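(* Let $V:\mathbb{R}_+\times\mathbb{R}^d\times\mathbb{R}^N\to\mathbb{R}^d$ be an $L$-Lipschitz continuous function, where $\mathbb{R}_+=[0,+\infty[$. Consider the Cauchy problem $$\partial_t u+\mathrm{div}\,[u\,V(t,x,u\ast\eta)]=0,\qquad u(0,\cdot)=u_0. \tag{P}$$ Then: (i) If $\eta\in BV(\mathbb{R}^d;\mathbb{R}^N)$ and $u_0\in L^\infty(\mathbb{R}^d)$, then there exist $T^\ast>0$, depending only on $L$, $d$, $N$, $|D\eta|(\mathbb{R}^d)$ and $\|u_0\|_{L^\infty}$, and a distributional solution $u\in L^\infty_{\mathrm{loc}}([0,T^\ast[;L^\infty(\mathbb{R}^d))$ of (P) on $[0,T^\ast[$. (ii) Fix $p>1$ and let $q=p/(p-1)$. If $\eta\in W^{1,p}(\mathbb{R}^d;\mathbb{R}^N)$ and $u_0\in L^q(\mathbb{R}^d)$, then there exist $T^\ast_q>0$, depending only on $L$, $d$, $N$, $\|\nabla\eta\|_{L^p(\mathbb{R}^d;\mathbb{R}^{N\times d})}$ and $\|u_0\|_{L^q(\mathbb{R}^d)}$, and a distributional solution $u\in L^\infty_{\mathrm{loc}}([0,T^\ast_q[;L^q(\mathbb{R}^d))$ of (P) on $[0,T^\ast_q[$.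
   Context: Here $u:\mathbb{R}_+\times\mathbb{R}^d\to\mathbb{R}$ is the unknown, $\mathrm{div}$ is the divergence in the space variable only, and $\ast$ denotes convolution in the space variable only: $u\ast\eta(t,x)=\int_{\mathbb{R}^d}u(t,x-y)\eta(y)\,dy$. $|D\eta|(\mathbb{R}^d)$ is the total variation of $\eta$. Distributional solution: given $T>0$, $u_0\in L^1_{\mathrm{loc}}(\mathbb{R}^d)$, $u\in L^1_{\mathrm{loc}}(]0,T[\times\mathbb{R}^d)$ and $\eta\in L^1_{\mathrm{loc}}(\mathbb{R}^d;\mathbb{R}^N)$ with $u\ast\eta\in L^\infty(]0,T[\times\mathbb{R}^d;\mathbb{R}^N)$, $u$ is a distributional solution of (P) if for every $\varphi\in C^\infty_c([0,T[\times\mathbb{R}^d)$ $$\int_0^T\!\!\int_{\mathbb{R}^d}u\,[\partial_t\varphi+V(\cdot,\cdot,u\ast\eta)\cdot\nabla\varphi]\,dx\,dt+\int_{\mathbb{R}^d}u_0\,\varphi(0,\cdot)\,dx=0.$$ A distributional solution on $[0,T^\ast[$ means a distributional solution on $[0,T]$ for every $T<T^\ast$. *)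

theory Defs
  imports "HOL-Analysis.Analysis" "HOL-Probability.Essential_Supremum"
begin

definition pd :: "'a::euclidean_space \<Rightarrow> ('a \<Rightarrow> real) \<Rightarrow> 'a \<Rightarrow> real" where
  "pd v f x = frechet_derivative f (at x) v"

fun iter_pd :: "'a::euclidean_space list \<Rightarrow> ('a \<Rightarrow> real) \<Rightarrow> 'a \<Rightarrow> real" where
  "iter_pd [] f = f"
| "iter_pd (v # vs) f = pd v (iter_pd vs f)"

text \<open>C-infinity: all iterated partial derivatives exist and are (Frechet) differentiable
  everywhere (hence continuous).\<close>
definition Cinf :: "('a::euclidean_space \<Rightarrow> real) \<Rightarrow> bool" where
  "Cinf f \<longleftrightarrow> (\<forall>vs. set vs \<subseteq> Basis \<longrightarrow> (\<forall>x. iter_pd vs f differentiable (at x)))"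

definition C1_field :: "('a::euclidean_space \<Rightarrow> 'a) \<Rightarrow> bool" where
  "C1_field f \<longleftrightarrow> (\<forall>x. f differentiable (at x)) \<and>
     (\<forall>v. continuous_on UNIV (\<lambda>x. frechet_derivative f (at x) v))"

definition divg :: "('a::euclidean_space \<Rightarrow> 'a) \<Rightarrow> 'a \<Rightarrow> real" where
  "divg f x = (\<Sum>i\<in>Basis. frechet_derivative f (at x) i \<bullet> i)"

definition compact_supp :: "('a::euclidean_space \<Rightarrow> 'b::zero) \<Rightarrow> bool" where
  "compact_supp f \<longleftrightarrow> (\<exists>K. compact K \<and> (\<forall>x. x \<notin> K \<longrightarrow> f x = 0))"

definition Linf :: "('a::euclidean_space \<Rightarrow> real) \<Rightarrow> bool" where
  "Linf f \<longleftrightarrow> f \<in> borel_measurable lebesgue \<and> (\<exists>M. AE x in lebesgue. \<bar>f x\<bar> \<le> M)"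

definition Linf_norm :: "('a::euclidean_space \<Rightarrow> real) \<Rightarrow> real" where
  "Linf_norm f = real_of_ereal (esssup lebesgue (\<lambda>x. ereal \<bar>f x\<bar>))"

definition Lp :: "real \<Rightarrow> ('a::euclidean_space \<Rightarrow> 'b::euclidean_space) \<Rightarrow> bool" where
  "Lp p f \<longleftrightarrow> f \<in> borel_measurable lebesgue \<and> integrable lebesgue (\<lambda>x. norm (f x) powr p)"

definition Lp_norm :: "real \<Rightarrow> ('a::euclidean_space \<Rightarrow> 'b::euclidean_space) \<Rightarrow> real" where
  "Lp_norm p f = (LINT x|lebesgue. norm (f x) powr p) powr (1 / p)"

definition loc_integrable_on :: "'a::euclidean_space set \<Rightarrow> ('a \<Rightarrow> 'b::euclidean_space) \<Rightarrow> bool" where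
  "loc_integrable_on S f \<longleftrightarrow> (\<forall>K. compact K \<and> K \<subseteq> S \<longrightarrow> set_integrable lebesgue K f)"

text \<open>Admissible test fields for the total variation: \<Phi> j is the j-th row
  (j in the basis of R^N) of a C^1_c matrix field with (Frobenius) norm at most 1.\<close>
definition tv_set :: "('d::euclidean_space \<Rightarrow> 'n::euclidean_space) \<Rightarrow> real set" where
  "tv_set \<eta> = {(LINT x|lebesgue. (\<Sum>j\<in>Basis. (\<eta> x \<bullet> j) * divg (\<Phi> j) x)) | \<Phi> :: 'n \<Rightarrow> 'd \<Rightarrow> 'd.
      (\<forall>j\<in>Basis. C1_field (\<Phi> j) \<and> compact_supp (\<Phi> j)) \<and>
      (\<forall>x. (\<Sum>j\<in>Basis. (norm (\<Phi> j x))\<^sup>2) \<le> 1)}"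

definition total_variation :: "('d::euclidean_space \<Rightarrow> 'n::euclidean_space) \<Rightarrow> real" where
  "total_variation \<eta> = Sup (tv_set \<eta>)"

definition is_BV :: "('d::euclidean_space \<Rightarrow> 'n::euclidean_space) \<Rightarrow> bool" where
  "is_BV \<eta> \<longleftrightarrow> integrable lebesgue \<eta> \<and> bdd_above (tv_set \<eta>)"

definition weak_grad :: "('d::euclidean_space \<Rightarrow> 'n::euclidean_space) \<Rightarrow> ('n \<Rightarrow> 'd \<Rightarrow> 'd) \<Rightarrow> bool" where
  "weak_grad \<eta> G \<longleftrightarrow> (\<forall>j\<in>Basis. loc_integrable_on UNIV (G j)) \<and>
     (\<forall>\<psi>. Cinf \<psi> \<and> compact_supp \<psi> \<longrightarrow> (\<forall>j\<in>Basis. \<forall>i\<in>Basis.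
        (LINT x|lebesgue. (\<eta> x \<bullet> j) * pd i \<psi> x) = - (LINT x|lebesgue. (G j x \<bullet> i) * \<psi> x)))"

definition frob :: "('n::euclidean_space \<Rightarrow> 'd::euclidean_space \<Rightarrow> 'd) \<Rightarrow> 'd \<Rightarrow> real" where
  "frob G x = sqrt (\<Sum>j\<in>Basis. (norm (G j x))\<^sup>2)"

definition conv :: "(real \<times> 'd::euclidean_space \<Rightarrow> real) \<Rightarrow> ('d \<Rightarrow> 'n::euclidean_space) \<Rightarrow> real \<times> 'd \<Rightarrow> 'n" where
  "conv u \<eta> z = (LINT y|lebesgue. u (fst z, snd z - y) *\<^sub>R \<eta> y)"

definition test_fun :: "real \<Rightarrow> (real \<times> 'd::euclidean_space \<Rightarrow> real) \<Rightarrow> bool" where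
  "test_fun T \<phi> \<longleftrightarrow> Cinf \<phi> \<and>
     (\<exists>K. compact K \<and> K \<subseteq> {..<T} \<times> UNIV \<and> (\<forall>z. z \<notin> K \<longrightarrow> \<phi> z = 0))"

definition dt :: "(real \<times> 'd::euclidean_space \<Rightarrow> real) \<Rightarrow> real \<times> 'd \<Rightarrow> real" where
  "dt \<phi> z = pd (1, 0) \<phi> z"

definition gradx :: "(real \<times> 'd::euclidean_space \<Rightarrow> real) \<Rightarrow> real \<times> 'd \<Rightarrow> 'd" where
  "gradx \<phi> z = (\<Sum>i\<in>Basis. pd (0, i) \<phi> z *\<^sub>R i)"

definition dist_sol :: "(real \<Rightarrow> 'd::euclidean_space \<Rightarrow> 'n::euclidean_space \<Rightarrow> 'd) \<Rightarrow> ('d \<Rightarrow> 'n)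
     \<Rightarrow> ('d \<Rightarrow> real) \<Rightarrow> real \<Rightarrow> (real \<times> 'd \<Rightarrow> real) \<Rightarrow> bool" where
  "dist_sol V \<eta> u0 T u \<longleftrightarrow> 0 < T \<and>
     loc_integrable_on UNIV u0 \<and>
     loc_integrable_on ({0<..<T} \<times> UNIV) u \<and>
     loc_integrable_on UNIV \<eta> \<and>
     (\<lambda>z. indicator ({0<..<T} \<times> UNIV) z *\<^sub>R conv u \<eta> z) \<in> borel_measurable lebesgue \<and>
     (\<exists>M. AE z in lebesgue. z \<in> {0<..<T} \<times> UNIV \<longrightarrow>
          integrable lebesgue (\<lambda>y. u (fst z, snd z - y) *\<^sub>R \<eta> y) \<and> norm (conv u \<eta> z) \<le> M) \<and>
     (\<forall>\<phi>. test_fun T \<phi> \<longrightarrow>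
        set_integrable lebesgue ({0<..<T} \<times> UNIV)
          (\<lambda>z. u z * (dt \<phi> z + V (fst z) (snd z) (conv u \<eta> z) \<bullet> gradx \<phi> z)) \<and>
        (LINT z:{0<..<T} \<times> UNIV|lebesgue.
            u z * (dt \<phi> z + V (fst z) (snd z) (conv u \<eta> z) \<bullet> gradx \<phi> z))
        + (LINT x|lebesgue. u0 x * \<phi> (0, x)) = 0)"

definition dist_sol_upto :: "(real \<Rightarrow> 'd::euclidean_space \<Rightarrow> 'n::euclidean_space \<Rightarrow> 'd) \<Rightarrow> ('d \<Rightarrow> 'n)
     \<Rightarrow> ('d \<Rightarrow> real) \<Rightarrow> real \<Rightarrow> (real \<times> 'd \<Rightarrow> real) \<Rightarrow> bool" where
  "dist_sol_upto V \<eta> u0 Ts u \<longleftrightarrow> (\<forall>T. 0 < T \<and> T < Ts \<longrightarrow> dist_sol V \<eta> u0 T u)"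

definition Linf_loc_Linf :: "real \<Rightarrow> (real \<times> 'd::euclidean_space \<Rightarrow> real) \<Rightarrow> bool" where
  "Linf_loc_Linf Ts u \<longleftrightarrow> u \<in> borel_measurable lebesgue \<and>
     (\<forall>T. T < Ts \<longrightarrow> (\<exists>M. AE z in lebesgue. z \<in> {0<..<T} \<times> UNIV \<longrightarrow> \<bar>u z\<bar> \<le> M))"

definition Linf_loc_Lq :: "real \<Rightarrow> real \<Rightarrow> (real \<times> 'd::euclidean_space \<Rightarrow> real) \<Rightarrow> bool" where
  "Linf_loc_Lq q Ts u \<longleftrightarrow> u \<in> borel_measurable lebesgue \<and>
     (\<forall>T. T < Ts \<longrightarrow> (\<exists>M. AE t in lebesgue. 0 < t \<and> t < T \<longrightarrow>
         integrable lebesgue (\<lambda>x. \<bar>u (t, x)\<bar> powr q) \<and>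
         (LINT x|lebesgue. \<bar>u (t, x)\<bar> powr q) \<le> M))"

end

theory Submission
  imports Defs
begin

text \<open>
  Write \<open>w = u * \<eta>\<close>. If \<open>X t\<close> is the flow of the velocity \<open>V t x (w (t, x))\<close>, then \<open>u\<close> is the
  push-forward of \<open>u0\<close> along \<open>X\<close>, so \<open>w\<close> is a fixed point of \<open>w \<mapsto> W w\<close> with
  \<open>W w (t, z) = \<integral> u0 y \<eta> (z - X t y) dy\<close>. For short times \<open>X t\<close> is a perturbation of the identity by a
  map of Lipschitz constant 1/2, so composing with it costs only a dimensional constant in any
  \<open>L\<^sup>p\<close> norm. The hypotheses on \<open>\<eta>\<close> enter solely through the estimate of \<open>\<eta> (\<cdot> + h) - \<eta>\<close> in \<open>L\<^sup>1\<close>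
  (or \<open>L\<^sup>p\<close>) by a multiple of the norm of \<open>h\<close>. It makes \<open>W w\<close> Lipschitz in space and, by averaging over
  small balls, also controls how \<open>W w\<close> changes with \<open>X\<close>; hence the fixed point map is a contraction
  for the sup norm on a time interval of the required length. No compactness is needed.
\<close>

section \<open>Maps expanding distances by at least one half\<close>

text \<open>Since \<open>\<eta>\<close> may be discontinuous and unbounded and \<open>V\<close> is
  only Lipschitz, neither a pointwise comparison of \<open>\<eta> (z - X1 y)\<close> with
  \<open>\<eta> (z - X2 y)\<close> nor an everywhere defined Jacobian of the flow is at hand. Volume
  estimates replace both: if \<open>X\<close> has a 2-Lipschitz inverse on its range, preimages
  under \<open>X\<close> have at most 4 ^ d times the volume, which bounds integrals along
  \<open>X\<close> and also the Radon-Nikodym density of the transported Lebesgue measure. The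
  estimates of \<open>W X\<close> hold for all such \<open>X\<close> with one constant
  \<open>K\<close>, so the class of fields in which the fixed point is sought can be fixed before
  any flow is known. Two smallness conditions determine the length \<open>T\<close> of the time
  interval: \<open>T * L * (1 + K) \<le> 1 / 3\<close> makes the Picard map a 1/3-contraction,
  whence displacements have constant (1/3) / (1 - 1/3) = 1/2; the other makes the field map a
  1/2-contraction. In the Sobolev case Young's inequality with a free scale replaces Hoelder's, so
  \<open>K\<close> is not a product of norms, but it still depends only on the two norms, p and the
  dimensions.\<close>

definition expanding :: "('d::euclidean_space \<Rightarrow> 'd) \<Rightarrow> bool" where
  "expanding X \<longleftrightarrow> continuous_on UNIV X \<and> (\<forall>x y. norm (x - y) \<le> 2 * norm (X x - X y))"

lemma expanding_measurable [measurable_dest]: "expanding X \<Longrightarrow> X \<in> borel_measurable borel"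
  unfolding expanding_def by (auto intro: borel_measurable_continuous_onI)

text \<open>Reflections and translations preserve distances, so every estimate for
  \<open>\<eta> (X y)\<close> applies to the integrand \<open>\<eta> (z - X y)\<close> of the
  convolution, uniformly in \<open>z\<close>.\<close>

lemma expanding_diff_const: "expanding X \<Longrightarrow> expanding (\<lambda>y. z - X y)"
  unfolding expanding_def by (auto intro!: continuous_intros simp: norm_minus_commute)

text \<open>The triangle inequality bounds the distance of two points by that of their images plus
  half of itself; absorbing the half gives the factor 2.\<close>

lemma expanding_id_plus:
  assumes "\<And>x y. norm ((X x - x) - (X y - y)) \<le> norm (x - y) / 2"
  shows "expanding X"
  unfolding expanding_def
proof
  have "2-lipschitz_on UNIV X"
  proof (rule lipschitz_onI)
    fix x y
    have "norm (X x - X y) \<le> norm ((X x - x) - (X y - y)) + norm (x - y)"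
      by (rule order_trans[OF _ norm_triangle_ineq]) (simp add: algebra_simps)
    with assms[of x y] show "dist (X x) (X y) \<le> 2 * dist x y"
      unfolding dist_norm using norm_ge_zero[of "x - y"] by linarith
  qed simp
  then show "continuous_on UNIV X"
    by (rule lipschitz_on_continuous_on)
  show "\<forall>x y. norm (x - y) \<le> 2 * norm (X x - X y)"
  proof (intro allI)
    fix x y
    have "norm (x - y) \<le> norm (X x - X y) + norm ((X x - x) - (X y - y))"
      by (rule order_trans[OF _ norm_triangle_ineq4]) (simp add: algebra_simps)
    with assms[of x y] show "norm (x - y) \<le> 2 * norm (X x - X y)" by linarith
  qed
qed

lemma emeasure_lborel_ball_scale:
  fixes c c' :: "'a::euclidean_space"
  assumes "k \<ge> 0" "r \<ge> 0"
  shows "emeasure lborel (ball c (k * r)) = ennreal (k ^ DIM('a)) * emeasure lborel (ball c' r)"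
proof -
  have e: "emeasure lborel (ball c r) = ennreal (measure lborel (ball c r))" for c::'a and r
    using emeasure_lborel_ball_finite[of c r] by (subst emeasure_eq_ennreal_measure) auto
  have "measure lborel (ball c (k * r)) = k ^ DIM('a) * measure lborel (ball c' r)"
    using assms by (simp add: content_ball_conv_unit_ball[of "k * r" c] content_ball_conv_unit_ball[of r c'] power_mult_distrib)
  then show ?thesis unfolding e using assms by (simp add: ennreal_mult)
qed

text \<open>Two points of the preimage have images less than 2 * e apart and are therefore less than
  4 * e apart, so the preimage lies in a ball of radius 4 * e about any of its points. This is the
  origin of the constant 4 ^ d.\<close>

lemma expanding_emeasure_vimage_ball:
  fixes X :: "'d::euclidean_space \<Rightarrow> 'd"
  assumes X: "expanding X" and "e > 0"
  shows "emeasure lborel {y. dist (X y) x < e} \<le> ennreal (4 ^ DIM('d)) * emeasure lborel (ball x e)"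
proof (cases "{y. dist (X y) x < e} = {}")
  case True
  show ?thesis unfolding True by simp
next
  case False
  then obtain y0 where y0: "dist (X y0) x < e" by auto
  have "{y. dist (X y) x < e} \<subseteq> ball y0 (4 * e)"
  proof safe
    fix y assume y: "dist (X y) x < e"
    have "norm (y0 - y) \<le> 2 * dist (X y0) (X y)"
      using X unfolding expanding_def dist_norm by auto
    also have "dist (X y0) (X y) < e + e"
      using y y0 by metric
    finally show "y \<in> ball y0 (4 * e)" by (simp add: dist_norm)
  qed
  then have "emeasure lborel {y. dist (X y) x < e} \<le> emeasure lborel (ball y0 (4 * e))"
    by (rule emeasure_mono) simp
  also have "\<dots> = ennreal (4 ^ DIM('d)) * emeasure lborel (ball x e)"
    using \<open>e > 0\<close> by (intro emeasure_lborel_ball_scale) auto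
  finally show ?thesis .
qed

text \<open>The averages of the indicator of \<open>U\<close> over small balls converge to 1 on \<open>U\<close>,
  and integrating them along \<open>X\<close> only involves volumes of preimages of balls.\<close>

lemma expanding_emeasure_vimage_open:
  fixes X :: "'d::euclidean_space \<Rightarrow> 'd"
  assumes X: "expanding X" and U: "open U"
  shows "emeasure lborel (X -` U) \<le> ennreal (4 ^ DIM('d)) * emeasure lborel U"
proof -
  note [measurable] = expanding_measurable[OF X] borel_open[OF U]
  define e where "e n = 1 / real (Suc n)" for n
  have e0: "e n > 0" for n by (simp add: e_def)
  define v where "v n = emeasure lborel (ball (0::'d) (e n))" for n
  have v: "emeasure lborel (ball x (e n)) = v n" for x :: "'d" and n
    using emeasure_lborel_ball_scale[of 1 "e n" x "0::'d"] e0[of n] by (simp add: v_def)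
  have v0: "v n \<noteq> 0" for n
  proof -
    have "v n = ennreal (measure lborel (ball (0::'d) (e n)))"
      unfolding v_def using emeasure_lborel_ball_finite[of "0::'d" "e n"]
      by (subst emeasure_eq_ennreal_measure) auto
    then show ?thesis using e0[of n] content_ball_pos[of "e n" "0::'d"] by simp
  qed
  have vt: "v n \<noteq> top" for n
    using emeasure_lborel_ball_finite[of "0::'d" "e n"] unfolding v_def by auto
  have iv: "v n * inverse (v n) = 1" for n
    using ennreal_divide_self[of "v n"] v0[of n] vt[of n] by (simp add: divide_ennreal_def top.not_eq_extremum)
  define k :: "nat \<Rightarrow> 'd \<Rightarrow> 'd \<Rightarrow> ennreal"
    where "k n x y = indicator U x * (if dist (X y) x < e n then 1 else 0) / v n" for n x y
  have k[measurable]: "case_prod (k n) \<in> borel_measurable (lborel \<Otimes>\<^sub>M lborel)" for n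
    unfolding k_def by measurable
  have int: "(\<integral>\<^sup>+y. (\<integral>\<^sup>+x. k n x y \<partial>lborel) \<partial>lborel) \<le> ennreal (4 ^ DIM('d)) * emeasure lborel U" for n
  proof -
    have "(\<integral>\<^sup>+y. (\<integral>\<^sup>+x. k n x y \<partial>lborel) \<partial>lborel) = (\<integral>\<^sup>+x. (\<integral>\<^sup>+y. k n x y \<partial>lborel) \<partial>lborel)"
      by (rule lborel_pair.Fubini') (rule k)
    also have "\<dots> \<le> (\<integral>\<^sup>+x. ennreal (4 ^ DIM('d)) * indicator U x \<partial>lborel)"
    proof (rule nn_integral_mono)
      fix x :: 'd
      have "(\<integral>\<^sup>+y. k n x y \<partial>lborel) = (\<integral>\<^sup>+y. indicator U x / v n * indicator {y. dist (X y) x < e n} y \<partial>lborel)"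
        unfolding k_def by (intro nn_integral_cong) (auto simp: indicator_def divide_ennreal_def)
      also have "\<dots> = indicator U x / v n * emeasure lborel {y. dist (X y) x < e n}"
        by (rule nn_integral_cmult_indicator) simp
      also have "\<dots> \<le> indicator U x / v n * (ennreal (4 ^ DIM('d)) * v n)"
        using expanding_emeasure_vimage_ball[OF X e0[of n], of x] unfolding v by (intro mult_left_mono) auto
      also have "\<dots> = ennreal (4 ^ DIM('d)) * indicator U x"
        using iv[of n] by (auto simp: indicator_def divide_ennreal_def mult_ac) (metis mult.assoc mult_1)
      finally show "(\<integral>\<^sup>+y. k n x y \<partial>lborel) \<le> ennreal (4 ^ DIM('d)) * indicator U x" .
    qed
    also have "\<dots> = ennreal (4 ^ DIM('d)) * emeasure lborel U"
      by (rule nn_integral_cmult_indicator) simp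
    finally show ?thesis .
  qed
  \<comment> \<open>If \<open>ball (X y) r\<close> lies in \<open>U\<close>, the average over
    \<open>ball (X y) (e n)\<close> is exactly 1 once \<open>e n < r\<close>. Fatou's lemma then
    carries the bound \<open>int\<close> over to the preimage.\<close>
  have lim: "indicator (X -` U) y \<le> liminf (\<lambda>n. \<integral>\<^sup>+x. k n x y \<partial>lborel)" for y
  proof (cases "X y \<in> U")
    case True
    then obtain r where r: "r > 0" "ball (X y) r \<subseteq> U" using U openE by blast
    have "eventually (\<lambda>n. e n < r) sequentially"
      unfolding e_def using r(1) by real_asymp
    then have "eventually (\<lambda>n. 1 \<le> (\<integral>\<^sup>+x. k n x y \<partial>lborel)) sequentially"
    proof eventually_elim
      case (elim n)
      have "(\<integral>\<^sup>+x. k n x y \<partial>lborel) = (\<integral>\<^sup>+x. inverse (v n) * indicator (ball (X y) (e n)) x \<partial>lborel)"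
        unfolding k_def using r(2) elim
        by (intro nn_integral_cong) (auto simp: indicator_def divide_ennreal_def subset_iff)
      also have "\<dots> = inverse (v n) * v n"
        by (subst nn_integral_cmult_indicator) (auto simp: v)
      also have "\<dots> = 1" using iv[of n] by (simp add: mult_ac)
      finally show ?case by simp
    qed
    then have "1 \<le> liminf (\<lambda>n. \<integral>\<^sup>+x. k n x y \<partial>lborel)" by (rule Liminf_bounded)
    then show ?thesis using True by simp
  qed simp
  have "emeasure lborel (X -` U) = (\<integral>\<^sup>+y. indicator (X -` U) y \<partial>lborel)"
    using measurable_sets_borel[OF expanding_measurable[OF X] borel_open[OF U]] by simp
  also have "\<dots> \<le> (\<integral>\<^sup>+y. liminf (\<lambda>n. \<integral>\<^sup>+x. k n x y \<partial>lborel) \<partial>lborel)"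
    by (intro nn_integral_mono lim)
  also have "\<dots> \<le> liminf (\<lambda>n. \<integral>\<^sup>+y. (\<integral>\<^sup>+x. k n x y \<partial>lborel) \<partial>lborel)"
    by (rule nn_integral_liminf) measurable
  also have "\<dots> \<le> limsup (\<lambda>n. \<integral>\<^sup>+y. (\<integral>\<^sup>+x. k n x y \<partial>lborel) \<partial>lborel)"
    by (rule Liminf_le_Limsup) simp
  also have "\<dots> \<le> ennreal (4 ^ DIM('d)) * emeasure lborel U"
    by (rule Limsup_bounded) (use int in auto)
  finally show ?thesis .
qed

text \<open>Outer regularity carries the bound from open to Borel sets. The excess is taken below e
  / 4 ^ d, so that it contributes at most e after multiplication.\<close>

lemma expanding_emeasure_vimage:
  fixes X :: "'d::euclidean_space \<Rightarrow> 'd"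
  assumes X: "expanding X" and B: "B \<in> sets borel"
  shows "emeasure lborel (X -` B) \<le> ennreal (4 ^ DIM('d)) * emeasure lborel B"
proof (rule ennreal_le_epsilon)
  fix e :: real assume e: "0 < e"
  obtain U where U: "open U" "B \<subseteq> U" "emeasure lborel (U - B) < ennreal (e / 4 ^ DIM('d))"
    using outer_regular_lborel[OF B, of "e / 4 ^ DIM('d)"] e by auto
  have "emeasure lborel (X -` B) \<le> emeasure lborel (X -` U)"
    using U measurable_sets_borel[OF expanding_measurable[OF X] borel_open[OF U(1)]]
    by (intro emeasure_mono) auto
  also have "\<dots> \<le> ennreal (4 ^ DIM('d)) * emeasure lborel U"
    by (rule expanding_emeasure_vimage_open[OF X U(1)])
  also have "emeasure lborel U = emeasure lborel B + emeasure lborel (U - B)"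
    using B U by (subst plus_emeasure) (auto intro!: arg_cong[where f = "emeasure lborel"])
  also have "ennreal (4 ^ DIM('d)) * (emeasure lborel B + emeasure lborel (U - B)) \<le>
      ennreal (4 ^ DIM('d)) * emeasure lborel B + ennreal (4 ^ DIM('d)) * ennreal (e / 4 ^ DIM('d))"
    unfolding distrib_left using U(3) by (intro add_left_mono mult_left_mono) auto
  also have "ennreal (4 ^ DIM('d)) * ennreal (e / 4 ^ DIM('d)) = ennreal e"
    using e by (simp add: ennreal_mult[symmetric])
  finally show "emeasure lborel (X -` B) \<le> ennreal (4 ^ DIM('d)) * emeasure lborel B + ennreal e" .
qed

lemma nn_integral_le_scale:
  assumes s: "sets N = sets M" and le: "\<And>A. A \<in> sets M \<Longrightarrow> emeasure N A \<le> c * emeasure M A"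
    and f: "f \<in> borel_measurable M"
  shows "(\<integral>\<^sup>+x. f x \<partial>N) \<le> c * (\<integral>\<^sup>+x. f x \<partial>M)"
proof -
  have "(\<integral>\<^sup>+x. f x \<partial>N) \<le> (\<integral>\<^sup>+x. f x \<partial>scale_measure c M)"
    using s le by (intro nn_integral_mono_measure) (auto simp: le_measure le_fun_def)
  also have "\<dots> = c * (\<integral>\<^sup>+x. f x \<partial>M)"
    using f by (rule nn_integral_scale_measure)
  finally show ?thesis .
qed

text \<open>Stands in for a change of variables with a Jacobian bound: the push-forward of Lebesgue
  measure under \<open>X\<close> is at most 4 ^ d times Lebesgue measure, and integrals are monotone
  in the measure.\<close>

lemma expanding_nn_integral:
  fixes X :: "'d::euclidean_space \<Rightarrow> 'd"
  assumes X: "expanding X" and f: "f \<in> borel_measurable borel"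
  shows "(\<integral>\<^sup>+y. f (X y) \<partial>lborel) \<le> ennreal (4 ^ DIM('d)) * (\<integral>\<^sup>+x. f x \<partial>lborel)"
proof -
  note [measurable] = expanding_measurable[OF X] f
  have "(\<integral>\<^sup>+y. f (X y) \<partial>lborel) = (\<integral>\<^sup>+x. f x \<partial>distr lborel borel X)"
    by (subst nn_integral_distr) auto
  also have "\<dots> \<le> ennreal (4 ^ DIM('d)) * (\<integral>\<^sup>+x. f x \<partial>lborel)"
    using expanding_emeasure_vimage[OF X]
    by (intro nn_integral_le_scale) (auto simp: emeasure_distr)
  finally show ?thesis .
qed

section \<open>Kernels transported by expanding maps\<close>

lemma nn_integral_lborel_translate:
  fixes f :: "'a::euclidean_space \<Rightarrow> ennreal"
  assumes [measurable]: "f \<in> borel_measurable borel"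
  shows "(\<integral>\<^sup>+x. f (c + x) \<partial>lborel) = (\<integral>\<^sup>+x. f x \<partial>lborel)"
proof -
  have "(\<integral>\<^sup>+x. f x \<partial>lborel) = (\<integral>\<^sup>+x. f x \<partial>distr lborel borel ((+) c))"
    by (simp add: lborel_distr_plus)
  also have "\<dots> = (\<integral>\<^sup>+x. f (c + x) \<partial>lborel)"
    by (rule nn_integral_distr) auto
  finally show ?thesis by simp
qed

text \<open>What the construction of the flow uses of the data. The bounds are uniform over all
  expanding maps because the flow depends on the unknown field. \<open>modulus\<close> drives the
  fixed point argument; \<open>tail\<close> serves continuity in time, where the flow is controlled
  on bounded sets only.\<close>

locale transported_kernel =
  fixes \<eta> :: "'d::euclidean_space \<Rightarrow> 'n::euclidean_space" and u0 :: "'d \<Rightarrow> real" and K :: real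
  assumes eta_borel [measurable]: "\<eta> \<in> borel_measurable borel"
    and u0_borel [measurable]: "u0 \<in> borel_measurable borel"
    and K_nonneg: "0 \<le> K"
    and bound: "\<exists>M. \<forall>X. expanding X \<longrightarrow>
          (\<integral>\<^sup>+y. ennreal (\<bar>u0 y\<bar> * norm (\<eta> (X y))) \<partial>lborel) \<le> ennreal M"
    and tail: "0 < e \<Longrightarrow> \<exists>r. \<forall>X. expanding X \<longrightarrow>
          (\<integral>\<^sup>+y. ennreal (\<bar>u0 y\<bar> * norm (\<eta> (X y))) * indicator {y. r < norm (X y)} y \<partial>lborel) \<le> ennreal e"
    and modulus: "expanding X \<Longrightarrow>
          (\<integral>\<^sup>+y. ennreal (\<bar>u0 y\<bar> * norm (\<eta> (X y + h) - \<eta> (X y))) \<partial>lborel) \<le> ennreal (K * norm h)"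
begin

definition W :: "('d \<Rightarrow> 'd) \<Rightarrow> 'd \<Rightarrow> 'n" where
  "W X z = (LINT y|lborel. u0 y *\<^sub>R \<eta> (z - X y))"

definition M where
  "M = (SOME M. 0 \<le> M \<and> (\<forall>X. expanding X \<longrightarrow>
          (\<integral>\<^sup>+y. ennreal (\<bar>u0 y\<bar> * norm (\<eta> (X y))) \<partial>lborel) \<le> ennreal M))"

lemma M: "0 \<le> M" "expanding X \<Longrightarrow> (\<integral>\<^sup>+y. ennreal (\<bar>u0 y\<bar> * norm (\<eta> (X y))) \<partial>lborel) \<le> ennreal M"
proof -
  obtain M' where M': "\<forall>X. expanding X \<longrightarrow>
          (\<integral>\<^sup>+y. ennreal (\<bar>u0 y\<bar> * norm (\<eta> (X y))) \<partial>lborel) \<le> ennreal M'"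
    using bound by auto
  have "0 \<le> max 0 M' \<and> (\<forall>X. expanding X \<longrightarrow>
          (\<integral>\<^sup>+y. ennreal (\<bar>u0 y\<bar> * norm (\<eta> (X y))) \<partial>lborel) \<le> ennreal (max 0 M'))"
    using M' by (auto intro: order_trans ennreal_leI)
  then have "0 \<le> M \<and> (\<forall>X. expanding X \<longrightarrow>
          (\<integral>\<^sup>+y. ennreal (\<bar>u0 y\<bar> * norm (\<eta> (X y))) \<partial>lborel) \<le> ennreal M)"
    unfolding M_def by (rule someI)
  then show "0 \<le> M" "expanding X \<Longrightarrow> (\<integral>\<^sup>+y. ennreal (\<bar>u0 y\<bar> * norm (\<eta> (X y))) \<partial>lborel) \<le> ennreal M"
    by auto
qed

lemma integrable_kernel:
  assumes X: "expanding X"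
  shows "integrable lborel (\<lambda>y. u0 y *\<^sub>R \<eta> (X y))"
proof -
  note [measurable] = expanding_measurable[OF X]
  show ?thesis
    using M(2)[OF X] by (auto simp: integrable_iff_bounded intro: le_less_trans)
qed

lemma integrable_W: "expanding X \<Longrightarrow> integrable lborel (\<lambda>y. u0 y *\<^sub>R \<eta> (z - X y))"
  by (rule integrable_kernel) (rule expanding_diff_const)

lemma norm_W_le:
  assumes X: "expanding X" shows "norm (W X z) \<le> M"
proof -
  note X' = expanding_diff_const[OF X, of z]
  have "ennreal (norm (W X z)) \<le> (\<integral>\<^sup>+y. ennreal (norm (u0 y *\<^sub>R \<eta> (z - X y))) \<partial>lborel)"
    unfolding W_def by (rule integral_norm_bound_ennreal[OF integrable_W[OF X]])
  also have "\<dots> \<le> ennreal M" using M(2)[OF X'] by simp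
  finally show ?thesis using M(1) by simp
qed

lemma ennreal_norm_W_diff_le:
  assumes X1: "expanding X1" and X2: "expanding X2"
  shows "ennreal (norm (W X1 z1 - W X2 z2)) \<le>
     (\<integral>\<^sup>+y. ennreal (\<bar>u0 y\<bar> * norm (\<eta> (z1 - X1 y) - \<eta> (z2 - X2 y))) \<partial>lborel)"
proof -
  have "W X1 z1 - W X2 z2 = (LINT y|lborel. u0 y *\<^sub>R \<eta> (z1 - X1 y) - u0 y *\<^sub>R \<eta> (z2 - X2 y))"
    unfolding W_def by (subst Bochner_Integration.integral_diff) (auto intro: integrable_W X1 X2)
  also have "ennreal (norm \<dots>) \<le> (\<integral>\<^sup>+y. ennreal (norm (u0 y *\<^sub>R \<eta> (z1 - X1 y) - u0 y *\<^sub>R \<eta> (z2 - X2 y))) \<partial>lborel)"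
    by (intro integral_norm_bound_ennreal Bochner_Integration.integrable_diff integrable_W X1 X2)
  finally show ?thesis by (simp add: scaleR_diff_right[symmetric])
qed

text \<open>A shift of \<open>z\<close> is a shift of the argument of \<open>\<eta>\<close> along
  the expanding map \<open>z2 - X y\<close>, so \<open>modulus\<close> applies. Since
  \<open>K\<close> does not depend on \<open>X\<close>, all fields produced by \<open>W\<close>
  share one Lipschitz bound.\<close>

lemma W_lipschitz:
  assumes X: "expanding X" shows "norm (W X z1 - W X z2) \<le> K * norm (z1 - z2)"
proof -
  have "ennreal (norm (W X z1 - W X z2)) \<le>
     (\<integral>\<^sup>+y. ennreal (\<bar>u0 y\<bar> * norm (\<eta> ((z2 - X y) + (z1 - z2)) - \<eta> (z2 - X y))) \<partial>lborel)"
    using ennreal_norm_W_diff_le[OF X X, of z1 z2] by (simp add: algebra_simps)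
  also have "\<dots> \<le> ennreal (K * norm (z1 - z2))"
    by (rule modulus) (rule expanding_diff_const[OF X])
  finally show ?thesis using K_nonneg by simp
qed

text \<open>Compare \<open>\<eta> (X1 y)\<close> and \<open>\<eta> (X2 y)\<close> with the average of \<open>\<eta>\<close> over
  \<open>ball (X1 y) \<delta>\<close>, which is contained in \<open>ball (X2 y) (2 * \<delta>)\<close>: this reduces the
  perturbation of the map to translations.\<close>

lemma modulus_perturb:
  assumes X1: "expanding X1" and X2: "expanding X2" and A [measurable]: "A \<in> sets borel"
    and \<delta>: "0 < \<delta>" and close: "\<And>y. y \<in> A \<Longrightarrow> norm (X1 y - X2 y) \<le> \<delta>"
  shows "(\<integral>\<^sup>+y. ennreal (\<bar>u0 y\<bar> * norm (\<eta> (X1 y) - \<eta> (X2 y))) * indicator A y \<partial>lborel)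
     \<le> ennreal ((1 + 2 * 2 ^ DIM('d)) * K * \<delta>)"
proof -
  note [measurable] = expanding_measurable[OF X1] expanding_measurable[OF X2]
  have ball [measurable]: "ball (0::'d) r \<in> sets borel" for r by simp
  define c where "c = emeasure lborel (ball (0::'d) \<delta>)"
  have ce: "c = ennreal (measure lborel (ball (0::'d) \<delta>))"
    unfolding c_def using emeasure_lborel_ball_finite[of "0::'d" "\<delta>"]
    by (subst emeasure_eq_ennreal_measure) auto
  have c0: "c \<noteq> 0" unfolding ce using \<delta> content_ball_pos[of \<delta> "0::'d"] by simp
  have ct: "c < top" unfolding ce by simp
  have c2: "emeasure lborel (ball (0::'d) (2 * \<delta>)) = ennreal (2 ^ DIM('d)) * c"
    unfolding c_def using \<delta> by (intro emeasure_lborel_ball_scale) auto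
  define D where "D X h y = ennreal (\<bar>u0 y\<bar> * norm (\<eta> (X y + h) - \<eta> (X y)))" for X :: "'d \<Rightarrow> 'd" and h y
  have D1 [measurable]: "(\<lambda>(h, y). D X1 h y) \<in> borel_measurable (lborel \<Otimes>\<^sub>M lborel)"
    and D2 [measurable]: "(\<lambda>(h, y). D X2 h y) \<in> borel_measurable (lborel \<Otimes>\<^sub>M lborel)"
    unfolding D_def by measurable
  have av: "(\<integral>\<^sup>+y. (\<integral>\<^sup>+h. D X h y * indicator (ball 0 r) h \<partial>lborel) \<partial>lborel)
      \<le> ennreal (K * r) * emeasure lborel (ball (0::'d) r)"
    if X: "expanding X" and r: "0 \<le> r" and [measurable]: "(\<lambda>(h, y). D X h y) \<in> borel_measurable (lborel \<Otimes>\<^sub>M lborel)" for X r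
  proof -
    note [measurable] = expanding_measurable[OF X]
    have "(\<integral>\<^sup>+y. (\<integral>\<^sup>+h. D X h y * indicator (ball 0 r) h \<partial>lborel) \<partial>lborel) =
      (\<integral>\<^sup>+h. (\<integral>\<^sup>+y. D X h y * indicator (ball 0 r) h \<partial>lborel) \<partial>lborel)"
      by (rule lborel_pair.Fubini') measurable
    also have "\<dots> \<le> (\<integral>\<^sup>+h. ennreal (K * r) * indicator (ball (0::'d) r) h \<partial>lborel)"
    proof (rule nn_integral_mono)
      fix h :: 'd
      have "(\<integral>\<^sup>+y. D X h y * indicator (ball 0 r) h \<partial>lborel) = (\<integral>\<^sup>+y. D X h y \<partial>lborel) * indicator (ball 0 r) h"
        by (rule nn_integral_multc) (simp add: D_def)
      also have "\<dots> \<le> ennreal (K * norm h) * indicator (ball 0 r) h"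
        using modulus[OF X, of h] unfolding D_def by (intro mult_right_mono) auto
      also have "\<dots> \<le> ennreal (K * r) * indicator (ball 0 r) h"
        using K_nonneg by (auto simp: indicator_def intro!: ennreal_leI mult_left_mono)
      finally show "(\<integral>\<^sup>+y. D X h y * indicator (ball 0 r) h \<partial>lborel) \<le> ennreal (K * r) * indicator (ball 0 r) h" .
    qed
    also have "\<dots> = ennreal (K * r) * emeasure lborel (ball (0::'d) r)"
      by (rule nn_integral_cmult_indicator) simp
    finally show ?thesis .
  qed
  define F where "F y = ennreal (\<bar>u0 y\<bar> * norm (\<eta> (X1 y) - \<eta> (X2 y)))" for y
  have F[measurable]: "F \<in> borel_measurable borel" unfolding F_def by measurable
  \<comment> \<open>For \<open>norm h < \<delta>\<close> the point \<open>X1 y + h\<close> equals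
    \<open>X2 y + (?a + h)\<close>, and \<open>?a + h\<close> has norm below
    \<open>2 * \<delta>\<close>. The triangle inequality through the value of \<open>\<eta>\<close>
    there is integrated over \<open>h\<close>; translating \<open>h\<close> by \<open>?a\<close>
    turns the second term into an integral over the ball of radius
    \<open>2 * \<delta>\<close>.\<close>
  have pt: "c * (F y * indicator A y) \<le> (\<integral>\<^sup>+h. D X1 h y * indicator (ball 0 \<delta>) h \<partial>lborel)
        + (\<integral>\<^sup>+h. D X2 h y * indicator (ball 0 (2 * \<delta>)) h \<partial>lborel)" for y
  proof (cases "y \<in> A")
    case True
    let ?a = "X1 y - X2 y"
    have "c * (F y * indicator A y) = (\<integral>\<^sup>+h. F y * indicator (ball (0::'d) \<delta>) h \<partial>lborel)"
      unfolding c_def using True by (subst nn_integral_cmult_indicator) (auto simp: mult.commute)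
    also have "\<dots> \<le> (\<integral>\<^sup>+h. D X1 h y * indicator (ball 0 \<delta>) h
        + D X2 (?a + h) y * indicator (ball 0 (2 * \<delta>)) (?a + h) \<partial>lborel)"
    proof (rule nn_integral_mono)
      fix h :: 'd
      show "F y * indicator (ball (0::'d) \<delta>) h \<le> D X1 h y * indicator (ball 0 \<delta>) h
        + D X2 (?a + h) y * indicator (ball 0 (2 * \<delta>)) (?a + h)"
      proof (cases "norm h < \<delta>")
        case h: True
        have "norm (?a + h) < 2 * \<delta>"
          using norm_triangle_ineq[of ?a h] close[OF True] h by linarith
        moreover have "\<bar>u0 y\<bar> * norm (\<eta> (X1 y) - \<eta> (X2 y)) \<le>
            \<bar>u0 y\<bar> * norm (\<eta> (X1 y + h) - \<eta> (X1 y)) + \<bar>u0 y\<bar> * norm (\<eta> (X2 y + (?a + h)) - \<eta> (X2 y))"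
          unfolding distrib_left[symmetric]
          by (intro mult_left_mono) (auto simp: norm_minus_commute intro: order_trans[OF _ norm_triangle_ineq4])
        ultimately show ?thesis
          using h by (simp add: F_def D_def ennreal_plus[symmetric] del: ennreal_plus)
      qed simp
    qed
    also have "\<dots> = (\<integral>\<^sup>+h. D X1 h y * indicator (ball 0 \<delta>) h \<partial>lborel)
        + (\<integral>\<^sup>+h. D X2 (?a + h) y * indicator (ball 0 (2 * \<delta>)) (?a + h) \<partial>lborel)"
      unfolding D_def by (rule nn_integral_add) measurable
    also have "(\<integral>\<^sup>+h. D X2 (?a + h) y * indicator (ball 0 (2 * \<delta>)) (?a + h) \<partial>lborel) =
        (\<integral>\<^sup>+h. D X2 h y * indicator (ball 0 (2 * \<delta>)) h \<partial>lborel)"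
      by (rule nn_integral_lborel_translate[where f = "\<lambda>h. D X2 h y * indicator (ball 0 (2 * \<delta>)) h"])
         (unfold D_def, measurable)
    finally show ?thesis .
  qed simp
  have "c * (\<integral>\<^sup>+y. F y * indicator A y \<partial>lborel) = (\<integral>\<^sup>+y. c * (F y * indicator A y) \<partial>lborel)"
    by (rule nn_integral_cmult[symmetric]) measurable
  also have "\<dots> \<le> (\<integral>\<^sup>+y. (\<integral>\<^sup>+h. D X1 h y * indicator (ball 0 \<delta>) h \<partial>lborel)
        + (\<integral>\<^sup>+h. D X2 h y * indicator (ball 0 (2 * \<delta>)) h \<partial>lborel) \<partial>lborel)"
    by (intro nn_integral_mono pt)
  also have "\<dots> = (\<integral>\<^sup>+y. (\<integral>\<^sup>+h. D X1 h y * indicator (ball 0 \<delta>) h \<partial>lborel) \<partial>lborel)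
        + (\<integral>\<^sup>+y. (\<integral>\<^sup>+h. D X2 h y * indicator (ball 0 (2 * \<delta>)) h \<partial>lborel) \<partial>lborel)"
    by (rule nn_integral_add) (unfold D_def, measurable)
  \<comment> \<open>The first term has shifts up to \<open>\<delta>\<close> over a ball of volume
    \<open>c\<close>, the second has shifts up to \<open>2 * \<delta>\<close> over a ball of volume
    2 ^ d times \<open>c\<close>. Their sum explains the factor
    \<open>1 + 2 * 2 ^ DIM('d)\<close>.\<close>
  also have "\<dots> \<le> ennreal (K * \<delta>) * c + ennreal (K * (2 * \<delta>)) * (ennreal (2 ^ DIM('d)) * c)"
    using av[OF X1 _ D1, of \<delta>] av[OF X2 _ D2, of "2 * \<delta>"] \<delta> unfolding c2 c_def[symmetric]
    by (intro add_mono) auto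
  also have "\<dots> = c * ennreal ((1 + 2 * 2 ^ DIM('d)) * K * \<delta>)"
    unfolding ce using K_nonneg \<delta>
    by (simp add: ennreal_mult[symmetric] ennreal_plus[symmetric] algebra_simps del: ennreal_plus)
  finally have "c * (\<integral>\<^sup>+y. F y * indicator A y \<partial>lborel) \<le> c * ennreal ((1 + 2 * 2 ^ DIM('d)) * K * \<delta>)" .
  then show ?thesis
    using c0 ct by (simp add: ennreal_mult_le_mult_iff F_def top.not_eq_extremum)
qed

end

section \<open>The nonlocal flow\<close>

text \<open>\<open>T_flow\<close> makes the Picard map contract by 1/3. In
  \<open>T_contraction\<close> the factor \<open>3 / 2 * (T * L)\<close> is the sensitivity of the
  flow to the field, and the factor before it is the constant of \<open>modulus_perturb\<close>.
  Here \<open>V\<close> is Lipschitz for all real times; negative times are supplied later by an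
  extension.\<close>

locale nonlocal_flow = transported_kernel \<eta> u0 K
  for \<eta> :: "'d::euclidean_space \<Rightarrow> 'n::euclidean_space" and u0 :: "'d \<Rightarrow> real" and K :: real +
  fixes V :: "real \<Rightarrow> 'd \<Rightarrow> 'n \<Rightarrow> 'd" and L T :: real
  assumes V_lipschitz: "L-lipschitz_on UNIV (\<lambda>(t, x, w). V t x w)"
    and T_pos: "0 < T"
    and T_flow: "T * L * (1 + K) \<le> 1 / 3"
    and T_contraction: "(1 + 2 * 2 ^ DIM('d)) * K * (3 / 2 * (T * L)) \<le> 1 / 2"
begin

lemma L_nonneg: "0 \<le> L"
  using V_lipschitz by (rule lipschitz_on_nonneg)

lemma V_diff_le: "norm (V t x w - V t y v) \<le> L * (norm (x - y) + norm (w - v))"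
proof -
  have "norm (V t x w - V t y v) \<le> L * dist (t, x, w) (t, y, v)"
    using lipschitz_onD[OF V_lipschitz, of "(t, x, w)" "(t, y, v)"] by (simp add: dist_norm)
  also have "dist (t, x, w) (t, y, v) \<le> norm (x - y) + norm (w - v)"
    using sqrt_sum_squares_le_sum[of "dist x y" "dist w v"]
    unfolding dist_Pair_Pair by (simp add: dist_norm)
  finally show ?thesis using L_nonneg by (simp add: mult_left_mono)
qed

lemma continuous_on_V [continuous_intros]:
  assumes "continuous_on S f" "continuous_on S g" "continuous_on S h"
  shows "continuous_on S (\<lambda>s. V (f s) (g s) (h s))"
proof -
  have "continuous_on S (\<lambda>s. (\<lambda>(t, x, w). V t x w) (f s, g s, h s))"
    by (rule continuous_on_compose2[OF lipschitz_on_continuous_on[OF V_lipschitz]])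
       (auto intro!: continuous_intros assms)
  then show ?thesis by simp
qed

text \<open>The set in which the fixed point is sought. Its constant is the \<open>K\<close> of
  \<open>modulus\<close>, so \<open>W_lipschitz\<close> makes the set invariant; in time only the
  continuity contained in the type is asked.\<close>

definition admissible :: "((real \<times> 'd) \<Rightarrow>\<^sub>C 'n) \<Rightarrow> bool" where
  "admissible w \<longleftrightarrow> (\<forall>t x y. norm (w (t, x) - w (t, y)) \<le> K * norm (x - y))"

text \<open>Freezes trajectories outside \<open>{0..T}\<close>. They become bounded continuous
  functions on the whole line, a complete space for the sup norm.\<close>

definition clip :: "real \<Rightarrow> real" where "clip t = max 0 (min T t)"

lemma clip [simp]: "clip t \<in> {0..T}" "0 \<le> clip t" "clip t \<le> T" "0 \<le> t \<Longrightarrow> t \<le> T \<Longrightarrow> clip t = t"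
  using T_pos by (auto simp: clip_def)

definition vel :: "((real \<times> 'd) \<Rightarrow>\<^sub>C 'n) \<Rightarrow> real \<Rightarrow> 'd \<Rightarrow> 'd" where
  "vel w s x = V s x (w (s, x))"

lemma continuous_on_vel [continuous_intros]:
  assumes "continuous_on S f" "continuous_on S g"
  shows "continuous_on S (\<lambda>s. vel w (f s) (g s))"
  unfolding vel_def
  by (intro continuous_intros assms continuous_on_compose2[OF continuous_on_apply_bcontfun[of UNIV w]]) auto

lemma vel_diff_le:
  assumes "admissible w1"
  shows "norm (vel w1 s x - vel w2 s y) \<le> L * (1 + K) * norm (x - y) + L * dist w1 w2"
proof -
  have "norm (vel w1 s x - vel w2 s y) \<le> L * (norm (x - y) + norm (w1 (s, x) - w2 (s, y)))"
    unfolding vel_def by (rule V_diff_le)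
  also have "\<dots> \<le> L * ((1 + K) * norm (x - y) + dist w1 w2)"
  proof (rule mult_left_mono[OF _ L_nonneg])
    have "norm (w1 (s, x) - w2 (s, y)) \<le> norm (w1 (s, x) - w1 (s, y)) + norm (w1 (s, y) - w2 (s, y))"
      by (rule order_trans[OF _ norm_triangle_ineq]) simp
    moreover have "norm (w1 (s, x) - w1 (s, y)) \<le> K * norm (x - y)"
      using assms unfolding admissible_def by blast
    moreover have "norm (w1 (s, y) - w2 (s, y)) \<le> dist w1 w2"
      using dist_bounded[of w1 "(s, y)" w2] by (simp add: dist_norm)
    ultimately show "norm (x - y) + norm (w1 (s, x) - w2 (s, y)) \<le> (1 + K) * norm (x - y) + dist w1 w2"
      by (simp add: distrib_right)
  qed
  finally show ?thesis by (simp add: algebra_simps)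
qed

definition picard_fun :: "((real \<times> 'd) \<Rightarrow>\<^sub>C 'n) \<Rightarrow> 'd \<Rightarrow> (real \<Rightarrow>\<^sub>C 'd) \<Rightarrow> real \<Rightarrow> 'd" where
  "picard_fun w x f t = x + integral {0..clip t} (\<lambda>s. vel w s (f s))"

lemma vel_along_integrable: "(\<lambda>s. vel w s (apply_bcontfun f s)) integrable_on {0..a}"
  by (intro integrable_continuous_interval continuous_intros) auto

lemma picard_fun_bcontfun: "picard_fun w x f \<in> bcontfun"
proof -
  have c: "continuous_on {0..T} (\<lambda>t. x + integral {0..t} (\<lambda>s. vel w s (f s)))"
    by (intro continuous_intros indefinite_integral_continuous_1 vel_along_integrable)
  have "continuous_on UNIV (\<lambda>t. (\<lambda>t. x + integral {0..t} (\<lambda>s. vel w s (f s))) (clip t))"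
    by (rule continuous_on_compose2[OF c]) (auto simp: clip_def T_pos less_imp_le intro!: continuous_intros)
  moreover have "bounded ((\<lambda>t. x + integral {0..t} (\<lambda>s. vel w s (f s))) ` {0..T})"
    by (intro compact_imp_bounded compact_continuous_image c) simp
  then have "bounded (range (picard_fun w x f))"
    by (rule bounded_subset) (auto simp: picard_fun_def)
  ultimately show ?thesis
    unfolding bcontfun_def picard_fun_def by simp
qed

text \<open>For displacements the starting points drop out and only terms with a factor
  \<open>T * L\<close> remain. Allowing different starting points and fields lets this one estimate
  serve the Picard contraction, the dependence on the starting point and the dependence on the
  field.\<close>

lemma picard_diff_le:
  assumes w1: "admissible w1"
  shows "norm ((picard_fun w1 x f t - x) - (picard_fun w2 y g t - y)) \<le>
     dist f g / 3 + T * L * dist w1 w2"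
proof -
  have "norm ((picard_fun w1 x f t - x) - (picard_fun w2 y g t - y)) =
      norm (integral {0..clip t} (\<lambda>s. vel w1 s (f s) - vel w2 s (g s)))"
    unfolding picard_fun_def
    by (subst integral_diff[OF vel_along_integrable vel_along_integrable]) simp
  also have "\<dots> \<le> (L * (1 + K) * dist f g + L * dist w1 w2) * (clip t - 0)"
  proof (rule integral_bound)
    show "continuous_on {0..clip t} (\<lambda>s. vel w1 s (f s) - vel w2 s (g s))"
      by (intro continuous_intros) auto
    fix s
    have "norm (vel w1 s (f s) - vel w2 s (g s)) \<le> L * (1 + K) * norm (f s - g s) + L * dist w1 w2"
      by (rule vel_diff_le[OF w1])
    also have "\<dots> \<le> L * (1 + K) * dist f g + L * dist w1 w2"
      using dist_bounded[of f s g] L_nonneg K_nonneg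
      by (intro add_right_mono mult_left_mono) (auto simp: dist_norm)
    finally show "norm (vel w1 s (f s) - vel w2 s (g s)) \<le> L * (1 + K) * dist f g + L * dist w1 w2" .
  qed simp
  also have "\<dots> \<le> (L * (1 + K) * dist f g + L * dist w1 w2) * T"
    using clip(3)[of t] L_nonneg K_nonneg by (intro mult_left_mono) auto
  also have "\<dots> = (T * L * (1 + K)) * dist f g + T * L * dist w1 w2"
    by (simp add: algebra_simps)
  also have "\<dots> \<le> 1 / 3 * dist f g + T * L * dist w1 w2"
    using T_flow by (intro add_right_mono mult_right_mono) auto
  finally show ?thesis by simp
qed

definition flow :: "((real \<times> 'd) \<Rightarrow>\<^sub>C 'n) \<Rightarrow> 'd \<Rightarrow> real \<Rightarrow>\<^sub>C 'd" where
  "flow w x = (SOME f. apply_bcontfun f = picard_fun w x f)"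

text \<open>Banach's theorem for the 1/3-contraction on bounded continuous trajectories provides a
  witness for the choice in \<open>flow\<close>.\<close>

lemma flow_eq:
  assumes "admissible w" shows "flow w x t = picard_fun w x (flow w x) t"
proof -
  have "\<exists>!f. Bcontfun (picard_fun w x f) = f"
  proof (rule banach_fix_type[of "1/3"])
    show "\<forall>f g. dist (Bcontfun (picard_fun w x f)) (Bcontfun (picard_fun w x g)) \<le> 1 / 3 * dist f g"
      using picard_diff_le[OF assms, of x _ _ w x]
      by (intro allI dist_bound) (simp add: Bcontfun_inverse[OF picard_fun_bcontfun] dist_norm)
  qed auto
  then have "\<exists>f. apply_bcontfun f = picard_fun w x f"
    using Bcontfun_inverse[OF picard_fun_bcontfun] by metis
  then have "apply_bcontfun (flow w x) = picard_fun w x (flow w x)"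
    unfolding flow_def by (rule someI_ex)
  then show ?thesis by simp
qed

text \<open>Let D be the distance of the trajectories, a that of the starting points and b =
  \<open>T * L * dist w1 w2\<close>. The Picard estimate gives D <= a + D / 3 + b, hence D <= 3 / 2
  (a + b); used once more, it bounds the difference of displacements by a / 2 + 3 / 2 b. The term a
  / 2 is what makes the flow expanding.\<close>

lemma flow_diff_le:
  assumes "admissible w1" "admissible w2"
  shows "dist (flow w1 x) (flow w2 y) \<le> 3 / 2 * (norm (x - y) + T * L * dist w1 w2)"
    and "norm ((flow w1 x t - x) - (flow w2 y t - y)) \<le> norm (x - y) / 2 + 3 / 2 * (T * L * dist w1 w2)"
proof -
  let ?D = "dist (flow w1 x) (flow w2 y)"
  have *: "norm ((flow w1 x t - x) - (flow w2 y t - y)) \<le> ?D / 3 + T * L * dist w1 w2" for t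
    using picard_diff_le[OF assms(1), of x "flow w1 x" t w2 y "flow w2 y"]
    by (simp add: flow_eq[OF assms(1), symmetric] flow_eq[OF assms(2), symmetric])
  have "?D \<le> norm (x - y) + (?D / 3 + T * L * dist w1 w2)"
  proof (rule dist_bound)
    fix t
    have "dist (flow w1 x t) (flow w2 y t) \<le> norm (x - y) + norm ((flow w1 x t - x) - (flow w2 y t - y))"
      unfolding dist_norm by (rule order_trans[OF _ norm_triangle_ineq]) (simp add: algebra_simps)
    with *[of t] show "dist (flow w1 x t) (flow w2 y t) \<le> norm (x - y) + (?D / 3 + T * L * dist w1 w2)"
      by linarith
  qed
  then show D: "?D \<le> 3 / 2 * (norm (x - y) + T * L * dist w1 w2)" by simp
  show "norm ((flow w1 x t - x) - (flow w2 y t - y)) \<le> norm (x - y) / 2 + 3 / 2 * (T * L * dist w1 w2)"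
    using *[of t] D by argo
qed

lemma flow_displacement:
  "admissible w \<Longrightarrow> norm ((flow w x t - x) - (flow w y t - y)) \<le> norm (x - y) / 2"
  using flow_diff_le(2)[of w w x t y] by simp

lemma expanding_flow: "admissible w \<Longrightarrow> expanding (\<lambda>y. flow w y t)"
  by (intro expanding_id_plus flow_displacement)

text \<open>Joint continuity comes from continuity in time for each fixed \<open>y\<close> together
  with a Lipschitz bound in \<open>y\<close> that is uniform in time.\<close>

lemma continuous_flow:
  assumes w: "admissible w" shows "continuous_on UNIV (\<lambda>(t, y). flow w y t)"
proof -
  have "((\<lambda>z. flow w (snd z) (fst z)) \<longlongrightarrow> flow w y t) (at (t, y))" for t y
  proof -
    have a: "((\<lambda>z. flow w y (fst z)) \<longlongrightarrow> flow w y t) (at (t, y))"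
    proof (rule isCont_tendsto_compose[of t "flow w y"])
      show "isCont (flow w y) t"
        using continuous_on_apply_bcontfun[of UNIV "flow w y"] continuous_on_eq_continuous_at[OF open_UNIV] by blast
    qed (auto intro!: tendsto_eq_intros)
    have b: "((\<lambda>z. flow w (snd z) (fst z) - flow w y (fst z)) \<longlongrightarrow> 0) (at (t, y))"
    proof (rule Lim_null_comparison)
      show "eventually (\<lambda>z. norm (flow w (snd z) (fst z) - flow w y (fst z)) \<le> 3 / 2 * norm (snd z - y)) (at (t, y))"
      proof (intro always_eventually allI)
        fix z :: "real \<times> 'd"
        show "norm (flow w (snd z) (fst z) - flow w y (fst z)) \<le> 3 / 2 * norm (snd z - y)"
          using order_trans[OF dist_bounded flow_diff_le(1)[OF w w, of "snd z" y], of "fst z"] by (simp add: dist_norm)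
      qed
      show "((\<lambda>z. 3 / 2 * norm (snd z - y)) \<longlongrightarrow> 0) (at (t, y))"
        by (auto intro!: tendsto_eq_intros)
    qed
    show ?thesis using tendsto_add[OF a b] by simp
  qed
  then show ?thesis
    by (auto simp: continuous_on_def case_prod_unfold)
qed

section \<open>Contraction and time continuity of the field map\<close>

lemma flow_W_dist_le:
  assumes w1: "admissible w1" and w2: "admissible w2"
  shows "norm (W (\<lambda>y. flow w1 y t) z - W (\<lambda>y. flow w2 y t) z) \<le> 1 / 2 * dist w1 w2"
\<comment> \<open>\<open>modulus_perturb\<close> averages over balls and needs a positive radius. In
  the degenerate case the radius below would be 0, but then the two flows coincide.\<close>
proof (cases "L = 0 \<or> w1 = w2")
  case True
  then have "flow w1 y t = flow w2 y t" for y
    using flow_diff_le(2)[OF w1 w2, of y t y] by auto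
  then show ?thesis by simp
next
  case False
  then have L: "0 < L" and d: "0 < dist w1 w2" using L_nonneg by auto
  \<comment> \<open>The bound of \<open>flow_diff_le\<close> on the distance of the two flows from a
    common starting point, uniform in that point.\<close>
  define \<delta> where "\<delta> = 3 / 2 * (T * L) * dist w1 w2"
  have \<delta>: "0 < \<delta>" using L d T_pos by (simp add: \<delta>_def)
  have "ennreal (norm (W (\<lambda>y. flow w1 y t) z - W (\<lambda>y. flow w2 y t) z)) \<le>
     (\<integral>\<^sup>+y. ennreal (\<bar>u0 y\<bar> * norm (\<eta> (z - flow w1 y t) - \<eta> (z - flow w2 y t))) \<partial>lborel)"
    by (intro ennreal_norm_W_diff_le expanding_flow w1 w2)
  also have "\<dots> = (\<integral>\<^sup>+y. ennreal (\<bar>u0 y\<bar> * norm (\<eta> (z - flow w1 y t) - \<eta> (z - flow w2 y t))) * indicator UNIV y \<partial>lborel)"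
    by simp
  also have "\<dots> \<le> ennreal ((1 + 2 * 2 ^ DIM('d)) * K * \<delta>)"
  proof (rule modulus_perturb[OF expanding_diff_const[OF expanding_flow[OF w1]]
          expanding_diff_const[OF expanding_flow[OF w2]] _ \<delta>])
    show "norm (z - flow w1 y t - (z - flow w2 y t)) \<le> \<delta>" for y
      using flow_diff_le(2)[OF w1 w2, of y t y] by (simp add: \<delta>_def norm_minus_commute algebra_simps)
  qed simp
  finally have "norm (W (\<lambda>y. flow w1 y t) z - W (\<lambda>y. flow w2 y t) z) \<le> (1 + 2 * 2 ^ DIM('d)) * K * \<delta>"
    using K_nonneg \<delta> by simp
  also have "\<dots> = (1 + 2 * 2 ^ DIM('d)) * K * (3 / 2 * (T * L)) * dist w1 w2"
    by (simp add: \<delta>_def)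
  also have "\<dots> \<le> 1 / 2 * dist w1 w2"
    using T_contraction by (intro mult_right_mono) auto
  finally show ?thesis .
qed

text \<open>The velocity may grow linearly in space, so the flow need not be continuous in time
  uniformly in \<open>y\<close>. Far points are handled by \<open>tail\<close>, a compact ball of
  starting points by uniform continuity and by \<open>modulus_perturb\<close> restricted to that
  ball.\<close>

lemma flow_W_continuous_time:
  assumes w: "admissible w"
  shows "((\<lambda>t. W (\<lambda>y. flow w y t) z) \<longlongrightarrow> W (\<lambda>y. flow w y s) z) (at s)"
proof (rule tendstoI)
  fix e :: real assume e: "0 < e"
  obtain r where r: "\<And>X. expanding X \<Longrightarrow>
          (\<integral>\<^sup>+y. ennreal (\<bar>u0 y\<bar> * norm (\<eta> (X y))) * indicator {y. r < norm (X y)} y \<partial>lborel) \<le> ennreal (e / 4)"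
    using tail[of "e / 4"] e by auto
  define C where "C = (1 + 2 * 2 ^ DIM('d)) * K"
  have C: "0 \<le> C" using K_nonneg by (simp add: C_def)
  \<comment> \<open>Leaves e / 4 for the compact part; the two tails cost e / 4 each, so the total
    is at most 3 / 4 of e.\<close>
  define \<delta> where "\<delta> = e / (4 * (C + 1))"
  have \<delta>: "0 < \<delta>" "C * \<delta> \<le> e / 4"
    using e C by (auto simp: \<delta>_def field_simps)
  obtain B where B: "\<And>t. norm (flow w 0 t) \<le> B"
    using bounded_apply_bcontfun[of "flow w 0"] unfolding bounded_iff by auto
  \<comment> \<open>A trajectory with \<open>norm (z - flow w y t) \<le> r\<close> at some time
    starts within \<open>R\<close> of 0: \<open>B\<close> bounds the trajectory of the origin, and
    \<open>expanding\<close> costs the factor 2.\<close>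
  define R where "R = 2 * (r + norm z + B)"
  have far: "r < norm (z - flow w y t)" if "R < norm y" for y t
  proof -
    have "norm (y - 0) \<le> 2 * norm (flow w y t - flow w 0 t)"
      using expanding_flow[OF w, of t] unfolding expanding_def by blast
    also have "norm (flow w y t - flow w 0 t) \<le> norm (z - flow w y t) + norm z + norm (flow w 0 t)"
      using norm_triangle_ineq4[of "flow w y t" "flow w 0 t"] norm_triangle_ineq4[of z "z - flow w y t"] by simp
    finally show ?thesis using B[of t] that unfolding R_def by simp
  qed
  have "uniformly_continuous_on ({s-1..s+1} \<times> cball 0 R) (\<lambda>(t, y). flow w y t)"
    by (intro compact_uniformly_continuous compact_Times continuous_on_subset[OF continuous_flow[OF w]]) auto
  then obtain d where d: "0 < d"
    and unif: "\<And>a b. a \<in> {s-1..s+1} \<times> cball 0 R \<Longrightarrow> b \<in> {s-1..s+1} \<times> cball 0 R \<Longrightarrow> dist b a < d \<Longrightarrow>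
        dist (case b of (t, y) \<Rightarrow> flow w y t) (case a of (t, y) \<Rightarrow> flow w y t) < \<delta>"
    unfolding uniformly_continuous_on_def using \<delta>(1) by blast
  have close: "norm (flow w y t - flow w y s) \<le> \<delta>" if "dist t s < min 1 d" "norm y \<le> R" for t y
  proof -
    have "dist (case (t, y) of (t, y) \<Rightarrow> flow w y t) (case (s, y) of (t, y) \<Rightarrow> flow w y t) < \<delta>"
      by (rule unif) (use that in \<open>auto simp: dist_Pair_Pair dist_real_def\<close>)
    then show ?thesis by (simp add: dist_norm)
  qed
  have "dist (W (\<lambda>y. flow w y t) z) (W (\<lambda>y. flow w y s) z) < e" if t: "dist t s < min 1 d" for t
  proof -
    let ?X = "\<lambda>t y. z - flow w y t"
    have X: "expanding (?X t)" for t by (intro expanding_diff_const expanding_flow w)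
    note [measurable] = expanding_measurable[OF X]
    have [measurable]: "cball (0::'d) R \<in> sets borel" by simp
    let ?g = "\<lambda>t y. ennreal (\<bar>u0 y\<bar> * norm (\<eta> (?X t y))) * indicator {y. r < norm (?X t y)} y"
    have "ennreal (dist (W (\<lambda>y. flow w y t) z) (W (\<lambda>y. flow w y s) z)) \<le>
       (\<integral>\<^sup>+y. ennreal (\<bar>u0 y\<bar> * norm (\<eta> (?X t y) - \<eta> (?X s y))) \<partial>lborel)"
      unfolding dist_norm by (intro ennreal_norm_W_diff_le expanding_flow w)
    also have "\<dots> \<le> (\<integral>\<^sup>+y. ennreal (\<bar>u0 y\<bar> * norm (\<eta> (?X t y) - \<eta> (?X s y))) * indicator (cball 0 R) y
        + (?g t y + ?g s y) \<partial>lborel)"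
    proof (rule nn_integral_mono)
      fix y
      show "ennreal (\<bar>u0 y\<bar> * norm (\<eta> (?X t y) - \<eta> (?X s y))) \<le>
        ennreal (\<bar>u0 y\<bar> * norm (\<eta> (?X t y) - \<eta> (?X s y))) * indicator (cball 0 R) y + (?g t y + ?g s y)"
      proof (cases "norm y \<le> R")
        case False
        have "\<bar>u0 y\<bar> * norm (\<eta> (?X t y) - \<eta> (?X s y)) \<le> \<bar>u0 y\<bar> * norm (\<eta> (?X t y)) + \<bar>u0 y\<bar> * norm (\<eta> (?X s y))"
          unfolding distrib_left[symmetric] by (intro mult_left_mono norm_triangle_ineq4) auto
        then show ?thesis
          using False far[of y t] far[of y s] by (simp add: ennreal_plus[symmetric] del: ennreal_plus)
      qed simp
    qed
    also have "\<dots> = (\<integral>\<^sup>+y. ennreal (\<bar>u0 y\<bar> * norm (\<eta> (?X t y) - \<eta> (?X s y))) * indicator (cball 0 R) y \<partial>lborel)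
        + ((\<integral>\<^sup>+y. ?g t y \<partial>lborel) + (\<integral>\<^sup>+y. ?g s y \<partial>lborel))"
      by (subst nn_integral_add, measurable, subst nn_integral_add) measurable
    also have "\<dots> \<le> ennreal (C * \<delta>) + (ennreal (e / 4) + ennreal (e / 4))"
      unfolding C_def
      by (intro add_mono modulus_perturb r X \<delta>) (use close[OF t] in \<open>auto simp: norm_minus_commute\<close>)
    also have "\<dots> = ennreal (C * \<delta> + (e / 4 + e / 4))"
      using C \<delta> e by (simp add: ennreal_plus[symmetric] del: ennreal_plus)
    finally have "dist (W (\<lambda>y. flow w y t) z) (W (\<lambda>y. flow w y s) z) \<le> C * \<delta> + (e / 4 + e / 4)"
      using C \<delta> e by (subst (asm) ennreal_le_iff) auto
    then show ?thesis using \<delta>(2) e by linarith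
  qed
  then show "\<forall>\<^sub>F t in at s. dist (W (\<lambda>y. flow w y t) z) (W (\<lambda>y. flow w y s) z) < e"
    using d unfolding eventually_at by (intro exI[of _ "min 1 d"]) auto
qed

definition W_fun :: "((real \<times> 'd) \<Rightarrow>\<^sub>C 'n) \<Rightarrow> real \<times> 'd \<Rightarrow> 'n" where
  "W_fun w p = W (\<lambda>y. flow w y (fst p)) (snd p)"

lemma W_fun_bcontfun:
  assumes w: "admissible w" shows "W_fun w \<in> bcontfun"
proof (rule bcontfun_normI)
  show "norm (W_fun w p) \<le> M" for p
    unfolding W_fun_def by (intro norm_W_le expanding_flow w)
  have "((\<lambda>p. W (\<lambda>y. flow w y (fst p)) (snd p)) \<longlongrightarrow> W (\<lambda>y. flow w y s) z) (at (s, z))" for s z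
  proof -
    have "isCont (\<lambda>t. W (\<lambda>y. flow w y t) z) s"
      unfolding isCont_def by (rule flow_W_continuous_time[OF w])
    then have a: "((\<lambda>p. W (\<lambda>y. flow w y (fst p)) z) \<longlongrightarrow> W (\<lambda>y. flow w y s) z) (at (s, z))"
      by (rule isCont_tendsto_compose) (auto intro!: tendsto_eq_intros)
    have b: "((\<lambda>p. W (\<lambda>y. flow w y (fst p)) (snd p) - W (\<lambda>y. flow w y (fst p)) z) \<longlongrightarrow> 0) (at (s, z))"
    proof (rule Lim_null_comparison)
      show "eventually (\<lambda>p. norm (W (\<lambda>y. flow w y (fst p)) (snd p) - W (\<lambda>y. flow w y (fst p)) z) \<le> K * norm (snd p - z)) (at (s, z))"
        by (intro always_eventually allI W_lipschitz expanding_flow w)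
      show "((\<lambda>p. K * norm (snd p - z)) \<longlongrightarrow> 0) (at (s, z))"
        by (auto intro!: tendsto_eq_intros)
    qed
    show ?thesis using tendsto_add[OF a b] by simp
  qed
  then show "continuous_on UNIV (W_fun w)"
    by (auto simp: continuous_on_def W_fun_def)
qed

text \<open>Banach's theorem on the admissible fields. They are closed because a Lipschitz bound
  survives pointwise limits, and invariant by \<open>W_lipschitz\<close>; the factor 1/2 is
  \<open>flow_W_dist_le\<close>.\<close>

lemma ex_fixed_field: "\<exists>w. admissible w \<and> (\<forall>t z. w (t, z) = W (\<lambda>y. flow w y t) z)"
proof -
  have ap: "apply_bcontfun (Bcontfun (W_fun w)) = W_fun w" if "admissible w" for w
    by (rule Bcontfun_inverse[OF W_fun_bcontfun[OF that]])
  have "\<exists>!w\<in>Collect admissible. Bcontfun (W_fun w) = w"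
  proof (rule Banach_fix[where c = "1 / 2" and f = "\<lambda>w. Bcontfun (W_fun w)"])
    have "closed (Collect admissible)"
    proof (unfold closed_sequential_limits, safe)
      fix v w assume v: "\<forall>n. v n \<in> Collect admissible" and lim: "v \<longlonglongrightarrow> w"
      have pt: "(\<lambda>n. v n p) \<longlonglongrightarrow> w p" for p
        using tendsto_bcontfun_uniform_limit[OF lim] by (rule tendsto_uniform_limitI) simp
      show "admissible w"
        unfolding admissible_def
      proof (intro allI)
        fix t x y
        have "(\<lambda>n. norm (v n (t, x) - v n (t, y))) \<longlonglongrightarrow> norm (w (t, x) - w (t, y))"
          by (intro tendsto_intros pt)
        then show "norm (w (t, x) - w (t, y)) \<le> K * norm (x - y)"
          by (rule LIMSEQ_le_const2) (use v in \<open>auto simp: admissible_def\<close>)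
      qed
    qed
    then show "complete (Collect admissible)" by (simp add: complete_eq_closed)
    have "admissible 0" by (simp add: admissible_def K_nonneg)
    then show "Collect admissible \<noteq> {}" by auto
    show "(\<lambda>w. Bcontfun (W_fun w)) ` Collect admissible \<subseteq> Collect admissible"
      by (auto simp: admissible_def[of "Bcontfun _"] ap W_fun_def intro!: W_lipschitz expanding_flow)
    show "dist (Bcontfun (W_fun w1)) (Bcontfun (W_fun w2)) \<le> 1 / 2 * dist w1 w2"
      if "w1 \<in> Collect admissible" "w2 \<in> Collect admissible" for w1 w2
    proof (rule dist_bound)
      show "dist (Bcontfun (W_fun w1) p) (Bcontfun (W_fun w2) p) \<le> 1 / 2 * dist w1 w2" for p
        using that flow_W_dist_le[of w1 w2 "fst p" "snd p"] by (simp add: ap W_fun_def dist_norm)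
    qed
  qed auto
  then obtain w where "admissible w" "Bcontfun (W_fun w) = w" by auto
  with ap[of w] show ?thesis unfolding W_fun_def by (metis fst_conv snd_conv)
qed

text \<open>Unpacks the fixed point into plain functions. Derivatives are taken within
  \<open>{0..T}\<close>, since the trajectories are frozen outside.\<close>

lemma ex_nonlocal_flow:
  obtains X :: "real \<Rightarrow> 'd \<Rightarrow> 'd" and w :: "real \<times> 'd \<Rightarrow> 'n"
  where "continuous_on UNIV (\<lambda>(t, y). X t y)"
    and "\<And>t x y. norm ((X t x - x) - (X t y - y)) \<le> norm (x - y) / 2"
    and "\<And>y. X 0 y = y"
    and "\<And>t y. t \<in> {0..T} \<Longrightarrow>
        ((\<lambda>t. X t y) has_vector_derivative V t (X t y) (w (t, X t y))) (at t within {0..T})"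
    and "continuous_on UNIV w"
    and "\<And>t z. w (t, z) = (LINT y|lborel. u0 y *\<^sub>R \<eta> (z - X t y))"
    and "\<And>p. norm (w p) \<le> M"
proof -
  obtain w where w: "admissible w" and fix_w: "\<And>t z. w (t, z) = W (\<lambda>y. flow w y t) z"
    using ex_fixed_field by blast
  show ?thesis
  proof (rule that[of "\<lambda>t y. flow w y t" w])
    show "continuous_on UNIV (\<lambda>(t, y). flow w y t)" by (rule continuous_flow[OF w])
    show "norm ((flow w x t - x) - (flow w y t - y)) \<le> norm (x - y) / 2" for t x y
      by (rule flow_displacement[OF w])
    show "flow w y 0 = y" for y
      using flow_eq[OF w, of y 0] T_pos by (simp add: picard_fun_def)
    show "w (t, z) = (LINT y|lborel. u0 y *\<^sub>R \<eta> (z - flow w y t))" for t z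
      by (simp add: fix_w[of t z] W_def)
    show "norm (w p) \<le> M" for p
      using norm_W_le[OF expanding_flow[OF w]] fix_w by (cases p) simp
    show "((\<lambda>t. flow w y t) has_vector_derivative V t (flow w y t) (w (t, flow w y t))) (at t within {0..T})"
      if t: "t \<in> {0..T}" for t y
    proof -
      have "((\<lambda>t. integral {0..t} (\<lambda>s. vel w s (flow w y s))) has_vector_derivative vel w t (flow w y t)) (at t within {0..T})"
        by (rule integral_has_vector_derivative[OF _ t]) (intro continuous_intros, auto)
      then have "((\<lambda>t. y + integral {0..t} (\<lambda>s. vel w s (flow w y s))) has_vector_derivative vel w t (flow w y t)) (at t within {0..T})"
        by (auto intro!: derivative_eq_intros)
      moreover have "y + integral {0..t} (\<lambda>s. vel w s (flow w y s)) = flow w y t" if "t \<in> {0..T}" for t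
        using flow_eq[OF w, of y t] that by (simp add: picard_fun_def)
      ultimately show ?thesis
        unfolding vel_def[symmetric] using t by (rule_tac has_vector_derivative_transform) auto
    qed
  qed auto
qed

end

section \<open>Density and inverse of the flow\<close>

text \<open>Identities that hold at almost every time for each single box hold for all boxes outside
  one null set of times, by countability; stability under intersection then lets them determine the
  measure.\<close>

lemma borel_eq_sigma_rational_boxes:
  defines "\<Q> \<equiv> {box a b | a b :: 'a::euclidean_space. \<forall>i\<in>Basis. a \<bullet> i \<in> \<rat> \<and> b \<bullet> i \<in> \<rat>}"
  shows "countable \<Q>" "Int_stable \<Q>" "sets borel = sigma_sets UNIV \<Q>" "\<Union>\<Q> = UNIV"
proof -
  show c: "countable \<Q>"
  proof (rule countable_subset)
    let ?g = "\<lambda>f :: 'a \<Rightarrow> real \<times> real. box (\<Sum>i\<in>Basis. fst (f i) *\<^sub>R i) (\<Sum>i\<in>Basis. snd (f i) *\<^sub>R i :: 'a)"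
    show "\<Q> \<subseteq> ?g ` (Basis \<rightarrow>\<^sub>E \<rat> \<times> \<rat>)"
    proof
      fix A assume "A \<in> \<Q>"
      then obtain a b where ab: "A = box a b" "\<forall>i\<in>Basis. a \<bullet> i \<in> \<rat> \<and> b \<bullet> i \<in> \<rat>"
        unfolding \<Q>_def by auto
      then show "A \<in> ?g ` (Basis \<rightarrow>\<^sub>E \<rat> \<times> \<rat>)"
        by (intro image_eqI[of _ _ "\<lambda>i\<in>Basis. (a \<bullet> i, b \<bullet> i)"]) (auto simp: euclidean_representation)
    qed
    show "countable (?g ` (Basis \<rightarrow>\<^sub>E \<rat> \<times> \<rat>))"
      by (intro countable_image countable_PiE) (auto intro: countable_rat)
  qed
  show "Int_stable \<Q>"
    unfolding Int_stable_def
  proof safe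
    fix A B assume "A \<in> \<Q>" "B \<in> \<Q>"
    then obtain a b c d where "A = box a b" "\<forall>i\<in>Basis. a \<bullet> i \<in> \<rat> \<and> b \<bullet> i \<in> \<rat>"
      "B = box c d" "\<forall>i\<in>Basis. c \<bullet> i \<in> \<rat> \<and> d \<bullet> i \<in> \<rat>"
      unfolding \<Q>_def by blast
    then show "A \<inter> B \<in> \<Q>"
      unfolding \<Q>_def by (auto simp: box_Int_box max_def min_def intro!: exI)
  qed
  have tb: "topological_basis \<Q>"
  proof (rule topological_basisI)
    show "open A" if "A \<in> \<Q>" for A using that by (auto simp: \<Q>_def open_box)
    fix O' :: "'a set" and x assume "open O'" "x \<in> O'"
    then obtain e where "e > 0" "ball x e \<subseteq> O'" by (auto elim: openE)
    with rational_boxes[of e x] show "\<exists>B'\<in>\<Q>. x \<in> B' \<and> B' \<subseteq> O'"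
      unfolding \<Q>_def by blast
  qed
  show "sets borel = sigma_sets UNIV \<Q>"
    by (subst borel_eq_countable_basis[OF c tb]) (rule sets_measure_of, simp)
  show "\<Union>\<Q> = UNIV"
    using topological_basisE[OF tb open_UNIV] by (metis UNIV_I UnionI UNIV_eq_I)
qed

text \<open>A set of positive measure on which \<open>g\<close> exceeds \<open>c\<close> would
  violate the setwise bound. Intersecting with balls keeps the integral of \<open>c\<close> finite,
  as the strict comparison of integrals requires.\<close>

lemma AE_density_le:
  fixes g :: "'a::euclidean_space \<Rightarrow> ennreal" and c :: real
  assumes [measurable]: "g \<in> borel_measurable borel"
    and le: "\<And>A. A \<in> sets borel \<Longrightarrow> emeasure (density lborel g) A \<le> ennreal c * emeasure lborel A"
  shows "AE x in lborel. g x \<le> ennreal c"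
proof -
  have "AE x in lborel. x \<in> ball 0 (real n) \<longrightarrow> g x \<le> ennreal c" for n
  proof -
    have [measurable]: "ball (0::'a) n \<in> sets borel" by simp
    define A where "A = {x. ennreal c < g x} \<inter> ball 0 (real n)"
    have [measurable]: "A \<in> sets borel" unfolding A_def by measurable
    have fin: "emeasure lborel A < \<infinity>"
      by (rule le_less_trans[OF emeasure_mono emeasure_lborel_ball_finite[of 0 "real n"]]) (auto simp: A_def)
    have "AE x in lborel. g x * indicator A x \<le> ennreal c * indicator A x"
    proof (rule ccontr)
      assume n: "\<not> (AE x in lborel. g x * indicator A x \<le> ennreal c * indicator A x)"
      have "(\<integral>\<^sup>+x. ennreal c * indicator A x \<partial>lborel) < (\<integral>\<^sup>+x. g x * indicator A x \<partial>lborel)"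
      proof (rule nn_integral_less[OF _ _ _ _ n])
        show "(\<integral>\<^sup>+x. ennreal c * indicator A x \<partial>lborel) \<noteq> \<infinity>"
          using fin by (subst nn_integral_cmult_indicator) (auto simp: ennreal_mult_eq_top_iff)
        show "AE x in lborel. ennreal c * indicator A x \<le> g x * indicator A x"
          by (intro always_eventually allI) (auto simp: A_def indicator_def)
      qed measurable
      moreover have "(\<integral>\<^sup>+x. g x * indicator A x \<partial>lborel) \<le> ennreal c * emeasure lborel A"
        using le[of A] by (simp add: emeasure_density)
      ultimately show False
        by (simp add: nn_integral_cmult_indicator)
    qed
    then show ?thesis
    proof eventually_elim
      case (elim x)
      show ?case
        using elim by (cases "ennreal c < g x") (auto simp: A_def not_less)
    qed
  qed
  then have "AE x in lborel. \<forall>n. x \<in> ball 0 (real n) \<longrightarrow> g x \<le> ennreal c"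
    unfolding AE_all_countable by blast
  then show ?thesis
    by eventually_elim (metis mem_ball_0 reals_Archimedean2)
qed

text \<open>Replaces the Jacobian of the inverse flow. The density is taken once, in space-time,
  which makes \<open>J\<close> jointly measurable; that it is also the density of the slices at
  almost every time is deduced afterwards.\<close>

lemma ex_flow_density:
  fixes X :: "real \<Rightarrow> 'd::euclidean_space \<Rightarrow> 'd"
  assumes cont: "continuous_on UNIV (\<lambda>(t, y). X t y)" and X: "\<And>t. expanding (X t)"
  obtains J :: "real \<times> 'd \<Rightarrow> real" where "J \<in> borel_measurable borel" "\<And>p. 0 \<le> J p" "\<And>p. J p \<le> 4 ^ DIM('d)"
    and "density lborel (\<lambda>p. ennreal (J p)) = distr lborel borel (\<lambda>(t, y). (t, X t y))"
    and "AE t in lborel. density lborel (\<lambda>x. ennreal (J (t, x))) = distr lborel borel (X t)"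
proof -
  let ?\<Phi> = "\<lambda>(t, y). (t, X t y)"
  let ?C = "4 ^ DIM('d) :: real"
  have Phi [measurable]: "?\<Phi> \<in> borel_measurable borel"
    using cont by (intro borel_measurable_continuous_onI) (auto intro!: continuous_intros simp: case_prod_unfold)
  have [measurable]: "X t \<in> borel_measurable borel" for t by (rule expanding_measurable[OF X])
  define N where "N = distr (lborel :: (real \<times> 'd) measure) borel ?\<Phi>"
  have sets_N [simp]: "sets N = sets borel" by (simp add: N_def)
  have slice: "emeasure lborel B = (\<integral>\<^sup>+t. emeasure lborel (Pair t -` B) \<partial>lborel)"
    if "B \<in> sets borel" for B :: "(real \<times> 'd) set"
    using lborel.emeasure_pair_measure_alt[of B "lborel :: real measure"] that unfolding lborel_prod by simp
  have slice_meas: "(\<lambda>t. emeasure lborel (Pair t -` B)) \<in> borel_measurable borel"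
    if "B \<in> sets borel" for B :: "(real \<times> 'd) set"
    using lborel.measurable_emeasure_Pair[of B "lborel :: real measure"] that unfolding lborel_prod by simp
  have N_slice: "emeasure N B = (\<integral>\<^sup>+t. emeasure lborel (X t -` (Pair t -` B)) \<partial>lborel)"
    if B: "B \<in> sets borel" for B
  proof -
    have "emeasure N B = emeasure lborel (?\<Phi> -` B)"
      using B by (simp add: N_def emeasure_distr)
    also have "\<dots> = (\<integral>\<^sup>+t. emeasure lborel (Pair t -` (?\<Phi> -` B)) \<partial>lborel)"
      using B by (intro slice measurable_sets_borel[OF Phi])
    also have "\<dots> = (\<integral>\<^sup>+t. emeasure lborel (X t -` (Pair t -` B)) \<partial>lborel)"
      by (simp add: vimage_def)
    finally show ?thesis .
  qed
  have sliceB: "Pair t -` B \<in> sets borel" if "B \<in> sets borel" for t :: real and B :: "(real \<times> 'd) set"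
    using that by (intro measurable_sets_borel[of "Pair t"] borel_measurable_continuous_onI) (auto intro!: continuous_intros)
  have N_le: "emeasure N B \<le> ennreal ?C * emeasure lborel B" if B: "B \<in> sets borel" for B
  proof -
    have "emeasure N B \<le> (\<integral>\<^sup>+t. ennreal ?C * emeasure lborel (Pair t -` B) \<partial>lborel)"
      unfolding N_slice[OF B] using B by (intro nn_integral_mono expanding_emeasure_vimage X sliceB)
    also have "\<dots> = ennreal ?C * emeasure lborel B"
      unfolding slice[OF B] using slice_meas[OF B] by (intro nn_integral_cmult) simp
    finally show ?thesis .
  qed
  have "absolutely_continuous lborel N"
    unfolding absolutely_continuous_def using N_le by (fastforce simp: null_sets_def)
  then obtain g where g [measurable]: "g \<in> borel_measurable borel" and gN: "density lborel g = N"
    using sigma_finite_measure.Radon_Nikodym[OF lborel.sigma_finite_measure_axioms, of N] by auto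
  have g_le: "AE p in lborel. g p \<le> ennreal ?C"
    using N_le by (intro AE_density_le) (auto simp: gN)
  \<comment> \<open>The truncation alters \<open>g\<close> on a null set only, and makes
    \<open>J\<close> real-valued and bounded at every point.\<close>
  define J where "J p = enn2real (min (g p) (ennreal ?C))" for p
  have J [measurable]: "J \<in> borel_measurable borel" unfolding J_def by measurable
  have J0: "0 \<le> J p" for p by (simp add: J_def)
  have JC: "J p \<le> ?C" for p
  proof -
    have "J p \<le> enn2real (ennreal ?C)" unfolding J_def by (intro enn2real_mono) (auto simp: min_def)
    then show ?thesis by simp
  qed
  have JN: "density lborel (\<lambda>p. ennreal (J p)) = N"
  proof -
    have "AE p in lborel. ennreal (J p) = g p"
      using g_le
    proof eventually_elim
      case (elim p)
      then have "g p < top" by (rule le_less_trans) simp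
      then show ?case using elim by (simp add: J_def min_def)
    qed
    then have "density lborel (\<lambda>p. ennreal (J p)) = density lborel g"
      by (intro density_cong) auto
    then show ?thesis by (simp add: gN)
  qed
  define \<Q> where "\<Q> = {box a b | a b :: 'd. \<forall>i\<in>Basis. a \<bullet> i \<in> \<rat> \<and> b \<bullet> i \<in> \<rat>}"
  note Q = borel_eq_sigma_rational_boxes[where 'a = 'd, folded \<Q>_def]
  \<comment> \<open>For a fixed box \<open>A\<close> both functions of time have the same integral
    over every Borel set \<open>S\<close> of times, as the value of \<open>N\<close> on
    \<open>S \<times> A\<close> shows; hence they agree almost everywhere.\<close>
  have "AE t in lborel. (\<integral>\<^sup>+x. ennreal (J (t, x)) * indicator A x \<partial>lborel) = emeasure lborel (X t -` A)"
    if "A \<in> \<Q>" for A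
  proof -
    have [measurable]: "A \<in> sets borel" using that by (auto simp: \<Q>_def)
    have m1 [measurable]: "(\<lambda>t. \<integral>\<^sup>+x. ennreal (J (t, x)) * indicator A x \<partial>lborel) \<in> borel_measurable borel"
      by measurable
    have m2: "(\<lambda>t. emeasure lborel (X t -` A)) \<in> borel_measurable borel"
    proof -
      have "?\<Phi> -` (UNIV \<times> A) \<in> sets borel"
        by (rule measurable_sets_borel[OF Phi]) (simp add: borel_prod[symmetric])
      from slice_meas[OF this] show ?thesis by (simp add: vimage_def)
    qed
    have "density lborel (\<lambda>t. \<integral>\<^sup>+x. ennreal (J (t, x)) * indicator A x \<partial>lborel) = density lborel (\<lambda>t. emeasure lborel (X t -` A))"
    proof (rule measure_eqI)
      fix S :: "real set" assume "S \<in> sets (density lborel (\<lambda>t. \<integral>\<^sup>+x. ennreal (J (t, x)) * indicator A x \<partial>lborel))"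
      then have S [measurable]: "S \<in> sets borel" by simp
      have SA: "S \<times> A \<in> sets borel" by (simp add: borel_prod[symmetric])
      have "emeasure (density lborel (\<lambda>t. \<integral>\<^sup>+x. ennreal (J (t, x)) * indicator A x \<partial>lborel)) S =
         (\<integral>\<^sup>+t. (\<integral>\<^sup>+x. ennreal (J (t, x)) * indicator A x \<partial>lborel) * indicator S t \<partial>lborel)"
        by (simp add: emeasure_density)
      also have "\<dots> = (\<integral>\<^sup>+t. (\<integral>\<^sup>+x. ennreal (J (t, x)) * indicator (S \<times> A) (t, x) \<partial>lborel) \<partial>lborel)"
        by (intro nn_integral_cong, subst nn_integral_multc[symmetric])
           (auto intro!: nn_integral_cong simp: indicator_def)
      also have "\<dots> = (\<integral>\<^sup>+p. ennreal (J p) * indicator (S \<times> A) p \<partial>(lborel \<Otimes>\<^sub>M lborel))"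
        by (rule lborel.nn_integral_fst) (use SA in \<open>auto simp: lborel_prod\<close>)
      also have "\<dots> = emeasure N (S \<times> A)"
        using SA by (simp add: lborel_prod JN[symmetric] emeasure_density)
      also have "\<dots> = (\<integral>\<^sup>+t. emeasure lborel (X t -` A) * indicator S t \<partial>lborel)"
        unfolding N_slice[OF SA] by (intro nn_integral_cong) (auto simp: indicator_def)
      also have "\<dots> = emeasure (density lborel (\<lambda>t. emeasure lborel (X t -` A))) S"
        using m2 by (simp add: emeasure_density)
      finally show "emeasure (density lborel (\<lambda>t. \<integral>\<^sup>+x. ennreal (J (t, x)) * indicator A x \<partial>lborel)) S =
        emeasure (density lborel (\<lambda>t. emeasure lborel (X t -` A))) S" .
    qed simp
    then show ?thesis using m1 m2 by (intro sigma_finite_measure.density_unique[OF lborel.sigma_finite_measure_axioms]) simp_all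
  qed
  then have "AE t in lborel. \<forall>A\<in>\<Q>. (\<integral>\<^sup>+x. ennreal (J (t, x)) * indicator A x \<partial>lborel) = emeasure lborel (X t -` A)"
    using Q(1) by (simp add: AE_ball_countable)
  then have "AE t in lborel. density lborel (\<lambda>x. ennreal (J (t, x))) = distr lborel borel (X t)"
  proof eventually_elim
    case (elim t)
    show ?case
    proof (rule measure_eqI_generator_eq_countable[OF Q(2), where \<Omega> = UNIV and A = \<Q>])
      show "emeasure (density lborel (\<lambda>x. ennreal (J (t, x)))) A = emeasure (distr lborel borel (X t)) A"
        if "A \<in> \<Q>" for A
      proof -
        have "A \<in> sets borel" using that by (auto simp: \<Q>_def)
        then show ?thesis using elim that by (simp add: emeasure_density emeasure_distr)
      qed
      show "emeasure (density lborel (\<lambda>x. ennreal (J (t, x)))) A \<noteq> \<infinity>" if "A \<in> \<Q>" for A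
      proof -
        have A: "A \<in> sets borel" "emeasure lborel A < \<infinity>"
          using that by (auto simp: \<Q>_def emeasure_lborel_box_eq)
        have "emeasure (density lborel (\<lambda>x. ennreal (J (t, x)))) A = emeasure lborel (X t -` A)"
          using elim that A by (simp add: emeasure_density)
        also have "\<dots> \<le> ennreal ?C * emeasure lborel A"
          using A by (intro expanding_emeasure_vimage X)
        also have "\<dots> < \<infinity>" using A by (simp add: ennreal_mult_less_top)
        finally show ?thesis by simp
      qed
    qed (use Q in auto)
  qed
  then show ?thesis
    using that[of J] J J0 JC JN by (simp add: N_def)
qed

text \<open>A preimage of \<open>x\<close> is a fixed point of
  \<open>y \<mapsto> x - (X t y - y)\<close>, a contraction of factor 1/2. For the continuity of
  \<open>Y\<close>, expansion bounds its change by twice the residual obtained by keeping the old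
  starting point, and this residual tends to 0 by continuity of the flow.\<close>

lemma ex_inverse_flow:
  fixes X :: "real \<Rightarrow> 'd::euclidean_space \<Rightarrow> 'd"
  assumes cont: "continuous_on UNIV (\<lambda>(t, y). X t y)"
    and disp: "\<And>t x y. norm ((X t x - x) - (X t y - y)) \<le> norm (x - y) / 2"
  obtains Y :: "real \<times> 'd \<Rightarrow> 'd" where "continuous_on UNIV Y" "\<And>t y. Y (t, X t y) = y" "\<And>t x. X t (Y (t, x)) = x"
proof -
  have ex: "\<exists>!y. X t y = x" for t x
  proof -
    have "\<exists>!y. x - (X t y - y) = y"
      using disp[of t] by (intro banach_fix_type[of "1/2"]) (auto simp: dist_norm norm_minus_commute algebra_simps)
    then show ?thesis by (simp add: algebra_simps eq_commute[of x])
  qed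
  define Y where "Y p = (THE y. X (fst p) y = snd p)" for p
  have XY: "X t (Y (t, x)) = x" for t x
    unfolding Y_def using theI'[OF ex[of t x]] by simp
  have YX: "Y (t, X t y) = y" for t y
    using ex[of t "X t y"] XY[of t "X t y"] by auto
  have "(Y \<longlongrightarrow> Y (s, z)) (at (s, z))" for s z
  proof -
    have "isCont (\<lambda>(t, y). X t y) (s, Y (s, z))"
      using cont by (simp add: continuous_on_eq_continuous_at)
    then have "((\<lambda>p. case (fst p, Y (s, z)) of (t, y) \<Rightarrow> X t y) \<longlongrightarrow> (case (s, Y (s, z)) of (t, y) \<Rightarrow> X t y)) (at (s, z))"
      by (rule isCont_tendsto_compose) (auto intro!: tendsto_eq_intros)
    then have X: "((\<lambda>p. X (fst p) (Y (s, z))) \<longlongrightarrow> z) (at (s, z))"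
      by (simp add: XY)
    have "((\<lambda>p. Y (s, z) - Y p) \<longlongrightarrow> 0) (at (s, z))"
    proof (rule Lim_null_comparison)
      have "norm (Y (s, z) - Y p) \<le> 2 * norm (X (fst p) (Y (s, z)) - snd p)" for p
        using expanding_id_plus[of "X (fst p)", OF disp] XY[of "fst p" "snd p"]
        unfolding expanding_def by (metis prod.collapse)
      then show "\<forall>\<^sub>F p in at (s, z). norm (Y (s, z) - Y p) \<le> 2 * norm (X (fst p) (Y (s, z)) - snd p)"
        by simp
      show "((\<lambda>p. 2 * norm (X (fst p) (Y (s, z)) - snd p)) \<longlongrightarrow> 0) (at (s, z))"
        using X by (auto intro!: tendsto_eq_intros)
    qed
    from tendsto_diff[OF tendsto_const this, of "Y (s, z)"] show ?thesis by simp
  qed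
  then have "continuous_on UNIV Y" by (auto simp: continuous_on_def)
  then show ?thesis using that[of Y] XY YX by auto
qed

section \<open>The Lagrangian solution\<close>

lemma lborel_distr_minus: "distr lborel borel (\<lambda>y. z - y) = (lborel :: 'a::euclidean_space measure)"
  using lborel_affine[of "-1" z] by (simp add: density_1)

lemma lborel_reflect:
  fixes f :: "'a::euclidean_space \<Rightarrow> 'b::euclidean_space"
  assumes [measurable]: "f \<in> borel_measurable borel"
  shows "integrable lborel (\<lambda>y. f (z - y)) \<longleftrightarrow> integrable lborel f"
    and "(LINT y|lborel. f (z - y)) = (LINT y|lborel. f y)"
proof -
  show "integrable lborel (\<lambda>y. f (z - y)) \<longleftrightarrow> integrable lborel f"
    using integrable_distr_eq[of "\<lambda>y. z - y" lborel borel f] by (simp add: lborel_distr_minus)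
  show "(LINT y|lborel. f (z - y)) = (LINT y|lborel. f y)"
    using integral_distr[of "\<lambda>y. z - y" lborel borel f] by (simp add: lborel_distr_minus)
qed

section \<open>Calculus of smooth test functions\<close>

lemma Cinf_differentiable: "Cinf \<phi> \<Longrightarrow> \<phi> differentiable (at x)"
  unfolding Cinf_def using iter_pd.simps(1) by (metis empty_set empty_subsetI)

lemma Cinf_pd: "Cinf \<phi> \<Longrightarrow> i \<in> Basis \<Longrightarrow> Cinf (pd i \<phi>)"
proof -
  assume \<phi>: "Cinf \<phi>" and i: "i \<in> Basis"
  \<comment> \<open>\<open>iter_pd\<close> applies the last direction of its list first, so the new
    direction is appended at the end.\<close>
  have "iter_pd vs (pd i \<phi>) = iter_pd (vs @ [i]) \<phi>" for vs by (induction vs) auto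
  then show "Cinf (pd i \<phi>)" using \<phi> i unfolding Cinf_def by auto
qed

lemma Cinf_continuous: "Cinf \<phi> \<Longrightarrow> continuous_on S \<phi>"
  by (meson Cinf_differentiable differentiable_imp_continuous_within continuous_at_imp_continuous_on)

lemma Cinf_has_derivative: "Cinf \<phi> \<Longrightarrow> (\<phi> has_derivative (\<lambda>v. pd v \<phi> x)) (at x)"
  unfolding pd_def using Cinf_differentiable frechet_derivative_works by (metis eta_contract_eq)

text \<open>\<open>Cinf\<close> speaks of basis directions only; linearity of the derivative extends
  its consequences, such as continuity, to all directions.\<close>

lemma pd_eq_sum:
  assumes "Cinf \<phi>" shows "pd v \<phi> x = (\<Sum>i\<in>Basis. (v \<bullet> i) * pd i \<phi> x)"
proof -
  have lin: "linear (\<lambda>v. pd v \<phi> x)"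
    using Cinf_has_derivative[OF assms] has_derivative_linear by blast
  have "pd (\<Sum>i\<in>Basis. (v \<bullet> i) *\<^sub>R i) \<phi> x = (\<Sum>i\<in>Basis. pd ((v \<bullet> i) *\<^sub>R i) \<phi> x)"
    by (rule linear_sum[OF lin])
  then show ?thesis by (simp add: euclidean_representation linear_scale[OF lin])
qed

lemma pd_eq_0_outside:
  assumes K: "closed K" "\<And>z. z \<notin> K \<Longrightarrow> \<phi> z = 0" and z: "z \<notin> K"
  shows "pd v \<phi> z = 0"
proof -
  have "(\<phi> has_derivative (\<lambda>_. 0)) (at z)"
    by (rule has_derivative_transform_within_open[of "\<lambda>_. 0" _ _ _ "- K"]) (use K z in auto)
  then show ?thesis unfolding pd_def by (metis frechet_derivative_at)
qed

text \<open>With \<open>v\<close> the velocity this is the transport operator, so the chain rule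
  along a characteristic produces exactly the integrand of the weak formulation.\<close>

lemma pd_time_space:
  fixes \<phi> :: "real \<times> 'd::euclidean_space \<Rightarrow> real"
  assumes "Cinf \<phi>" shows "pd (1, v) \<phi> z = dt \<phi> z + v \<bullet> gradx \<phi> z"
proof -
  have lin: "linear (\<lambda>v. pd v \<phi> z)"
    using Cinf_has_derivative[OF assms] has_derivative_linear by blast
  have "(1, v) = (1, 0) + (\<Sum>i\<in>Basis. (v \<bullet> i) *\<^sub>R (0, i))"
    by (simp add: prod_eq_iff fst_sum snd_sum euclidean_representation)
  then have "pd (1, v) \<phi> z = pd (1, 0) \<phi> z + (\<Sum>i\<in>Basis. pd ((v \<bullet> i) *\<^sub>R (0, i)) \<phi> z)"
    using linear_add[OF lin] linear_sum[OF lin] by metis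
  then show ?thesis
    unfolding dt_def gradx_def by (simp only: linear_scale[OF lin]) (simp add: inner_sum_right mult.commute)
qed

lemma continuous_dt_gradx:
  fixes \<phi> :: "real \<times> 'd::euclidean_space \<Rightarrow> real"
  assumes "Cinf \<phi>" shows "continuous_on UNIV (dt \<phi>)" "continuous_on UNIV (gradx \<phi>)"
  unfolding dt_def gradx_def
  by (intro continuous_intros Cinf_continuous Cinf_pd assms; simp add: Basis_prod_def)+

lemma integral_density_eq_distr:
  fixes h :: "'a::euclidean_space \<Rightarrow> 'b::euclidean_space" and \<Phi> :: "'a \<Rightarrow> 'a"
  assumes D: "density lborel (\<lambda>x. ennreal (J x)) = distr lborel borel \<Phi>"
    and [measurable]: "J \<in> borel_measurable borel" "\<Phi> \<in> borel_measurable borel" "h \<in> borel_measurable borel"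
    and J: "\<And>x. 0 \<le> J x"
  shows "integrable lborel (\<lambda>x. J x *\<^sub>R h x) \<longleftrightarrow> integrable lborel (\<lambda>y. h (\<Phi> y))"
    and "(LINT x|lborel. J x *\<^sub>R h x) = (LINT y|lborel. h (\<Phi> y))"
proof -
  have "integrable lborel (\<lambda>x. J x *\<^sub>R h x) \<longleftrightarrow> integrable (density lborel (\<lambda>x. ennreal (J x))) h"
    by (rule integrable_density[symmetric]) (auto simp: J)
  also have "\<dots> \<longleftrightarrow> integrable lborel (\<lambda>y. h (\<Phi> y))"
    unfolding D by (rule integrable_distr_eq) auto
  finally show "integrable lborel (\<lambda>x. J x *\<^sub>R h x) \<longleftrightarrow> integrable lborel (\<lambda>y. h (\<Phi> y))" .
  have "(LINT x|lborel. J x *\<^sub>R h x) = integral\<^sup>L (density lborel (\<lambda>x. ennreal (J x))) h"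
    by (rule integral_density[symmetric]) (auto simp: J)
  also have "\<dots> = (LINT y|lborel. h (\<Phi> y))"
    unfolding D by (rule integral_distr) auto
  finally show "(LINT x|lborel. J x *\<^sub>R h x) = (LINT y|lborel. h (\<Phi> y))" .
qed

text \<open>The density appears twice: \<open>J_spacetime\<close> moves the integral of the weak
  formulation back to starting points, while \<open>J_slice\<close> does so at a fixed time, for the
  convolution and for the norms of the slices.\<close>

locale lagrangian_solution =
  fixes V :: "real \<Rightarrow> 'd::euclidean_space \<Rightarrow> 'n::euclidean_space \<Rightarrow> 'd" and \<eta> :: "'d \<Rightarrow> 'n"
    and u0 :: "'d \<Rightarrow> real" and T M :: real and X :: "real \<Rightarrow> 'd \<Rightarrow> 'd" and w :: "real \<times> 'd \<Rightarrow> 'n"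
    and J :: "real \<times> 'd \<Rightarrow> real" and Y :: "real \<times> 'd \<Rightarrow> 'd"
  assumes V_cont: "continuous_on UNIV (\<lambda>(t, x, w). V t x w)"
    and eta_borel [measurable]: "\<eta> \<in> borel_measurable borel"
    and u0_borel [measurable]: "u0 \<in> borel_measurable borel"
    and eta_loc: "loc_integrable_on UNIV \<eta>"
    and u0_loc: "loc_integrable_on UNIV u0"
    and X_cont: "continuous_on UNIV (\<lambda>(t, y). X t y)"
    and X_expanding: "\<And>t. expanding (X t)"
    and X_0: "\<And>y. X 0 y = y"
    and X_deriv: "\<And>t y. t \<in> {0..T} \<Longrightarrow>
        ((\<lambda>t. X t y) has_vector_derivative V t (X t y) (w (t, X t y))) (at t within {0..T})"
    and w_cont: "continuous_on UNIV w"
    and w_eq: "\<And>t z. w (t, z) = (LINT y|lborel. u0 y *\<^sub>R \<eta> (z - X t y))"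
    and w_integrable: "\<And>t z. integrable lborel (\<lambda>y. u0 y *\<^sub>R \<eta> (z - X t y))"
    and w_bound: "\<And>p. norm (w p) \<le> M"
    and J_borel [measurable]: "J \<in> borel_measurable borel"
    and J_nonneg: "\<And>p. 0 \<le> J p"
    and J_le: "\<And>p. J p \<le> 4 ^ DIM('d)"
    and J_spacetime: "density lborel (\<lambda>p. ennreal (J p)) = distr lborel borel (\<lambda>(t, y). (t, X t y))"
    and J_slice: "AE t in lborel. density lborel (\<lambda>x. ennreal (J (t, x))) = distr lborel borel (X t)"
    and Y_cont: "continuous_on UNIV Y"
    and Y_X: "\<And>t y. Y (t, X t y) = y"
begin

text \<open>The push-forward of \<open>u0\<close> under the flow, written as a function: the value
  carried from the starting point times the density of the transported volume.\<close>

definition u :: "real \<times> 'd \<Rightarrow> real" where "u p = J p * u0 (Y p)"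

lemma Y_borel [measurable]: "Y \<in> borel_measurable borel"
  using Y_cont by (rule borel_measurable_continuous_onI)

lemma u_borel [measurable]: "u \<in> borel_measurable borel"
  unfolding u_def by measurable

lemma X_pair_borel [measurable]: "(\<lambda>(t, y). (t, X t y)) \<in> borel_measurable borel"
  using X_cont by (intro borel_measurable_continuous_onI) (auto intro!: continuous_intros simp: case_prod_unfold)

lemma X_borel [measurable]: "X t \<in> borel_measurable borel"
  by (rule expanding_measurable[OF X_expanding])

lemma slice_borel:
  fixes f :: "real \<times> 'd \<Rightarrow> 'b::topological_space"
  assumes "f \<in> borel_measurable borel" shows "(\<lambda>x. f (t, x)) \<in> borel_measurable borel"
  using assms by (rule measurable_compose[rotated]) (intro borel_measurable_continuous_onI continuous_intros)

text \<open>\<open>Y (t, X t y) = y\<close> exhibits \<open>F p * u p\<close> as \<open>J p\<close>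
  times a function whose composition with the flow is \<open>F (t, X t y) * u0 y\<close>.\<close>

lemma transport_spacetime:
  fixes F :: "real \<times> 'd \<Rightarrow> real"
  assumes [measurable]: "F \<in> borel_measurable borel"
  shows "integrable lborel (\<lambda>p. F p * u p) \<longleftrightarrow> integrable lborel (\<lambda>(t, y). F (t, X t y) * u0 y)"
    and "(LINT p|lborel. F p * u p) = (LINT (t, y)|lborel. F (t, X t y) * u0 y)"
proof -
  define h where "h p = F p * u0 (Y p)" for p
  have h [measurable]: "h \<in> borel_measurable borel" unfolding h_def by measurable
  have 1: "(\<lambda>p. F p * u p) = (\<lambda>p. J p *\<^sub>R h p)" by (auto simp: h_def u_def)
  have 2: "(\<lambda>(t, y). F (t, X t y) * u0 y) = (\<lambda>p. h ((\<lambda>(t, y). (t, X t y)) p))"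
    by (auto simp: h_def Y_X)
  note eq = integral_density_eq_distr[OF J_spacetime J_borel X_pair_borel h J_nonneg]
  show "integrable lborel (\<lambda>p. F p * u p) \<longleftrightarrow> integrable lborel (\<lambda>(t, y). F (t, X t y) * u0 y)"
    unfolding 1 2 by (rule eq)
  show "(LINT p|lborel. F p * u p) = (LINT (t, y)|lborel. F (t, X t y) * u0 y)"
    unfolding 1 2 by (rule eq)
qed

lemma transport_slice:
  fixes g :: "'d \<Rightarrow> 'b::euclidean_space"
  assumes t: "density lborel (\<lambda>x. ennreal (J (t, x))) = distr lborel borel (X t)"
    and [measurable]: "g \<in> borel_measurable borel"
  shows "integrable lborel (\<lambda>x. u (t, x) *\<^sub>R g x) \<longleftrightarrow> integrable lborel (\<lambda>y. u0 y *\<^sub>R g (X t y))"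
    and "(LINT x|lborel. u (t, x) *\<^sub>R g x) = (LINT y|lborel. u0 y *\<^sub>R g (X t y))"
proof -
  note [measurable] = slice_borel[OF J_borel] slice_borel[OF Y_borel]
  define h where "h x = u0 (Y (t, x)) *\<^sub>R g x" for x
  have h [measurable]: "h \<in> borel_measurable borel" unfolding h_def by measurable
  have 1: "(\<lambda>x. u (t, x) *\<^sub>R g x) = (\<lambda>x. J (t, x) *\<^sub>R h x)" by (auto simp: h_def u_def)
  have 2: "(\<lambda>y. u0 y *\<^sub>R g (X t y)) = (\<lambda>y. h (X t y))" by (auto simp: h_def Y_X)
  note eq = integral_density_eq_distr[OF t slice_borel[OF J_borel] X_borel h J_nonneg]
  show "integrable lborel (\<lambda>x. u (t, x) *\<^sub>R g x) \<longleftrightarrow> integrable lborel (\<lambda>y. u0 y *\<^sub>R g (X t y))"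
    unfolding 1 2 by (rule eq)
  show "(LINT x|lborel. u (t, x) *\<^sub>R g x) = (LINT y|lborel. u0 y *\<^sub>R g (X t y))"
    unfolding 1 2 by (rule eq)
qed

text \<open>Reflecting \<open>y\<close> and moving back to starting points turns the convolution
  into the integral that defines \<open>w\<close>. As the slice identity holds at almost every time,
  \<open>w\<close> is a continuous representative of the convolution.\<close>

lemma conv_u:
  assumes t: "density lborel (\<lambda>x. ennreal (J (t, x))) = distr lborel borel (X t)"
  shows "integrable lebesgue (\<lambda>y. u (t, z - y) *\<^sub>R \<eta> y)" "conv u \<eta> (t, z) = w (t, z)"
proof -
  note [measurable] = slice_borel[OF u_borel]
  define f where "f x = u (t, x) *\<^sub>R \<eta> (z - x)" for x
  have f [measurable]: "f \<in> borel_measurable borel" unfolding f_def by measurable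
  have f_eq: "(\<lambda>y. u (t, z - y) *\<^sub>R \<eta> y) = (\<lambda>y. f (z - y))" by (simp add: f_def)
  have "integrable lborel f"
    unfolding f_def using transport_slice(1)[OF t, of "\<lambda>x. \<eta> (z - x)"] w_integrable by simp
  then show "integrable lebesgue (\<lambda>y. u (t, z - y) *\<^sub>R \<eta> y)"
    unfolding f_eq by (subst integrable_completion) (auto simp: lborel_reflect)
  have "conv u \<eta> (t, z) = (LINT y|lborel. f (z - y))"
    unfolding conv_def fst_conv snd_conv f_eq by (rule integral_completion) simp
  also have "\<dots> = (LINT y|lborel. u0 y *\<^sub>R \<eta> (z - X t y))"
    unfolding lborel_reflect(2)[OF f] unfolding f_def by (rule transport_slice(2)[OF t]) simp
  finally show "conv u \<eta> (t, z) = w (t, z)" by (simp add: w_eq)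
qed

text \<open>The exceptional set lies in a null set of times multiplied by the whole space, whose
  measure is 0 times infinity, that is 0.\<close>

lemma AE_spacetimeI:
  fixes P :: "real \<times> 'd \<Rightarrow> bool"
  assumes "AE t in lborel. \<forall>x. P (t, x)" shows "AE z in lebesgue. P z"
proof (rule AE_completion)
  obtain N where N: "{t. \<not> (\<forall>x. P (t, x))} \<subseteq> N" "emeasure lborel N = 0" "N \<in> sets borel"
    using AE_E[OF assms] by auto
  have "emeasure lborel (N \<times> (UNIV :: 'd set)) = emeasure lborel N * emeasure lborel (UNIV :: 'd set)"
    unfolding lborel_prod[symmetric] using N(3) by (intro lborel.emeasure_pair_measure_Times) auto
  then have "N \<times> (UNIV :: 'd set) \<in> null_sets lborel"
    using N by (auto simp: null_sets_def borel_prod[symmetric])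
  then show "AE z in lborel. P z"
    by (rule AE_I') (use N(1) in auto)
qed

lemma conv_borel: "conv u \<eta> \<in> borel_measurable borel"
proof -
  have "conv u \<eta> = (\<lambda>z. LINT y|lborel. u (fst z, snd z - y) *\<^sub>R \<eta> y)"
    unfolding conv_def
    by (intro ext integral_completion measurable_compose[OF _ u_borel] borel_measurable_scaleR) measurable
  also have "\<dots> \<in> borel_measurable (borel \<Otimes>\<^sub>M borel)"
    by (intro lborel.borel_measurable_lebesgue_integral) measurable
  also have "borel \<Otimes>\<^sub>M borel = (borel :: (real \<times> 'd) measure)" by (rule borel_prod)
  finally show ?thesis .
qed

lemma integrable_u0_cball: "integrable lborel (\<lambda>y. indicator (cball 0 r) y * u0 y)"
proof -
  have [measurable]: "cball (0::'d) r \<in> sets borel" by simp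
  have "set_integrable lebesgue (cball 0 r) u0" using u0_loc unfolding loc_integrable_on_def by auto
  then show ?thesis
    unfolding set_integrable_def by (subst (asm) integrable_completion) auto
qed

text \<open>\<open>u0\<close> is only locally integrable, so the starting points that matter must be
  confined to a ball; the majorant \<open>G\<close> is then integrable because the time interval is
  bounded as well.\<close>

lemma integrable_transport:
  fixes F :: "real \<times> 'd \<Rightarrow> real"
  assumes [measurable]: "F \<in> borel_measurable borel" and F: "\<And>p. \<bar>F p\<bar> \<le> B"
    and supp: "\<And>t x. F (t, x) \<noteq> 0 \<Longrightarrow> t \<in> {0..T} \<and> norm x \<le> r"
  shows "integrable lborel (\<lambda>(t, y). F (t, X t y) * u0 y)" "integrable lborel (\<lambda>p. F p * u p)"
proof -
  have "continuous_on {0..T} (\<lambda>t. (\<lambda>(t, y). X t y) (t, 0))"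
    by (rule continuous_on_compose2[OF X_cont]) (auto intro!: continuous_intros)
  then have "bounded ((\<lambda>t. X t 0) ` {0..T})"
    by (intro compact_imp_bounded compact_continuous_image) auto
  then obtain b where b: "\<And>t. t \<in> {0..T} \<Longrightarrow> norm (X t 0) \<le> b"
    unfolding bounded_iff by blast
  \<comment> \<open>Trajectories that meet the ball of radius \<open>r\<close> during
    \<open>{0..T}\<close> start within \<open>R\<close> of 0: \<open>b\<close> bounds the trajectory
    of the origin, and expansion costs the factor 2.\<close>
  define R where "R = 2 * (r + b)"
  have B: "0 \<le> B" using F[of undefined] by linarith
  have y: "norm y \<le> R" if "F (t, X t y) \<noteq> 0" for t y
  proof -
    have "norm (y - 0) \<le> 2 * norm (X t y - X t 0)"
      using X_expanding unfolding expanding_def by blast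
    also have "norm (X t y - X t 0) \<le> r + b"
      using supp[OF that] b[of t] norm_triangle_ineq4[of "X t y" "X t 0"] by simp
    finally show ?thesis by (simp add: R_def)
  qed
  define G :: "real \<times> 'd \<Rightarrow> real" where "G p = indicator {0..T} (fst p) * (B * (indicator (cball 0 R) (snd p) * u0 (snd p)))" for p
  have [measurable]: "cball (0::'d) R \<in> sets borel" by simp
  have "integrable (lborel \<Otimes>\<^sub>M lborel) G"
  proof (rule lborel_pair.Fubini_integrable)
    show "G \<in> borel_measurable (lborel \<Otimes>\<^sub>M lborel)" unfolding G_def by measurable
    have "integrable lborel (\<lambda>t. indicator {0..T} t * (LINT y|lborel. norm (B * (indicator (cball 0 R) y * u0 y))))"
      by (intro integrable_mult_left integrable_real_indicator) (auto simp: emeasure_lborel_Icc_eq)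
    then show "integrable lborel (\<lambda>t. LINT y|lborel. norm (G (t, y)))"
      by (simp add: G_def abs_mult)
    show "AE t in lborel. integrable lborel (\<lambda>y. G (t, y))"
      unfolding G_def by (auto intro!: AE_I2 integrable_mult_right integrable_u0_cball)
  qed
  then have G: "integrable lborel G" by (simp add: lborel_prod)
  show 1: "integrable lborel (\<lambda>(t, y). F (t, X t y) * u0 y)"
  proof (rule Bochner_Integration.integrable_bound[OF G])
    have "(\<lambda>p. F ((\<lambda>(t, y). (t, X t y)) p) * u0 (snd p)) \<in> borel_measurable (borel :: (real \<times> 'd) measure)"
      by (intro borel_measurable_times measurable_compose[OF X_pair_borel assms(1)] measurable_compose[OF _ u0_borel])
         (auto simp: borel_prod[symmetric])
    then show "(\<lambda>(t, y). F (t, X t y) * u0 y) \<in> borel_measurable lborel"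
      by (simp add: case_prod_unfold)
    have "norm (F (t, X t y) * u0 y) \<le> norm (G (t, y))" for t y
    proof (cases "F (t, X t y) = 0")
      case False
      then show ?thesis using y[OF False] supp[OF False] F[of "(t, X t y)"] B
        by (auto simp: G_def abs_mult intro!: mult_right_mono)
    qed simp
    then show "AE p in lborel. norm (case p of (t, y) \<Rightarrow> F (t, X t y) * u0 y) \<le> norm (G p)" by auto
  qed
  then show "integrable lborel (\<lambda>p. F p * u p)" by (simp add: transport_spacetime)
qed

text \<open>The integrand is the time derivative of \<open>\<phi>\<close> along the characteristic
  from \<open>y\<close>; the endpoint \<open>T'\<close> contributes nothing, and the other gives the
  initial value.\<close>

lemma characteristic_FTC:
  assumes \<phi>: "Cinf \<phi>" and T': "0 < T'" "T' \<le> T" and \<phi>0: "\<And>x. \<phi> (T', x) = 0"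
  shows "(LINT t|lborel. indicator {0<..<T'} t * (dt \<phi> (t, X t y) + V t (X t y) (w (t, X t y)) \<bullet> gradx \<phi> (t, X t y))) = - \<phi> (0, y)"
proof -
  let ?f = "\<lambda>t. dt \<phi> (t, X t y) + V t (X t y) (w (t, X t y)) \<bullet> gradx \<phi> (t, X t y)"
  have cX: "continuous_on S (\<lambda>t. X t y)" for S
  proof -
    have "continuous_on S (\<lambda>t. (\<lambda>(t, y). X t y) (t, y))"
      by (rule continuous_on_compose2[OF X_cont]) (auto intro!: continuous_intros)
    then show ?thesis by simp
  qed
  have cV: "continuous_on S (\<lambda>t. V t (X t y) (w (t, X t y)))" for S
  proof -
    have "continuous_on S (\<lambda>t. (\<lambda>(t, x, w). V t x w) (t, X t y, w (t, X t y)))"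
      by (rule continuous_on_compose2[OF V_cont])
         (auto intro!: continuous_intros cX continuous_on_compose2[OF w_cont])
    then show ?thesis by simp
  qed
  have "has_bochner_integral lborel (\<lambda>t. indicator {0..T'} t *\<^sub>R ?f t) (\<phi> (T', X T' y) - \<phi> (0, X 0 y))"
  proof (rule has_bochner_integral_FTC_Icc[where F = "\<lambda>t. \<phi> (t, X t y)"])
    show "continuous_on {0..T'} ?f"
      by (intro continuous_intros cX cV continuous_on_compose2[OF continuous_dt_gradx(1)[OF \<phi>]]
          continuous_on_compose2[OF continuous_dt_gradx(2)[OF \<phi>]]) auto
    fix t assume t: "0 \<le> t" "t \<le> T'"
    have "((\<lambda>t. X t y) has_derivative (\<lambda>h. h *\<^sub>R V t (X t y) (w (t, X t y)))) (at t within {0..T'})"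
      using has_vector_derivative_within_subset[OF X_deriv[of t y], of "{0..T'}"] t T'
      by (auto simp: has_vector_derivative_def)
    then have "((\<lambda>t. (t, X t y)) has_derivative (\<lambda>h. (h, h *\<^sub>R V t (X t y) (w (t, X t y))))) (at t within {0..T'})"
      by (intro has_derivative_Pair has_derivative_ident)
    from has_derivative_compose[OF this Cinf_has_derivative[OF \<phi>]]
    have "((\<lambda>t. \<phi> (t, X t y)) has_derivative (\<lambda>h. pd (h, h *\<^sub>R V t (X t y) (w (t, X t y))) \<phi> (t, X t y))) (at t within {0..T'})"
      by simp
    moreover have "pd (h, h *\<^sub>R v) \<phi> z = h * (dt \<phi> z + v \<bullet> gradx \<phi> z)" for h v z
      using linear_scale[OF has_derivative_linear[OF Cinf_has_derivative[OF \<phi>, of z]], of h "(1, v)"]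
      by (simp add: pd_time_space[OF \<phi>])
    ultimately show "((\<lambda>t. \<phi> (t, X t y)) has_vector_derivative ?f t) (at t within {0..T'})"
      unfolding has_vector_derivative_def by simp
  qed (use T' in auto)
  then have hb: "has_bochner_integral lborel (\<lambda>t. indicator {0..T'} t *\<^sub>R ?f t) (- \<phi> (0, y))"
    by (simp add: \<phi>0 X_0)
  have "continuous_on UNIV ?f"
    by (intro continuous_intros cX cV continuous_on_compose2[OF continuous_dt_gradx(1)[OF \<phi>]]
          continuous_on_compose2[OF continuous_dt_gradx(2)[OF \<phi>]]) auto
  then have [measurable]: "?f \<in> borel_measurable borel" by (rule borel_measurable_continuous_onI)
  have "(LINT t|lborel. indicator {0<..<T'} t * ?f t) = (LINT t|lborel. indicator {0..T'} t *\<^sub>R ?f t)"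
  proof (rule integral_cong_AE)
    show "AE t in lborel. indicator {0<..<T'} t * ?f t = indicator {0..T'} t *\<^sub>R ?f t"
      using AE_lborel_singleton[of 0] AE_lborel_singleton[of T'] by eventually_elim (auto simp: indicator_def)
  qed measurable
  also have "\<dots> = - \<phi> (0, y)" using hb by (rule has_bochner_integral_integral_eq)
  finally show ?thesis .
qed

text \<open>Almost everywhere the convolution may be replaced by the continuous \<open>w\<close>.
  Moving the space-time integral to starting points and integrating first in time reduces the
  identity to \<open>characteristic_FTC\<close>.\<close>

lemma weak_form:
  assumes T': "0 < T'" "T' \<le> T" and test: "test_fun T' \<phi>"
  shows "set_integrable lebesgue ({0<..<T'} \<times> UNIV)
          (\<lambda>z. u z * (dt \<phi> z + V (fst z) (snd z) (conv u \<eta> z) \<bullet> gradx \<phi> z))"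
    and "(LINT z:{0<..<T'} \<times> UNIV|lebesgue.
            u z * (dt \<phi> z + V (fst z) (snd z) (conv u \<eta> z) \<bullet> gradx \<phi> z))
        + (LINT x|lebesgue. u0 x * \<phi> (0, x)) = 0"
proof -
  obtain K where \<phi>: "Cinf \<phi>" and K: "compact K" "K \<subseteq> {..<T'} \<times> UNIV" "\<And>z. z \<notin> K \<Longrightarrow> \<phi> z = 0"
    using test unfolding test_fun_def by auto
  define \<psi> where "\<psi> z = dt \<phi> z + V (fst z) (snd z) (w z) \<bullet> gradx \<phi> z" for z
  have "continuous_on UNIV (\<lambda>z. (\<lambda>(t, x, w). V t x w) (fst z, snd z, w z))"
    by (rule continuous_on_compose2[OF V_cont]) (auto intro!: continuous_intros w_cont)
  then have \<psi>_cont: "continuous_on UNIV \<psi>"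
    unfolding \<psi>_def by (intro continuous_intros continuous_dt_gradx \<phi>) simp
  then have \<psi>_borel [measurable]: "\<psi> \<in> borel_measurable borel" by (rule borel_measurable_continuous_onI)
  have \<psi>_supp: "\<psi> z = 0" if "z \<notin> K" for z
    using pd_eq_0_outside[OF compact_imp_closed[OF K(1)] K(3) that]
    unfolding \<psi>_def dt_def gradx_def by simp
  have "bounded (\<psi> ` K)"
    by (intro compact_imp_bounded compact_continuous_image continuous_on_subset[OF \<psi>_cont] K) auto
  then obtain B where B: "\<And>z. z \<in> K \<Longrightarrow> \<bar>\<psi> z\<bar> \<le> B" unfolding bounded_iff by auto
  obtain r where r: "\<And>z. z \<in> K \<Longrightarrow> norm z \<le> r"
    using compact_imp_bounded[OF K(1)] unfolding bounded_iff by auto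
  have S [measurable]: "{0<..<T'} \<times> (UNIV :: 'd set) \<in> sets borel" by (simp add: borel_prod[symmetric])
  define F where "F z = indicator ({0<..<T'} \<times> (UNIV :: 'd set)) z * \<psi> z" for z
  have F_borel [measurable]: "F \<in> borel_measurable borel" unfolding F_def by measurable
  have F_bound: "\<bar>F z\<bar> \<le> \<bar>B\<bar>" for z
    using B[of z] \<psi>_supp[of z] by (cases "z \<in> K") (auto simp: F_def indicator_def)
  have F_supp: "t \<in> {0..T} \<and> norm x \<le> r" if "F (t, x) \<noteq> 0" for t x
  proof -
    have "(t, x) \<in> K" "t \<in> {0<..<T'}" using that \<psi>_supp by (auto simp: F_def indicator_def split: if_splits)
    then show ?thesis using r[of "(t, x)"] norm_snd_le[of x t] T' by (auto intro: order_trans)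
  qed
  note int = integrable_transport[OF F_borel F_bound F_supp]
  have ae: "AE z in lebesgue. indicator ({0<..<T'} \<times> UNIV) z *\<^sub>R
      (u z * (dt \<phi> z + V (fst z) (snd z) (conv u \<eta> z) \<bullet> gradx \<phi> z)) = F z * u z"
  proof (rule AE_spacetimeI)
    show "AE t in lborel. \<forall>x. indicator ({0<..<T'} \<times> UNIV) (t, x) *\<^sub>R
      (u (t, x) * (dt \<phi> (t, x) + V (fst (t, x)) (snd (t, x)) (conv u \<eta> (t, x)) \<bullet> gradx \<phi> (t, x))) = F (t, x) * u (t, x)"
      using J_slice by eventually_elim (simp add: conv_u F_def \<psi>_def)
  qed
  have m: "(\<lambda>z. indicator ({0<..<T'} \<times> UNIV) z *\<^sub>R
      (u z * (dt \<phi> z + V (fst z) (snd z) (conv u \<eta> z) \<bullet> gradx \<phi> z))) \<in> borel_measurable borel"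
  proof -
    have "(\<lambda>z. (\<lambda>(t, x, w). V t x w) (fst z, snd z, conv u \<eta> z)) \<in> borel_measurable borel"
      by (rule measurable_compose[OF _ borel_measurable_continuous_onI[OF V_cont]])
         (intro borel_measurable_Pair conv_borel borel_measurable_continuous_onI continuous_intros)
    then have "(\<lambda>z. V (fst z) (snd z) (conv u \<eta> z)) \<in> borel_measurable borel" by simp
    then show ?thesis
      using borel_measurable_continuous_onI[OF continuous_dt_gradx(1)[OF \<phi>]]
        borel_measurable_continuous_onI[OF continuous_dt_gradx(2)[OF \<phi>]] by measurable
  qed
  have m': "(\<lambda>z. indicator ({0<..<T'} \<times> UNIV) z *\<^sub>R
      (u z * (dt \<phi> z + V (fst z) (snd z) (conv u \<eta> z) \<bullet> gradx \<phi> z))) \<in> borel_measurable lebesgue"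
    using m by (intro measurable_completion) simp
  have FuL: "integrable lebesgue (\<lambda>z. F z * u z)"
    using int(2) by (subst integrable_completion) auto
  show "set_integrable lebesgue ({0<..<T'} \<times> UNIV)
          (\<lambda>z. u z * (dt \<phi> z + V (fst z) (snd z) (conv u \<eta> z) \<bullet> gradx \<phi> z))"
    unfolding set_integrable_def
    using FuL m' ae by (subst integrable_cong_AE[where g = "\<lambda>z. F z * u z"]) (auto intro: measurable_completion)
  have "(LINT z:{0<..<T'} \<times> UNIV|lebesgue. u z * (dt \<phi> z + V (fst z) (snd z) (conv u \<eta> z) \<bullet> gradx \<phi> z))
      = (LINT z|lebesgue. F z * u z)"
    unfolding set_lebesgue_integral_def
    using m' ae by (intro integral_cong_AE) (auto intro: measurable_completion)
  also have "\<dots> = (LINT z|lborel. F z * u z)"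
    by (rule integral_completion) simp
  also have "\<dots> = (LINT (t, y)|lborel. F (t, X t y) * u0 y)"
    by (rule transport_spacetime(2)) simp
  also have "\<dots> = (LINT y|lborel. (LINT t|lborel. F (t, X t y) * u0 y))"
    using lborel_pair.integral_snd[of "\<lambda>t y. F (t, X t y) * u0 y"] int(1) by (simp add: lborel_prod)
  also have "\<dots> = (LINT y|lborel. - (u0 y * \<phi> (0, y)))"
  proof (rule Bochner_Integration.integral_cong[OF refl])
    fix y
    have "(LINT t|lborel. F (t, X t y) * u0 y) = (LINT t|lborel. F (t, X t y)) * u0 y"
      by (rule integral_mult_left_zero)
    also have "(LINT t|lborel. F (t, X t y)) = - \<phi> (0, y)"
    proof -
      \<comment> \<open>The support lies in \<open>{..<T'} \<times> UNIV\<close>, so the test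
        function vanishes at time \<open>T'\<close>, although it need not vanish at time 0.\<close>
      have "\<phi> (T', x) = 0" for x using K(2,3) by blast
      from characteristic_FTC[OF \<phi> T' this, of y] show ?thesis
        by (simp add: F_def \<psi>_def indicator_times)
    qed
    finally show "(LINT t|lborel. F (t, X t y) * u0 y) = - (u0 y * \<phi> (0, y))" by simp
  qed
  also have "\<dots> = - (LINT y|lebesgue. u0 y * \<phi> (0, y))"
  proof -
    have "(\<lambda>y. \<phi> (0, y)) \<in> borel_measurable borel"
      by (intro borel_measurable_continuous_onI continuous_on_compose2[OF Cinf_continuous[OF \<phi>, of UNIV]])
         (auto intro!: continuous_intros)
    then show ?thesis by (subst integral_completion) auto
  qed
  finally show "(LINT z:{0<..<T'} \<times> UNIV|lebesgue.
            u z * (dt \<phi> z + V (fst z) (snd z) (conv u \<eta> z) \<bullet> gradx \<phi> z))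
        + (LINT x|lebesgue. u0 x * \<phi> (0, x)) = 0" by simp
qed

lemma dist_sol_u:
  assumes T': "0 < T'" "T' \<le> T" shows "dist_sol V \<eta> u0 T' u"
  unfolding dist_sol_def
proof (intro conjI allI impI)
  show "loc_integrable_on ({0<..<T'} \<times> UNIV) u"
    unfolding loc_integrable_on_def
  proof safe
    fix K assume K: "compact K" "K \<subseteq> {0<..<T'} \<times> (UNIV :: 'd set)"
    have [measurable]: "K \<in> sets borel" using K(1) by (intro borel_closed compact_imp_closed)
    obtain r where r: "\<And>z. z \<in> K \<Longrightarrow> norm z \<le> r"
      using compact_imp_bounded[OF K(1)] unfolding bounded_iff by auto
    have "integrable lborel (\<lambda>p. indicator K p * u p)"
    proof (rule integrable_transport(2)[where B = 1 and r = r])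
      show "t \<in> {0..T} \<and> norm x \<le> r" if "indicator K (t, x) \<noteq> (0::real)" for t x
      proof -
        have "(t, x) \<in> K" using that by (auto simp: indicator_def split: if_splits)
        then show ?thesis using r[of "(t, x)"] norm_snd_le[of x t] T' K(2) by (auto intro: order_trans)
      qed
    qed (auto simp: indicator_def)
    then show "set_integrable lebesgue K u"
      unfolding set_integrable_def by (subst integrable_completion) auto
  qed
  have S [measurable]: "{0<..<T'} \<times> (UNIV :: 'd set) \<in> sets borel" by (simp add: borel_prod[symmetric])
  show "(\<lambda>z. indicator ({0<..<T'} \<times> UNIV) z *\<^sub>R conv u \<eta> z) \<in> borel_measurable lebesgue"
    using conv_borel by (intro measurable_completion) simp
  show "\<exists>M. AE z in lebesgue. z \<in> {0<..<T'} \<times> UNIV \<longrightarrow>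
          integrable lebesgue (\<lambda>y. u (fst z, snd z - y) *\<^sub>R \<eta> y) \<and> norm (conv u \<eta> z) \<le> M"
  proof (intro exI[of _ M] AE_spacetimeI)
    show "AE t in lborel. \<forall>x. (t, x) \<in> {0<..<T'} \<times> UNIV \<longrightarrow>
        integrable lebesgue (\<lambda>y. u (fst (t, x), snd (t, x) - y) *\<^sub>R \<eta> y) \<and> norm (conv u \<eta> (t, x)) \<le> M"
      using J_slice by eventually_elim (auto simp: conv_u w_bound)
  qed
qed (rule T' u0_loc eta_loc weak_form[OF T'] | assumption)+

lemma u_bounded: "(\<And>y. \<bar>u0 y\<bar> \<le> B) \<Longrightarrow> \<bar>u p\<bar> \<le> 4 ^ DIM('d) * B"
  unfolding u_def abs_mult by (intro mult_mono) (simp_all add: J_nonneg J_le)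

text \<open>Split |u|^q into J^(q-1) and J |u0 o Y|^q. The first factor is at most (4^d)^(q-1); the
  second has the same integral as |u0|^q, because \<open>J\<close> is the density of the transported
  slice.\<close>

lemma u_slice_powr:
  assumes q: "1 < q"
  shows "AE t in lborel. (\<integral>\<^sup>+x. ennreal (\<bar>u (t, x)\<bar> powr q) \<partial>lborel) \<le>
     ennreal ((4 ^ DIM('d)) powr (q - 1)) * (\<integral>\<^sup>+y. ennreal (\<bar>u0 y\<bar> powr q) \<partial>lborel)"
  using J_slice
proof eventually_elim
  case (elim t)
  note [measurable] = slice_borel[OF J_borel] slice_borel[OF Y_borel]
  let ?c = "(4 ^ DIM('d)) powr (q - 1) :: real"
  have "(\<integral>\<^sup>+x. ennreal (\<bar>u (t, x)\<bar> powr q) \<partial>lborel) \<le> (\<integral>\<^sup>+x. ennreal ?c * (ennreal (J (t, x)) * ennreal (\<bar>u0 (Y (t, x))\<bar> powr q)) \<partial>lborel)"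
  proof (rule nn_integral_mono)
    fix x
    have "\<bar>u (t, x)\<bar> powr q = (J (t, x) powr (q - 1) * J (t, x)) * \<bar>u0 (Y (t, x))\<bar> powr q"
      using J_nonneg[of "(t, x)"] q
      by (cases "J (t, x) = 0") (auto simp: u_def abs_mult powr_mult powr_diff)
    also have "\<dots> \<le> (?c * J (t, x)) * \<bar>u0 (Y (t, x))\<bar> powr q"
      using J_nonneg[of "(t, x)"] J_le[of "(t, x)"] q by (intro mult_right_mono powr_mono2) auto
    finally show "ennreal (\<bar>u (t, x)\<bar> powr q) \<le> ennreal ?c * (ennreal (J (t, x)) * ennreal (\<bar>u0 (Y (t, x))\<bar> powr q))"
      using J_nonneg[of "(t, x)"] by (simp add: ennreal_mult[symmetric] mult.assoc)
  qed
  also have "\<dots> = ennreal ?c * (\<integral>\<^sup>+x. ennreal (J (t, x)) * ennreal (\<bar>u0 (Y (t, x))\<bar> powr q) \<partial>lborel)"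
    by (rule nn_integral_cmult) measurable
  also have "(\<integral>\<^sup>+x. ennreal (J (t, x)) * ennreal (\<bar>u0 (Y (t, x))\<bar> powr q) \<partial>lborel) =
      (\<integral>\<^sup>+x. ennreal (\<bar>u0 (Y (t, x))\<bar> powr q) \<partial>distr lborel borel (X t))"
    unfolding elim[symmetric] by (rule nn_integral_density[symmetric]) measurable
  also have "\<dots> = (\<integral>\<^sup>+y. ennreal (\<bar>u0 y\<bar> powr q) \<partial>lborel)"
    by (subst nn_integral_distr) (auto simp: Y_X)
  finally show ?case .
qed

end

text \<open>The two bounds hold for every \<open>B\<close> and every \<open>q\<close>, so that one
  construction serves both halves of the theorem.\<close>

lemma (in nonlocal_flow) ex_dist_sol:
  assumes "loc_integrable_on UNIV \<eta>" "loc_integrable_on UNIV u0"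
  shows "\<exists>u. u \<in> borel_measurable borel \<and> (\<forall>T'. 0 < T' \<longrightarrow> T' \<le> T \<longrightarrow> dist_sol V \<eta> u0 T' u)
    \<and> (\<forall>B. (\<forall>y. \<bar>u0 y\<bar> \<le> B) \<longrightarrow> (\<forall>p. \<bar>u p\<bar> \<le> 4 ^ DIM('d) * B))
    \<and> (\<forall>q>1. AE t in lborel. (\<integral>\<^sup>+x. ennreal (\<bar>u (t, x)\<bar> powr q) \<partial>lborel) \<le>
         ennreal ((4 ^ DIM('d)) powr (q - 1)) * (\<integral>\<^sup>+y. ennreal (\<bar>u0 y\<bar> powr q) \<partial>lborel))"
proof -
  obtain X w where X: "continuous_on UNIV (\<lambda>(t, y). X t y)"
      "\<And>t x y. norm ((X t x - x) - (X t y - y)) \<le> norm (x - y) / 2"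
      "\<And>y. X 0 y = y"
      "\<And>t y. t \<in> {0..T} \<Longrightarrow>
        ((\<lambda>t. X t y) has_vector_derivative V t (X t y) (w (t, X t y))) (at t within {0..T})"
      "continuous_on UNIV w"
      "\<And>t z. w (t, z) = (LINT y|lborel. u0 y *\<^sub>R \<eta> (z - X t y))"
      "\<And>p. norm (w p) \<le> M"
    by (rule ex_nonlocal_flow[OF that])
  have ex: "expanding (X t)" for t by (rule expanding_id_plus[OF X(2)])
  obtain J where J: "J \<in> borel_measurable borel" "\<And>p. 0 \<le> J p" "\<And>p. J p \<le> 4 ^ DIM('d)"
      "density lborel (\<lambda>p. ennreal (J p)) = distr lborel borel (\<lambda>(t, y). (t, X t y))"
      "AE t in lborel. density lborel (\<lambda>x. ennreal (J (t, x))) = distr lborel borel (X t)"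
    by (rule ex_flow_density[OF X(1) ex that])
  obtain Y where Y: "continuous_on UNIV Y" "\<And>t y. Y (t, X t y) = y"
    by (rule ex_inverse_flow[OF X(1,2)]) blast
  interpret lagrangian_solution V \<eta> u0 T M X w J Y
    by (rule lagrangian_solution.intro)
       (rule assms X J Y ex integrable_W eta_borel u0_borel lipschitz_on_continuous_on[OF V_lipschitz] | assumption)+
  show ?thesis
    using u_borel dist_sol_u u_bounded u_slice_powr by (intro exI[of _ u] conjI allI impI) simp_all
qed

section \<open>Smooth approximation and translations\<close>

text \<open>The classical flat function exp(-1/s), divided by powers of s: the span of this family
  is closed under differentiation, so higher derivatives need no separate treatment.\<close>

definition flat_exp :: "nat \<Rightarrow> real \<Rightarrow> real" where
  "flat_exp k s = (if s \<le> 0 then 0 else exp (- 1 / s) / s ^ k)"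

text \<open>The single term of order \<open>k + 2\<close> in the exponential series bounds exp(1/s)
  from below. Quadratic decay yields derivative 0 at the origin, where the two branches
  meet.\<close>

lemma flat_exp_le: "\<bar>flat_exp k s\<bar> \<le> fact (k + 2) * s\<^sup>2"
proof (cases "s \<le> 0")
  case False
  then have s: "0 < s" by simp
  define c where "c = (fact (k + 2) :: real)"
  have c: "0 < c" by (simp add: c_def)
  have "(1 / s) ^ (k + 2) /\<^sub>R c \<le> (\<Sum>n. (1 / s) ^ n /\<^sub>R fact n)"
    unfolding c_def
    using s sum_le_suminf[OF sums_summable[OF exp_converges[of "1 / s"]], of "{k + 2}"] by simp
  also have "\<dots> = exp (1 / s)" using exp_converges[of "1 / s"] by (simp add: sums_iff)
  finally have "1 \<le> c * s ^ (k + 2) * exp (1 / s)"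
    using s c by (simp add: power_divide field_simps)
  then have "exp (- 1 / s) / s ^ k \<le> c * s\<^sup>2"
    using s by (simp add: exp_minus power_add power2_eq_square field_simps)
  then show ?thesis using s by (simp add: flat_exp_def c_def)
qed (simp add: flat_exp_def)

lemma DERIV_flat_exp:
  "(flat_exp k has_real_derivative (flat_exp (k + 2) s - real k * flat_exp (k + 1) s)) (at s)"
proof -
  consider "s < 0" | "s = 0" | "0 < s" by linarith
  then show ?thesis
  proof cases
    case 1
    have "((\<lambda>_. 0) has_real_derivative 0) (at s)" by simp
    then have "(flat_exp k has_real_derivative 0) (at s)"
      by (rule DERIV_cong_ev[THEN iffD1, rotated 3, OF _ refl _ refl])
         (use 1 eventually_nhds_in_open[of "{..<0}" s] in \<open>auto simp: flat_exp_def elim!: eventually_mono\<close>)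
    then show ?thesis using 1 by (simp add: flat_exp_def)
  next
    case 2
    have "((\<lambda>h. (flat_exp k (0 + h) - flat_exp k 0) / h) \<longlongrightarrow> 0) (at 0)"
    proof (rule Lim_null_comparison)
      show "\<forall>\<^sub>F h in at 0. norm ((flat_exp k (0 + h) - flat_exp k 0) / h) \<le> fact (k + 2) * \<bar>h\<bar>"
        using flat_exp_le[of k]
        by (intro always_eventually allI) (auto simp: flat_exp_def[of _ 0] divide_simps power2_eq_square abs_mult mult.assoc)
      show "((\<lambda>h. fact (k + 2) * \<bar>h\<bar>) \<longlongrightarrow> 0) (at (0::real))"
        by (auto intro!: tendsto_eq_intros)
    qed
    then show ?thesis using 2 by (simp add: DERIV_def flat_exp_def[of _ 0])
  next
    case 3
    have "((\<lambda>s. exp (- 1 / s) / s ^ k) has_real_derivative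
        (exp (- 1 / s) / s ^ (k + 2) - real k * (exp (- 1 / s) / s ^ (k + 1)))) (at s)"
      using 3 by (cases k) (auto intro!: derivative_eq_intros simp: field_simps power2_eq_square,
          metis One_nat_def power_eq_if)
    then have "(flat_exp k has_real_derivative
        (exp (- 1 / s) / s ^ (k + 2) - real k * (exp (- 1 / s) / s ^ (k + 1)))) (at s)"
      by (rule DERIV_cong_ev[THEN iffD1, rotated 3, OF _ refl _ refl])
         (use 3 eventually_nhds_in_open[of "{0<..}" s] in \<open>auto simp: flat_exp_def elim!: eventually_mono\<close>)
    then show ?thesis using 3 by (simp add: flat_exp_def)
  qed
qed

lemma real_polynomial_function_derivative:
  fixes P :: "'a::euclidean_space \<Rightarrow> real"
  assumes "real_polynomial_function P"
  obtains P' where "\<And>x. (P has_derivative P' x) (at x)" "\<And>v. real_polynomial_function (\<lambda>x. P' x v)"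
proof -
  have "\<exists>P'. (\<forall>x. (P has_derivative P' x) (at x)) \<and> (\<forall>v. real_polynomial_function (\<lambda>x. P' x v))"
    using assms
  proof induction
    case (linear f)
    then show ?case
      by (intro exI[of _ "\<lambda>_. f"]) (auto intro: bounded_linear_imp_has_derivative)
  next
    case (const c)
    show ?case by (intro exI[of _ "\<lambda>_ _. 0"]) auto
  next
    case (add f g)
    then obtain f' g' where "\<forall>x. (f has_derivative f' x) (at x)" "\<forall>v. real_polynomial_function (\<lambda>x. f' x v)"
      "\<forall>x. (g has_derivative g' x) (at x)" "\<forall>v. real_polynomial_function (\<lambda>x. g' x v)" by blast
    then show ?case
      by (intro exI[of _ "\<lambda>x v. f' x v + g' x v"]) (auto intro!: has_derivative_add)
  next
    case (mult f g)
    then obtain f' g' where "\<forall>x. (f has_derivative f' x) (at x)" "\<forall>v. real_polynomial_function (\<lambda>x. f' x v)"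
      "\<forall>x. (g has_derivative g' x) (at x)" "\<forall>v. real_polynomial_function (\<lambda>x. g' x v)" by blast
    with mult.hyps show ?case
      by (intro exI[of _ "\<lambda>x v. f x * g' x v + f' x v * g x"]) (auto intro!: has_derivative_mult real_polynomial_function.intros(3,4))
  qed
  then show ?thesis using that by blast
qed

text \<open>Sums of polynomials times flat functions of R^2 - |x|^2. The factors \<open>P\<close>
  and the index \<open>k\<close> are free so that the class is stable under directional derivatives;
  smoothness then follows by induction on the list of directions.\<close>

inductive bump_class :: "real \<Rightarrow> ('a::euclidean_space \<Rightarrow> real) \<Rightarrow> bool" for R where
  base: "real_polynomial_function P \<Longrightarrow> bump_class R (\<lambda>x. P x * flat_exp k (R\<^sup>2 - x \<bullet> x))"
| add: "bump_class R f \<Longrightarrow> bump_class R g \<Longrightarrow> bump_class R (\<lambda>x. f x + g x)"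

text \<open>The chain rule contributes the polynomial factor -2 (x . v) and raises the index of the
  flat function by 1 or 2; the class absorbs both.\<close>

lemma bump_class_derivative:
  assumes "bump_class R f"
  shows "\<exists>f'. (\<forall>x. (f has_derivative f' x) (at x)) \<and> (\<forall>v. bump_class R (\<lambda>x. f' x v))"
  using assms
proof induction
  case (base P k)
  obtain P' where P': "\<And>x. (P has_derivative P' x) (at x)" "\<And>v. real_polynomial_function (\<lambda>x. P' x v)"
    using real_polynomial_function_derivative[OF base] by metis
  let ?s = "\<lambda>x. R\<^sup>2 - x \<bullet> x"
  let ?f' = "\<lambda>x v. P' x v * flat_exp k (?s x) +
      ((- 2 * P x * (x \<bullet> v)) * flat_exp (k + 2) (?s x) + (2 * real k * P x * (x \<bullet> v)) * flat_exp (k + 1) (?s x))"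
  have "((\<lambda>x. P x * flat_exp k (?s x)) has_derivative ?f' x) (at x)" for x
  proof -
    have "((\<lambda>x. flat_exp k (?s x)) has_derivative
        (\<lambda>v. (- 2 * (x \<bullet> v)) *\<^sub>R (flat_exp (k + 2) (?s x) - real k * flat_exp (k + 1) (?s x)))) (at x)"
      by (rule has_derivative_eq_rhs[OF has_derivative_compose[where g = "flat_exp k" and f = ?s,
              OF _ DERIV_flat_exp[unfolded has_field_derivative_def]]])
         (auto intro!: derivative_eq_intros simp: inner_commute algebra_simps)
    from has_derivative_mult[OF P'(1) this] show ?thesis
      by (rule has_derivative_eq_rhs) (auto simp: algebra_simps)
  qed
  moreover have "bump_class R (\<lambda>x. ?f' x v)" for v
  proof (intro bump_class.intros)
    have "real_polynomial_function (\<lambda>x. x \<bullet> v)"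
      by (intro real_polynomial_function.intros(1) bounded_linear_inner_left)
    then show "real_polynomial_function (\<lambda>x. - 2 * P x * (x \<bullet> v))" "real_polynomial_function (\<lambda>x. 2 * real k * P x * (x \<bullet> v))"
      using base by (intro real_polynomial_function.intros(2,4), simp_all)+
  qed (rule P')
  ultimately show ?case by (intro exI[of _ ?f']) blast
next
  case (add f g)
  then obtain f' g' where "\<forall>x. (f has_derivative f' x) (at x)" "\<forall>v. bump_class R (\<lambda>x. f' x v)"
    "\<forall>x. (g has_derivative g' x) (at x)" "\<forall>v. bump_class R (\<lambda>x. g' x v)" by blast
  then show ?case
    by (intro exI[of _ "\<lambda>x v. f' x v + g' x v"]) (auto intro!: has_derivative_add bump_class.add)
qed

lemma bump_class_Cinf:
  assumes "bump_class R f" shows "Cinf f"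
proof -
  have "bump_class R (iter_pd vs f)" for vs
  proof (induction vs)
    case (Cons v vs)
    obtain f' where f': "\<forall>x. (iter_pd vs f has_derivative f' x) (at x)" "\<forall>v. bump_class R (\<lambda>x. f' x v)"
      using bump_class_derivative[OF Cons] by blast
    then have "pd v (iter_pd vs f) = (\<lambda>x. f' x v)"
      unfolding pd_def by (metis frechet_derivative_at)
    then show ?case using f' by simp
  qed (simp add: assms)
  then show ?thesis
    unfolding Cinf_def using bump_class_derivative differentiableI by blast
qed

text \<open>By Stone--Weierstrass, \<open>g\<close> divided by the bump function can be approximated by
  polynomials; the truncation by \<open>max\<close> keeps the quotient continuous.\<close>

lemma Cinf_approx:
  fixes g :: "'a::euclidean_space \<Rightarrow> real"
  assumes g: "continuous_on UNIV g" "\<And>x. r \<le> norm x \<Longrightarrow> g x = 0" and r: "0 \<le> r" and e: "0 < e"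
  obtains \<psi> where "Cinf \<psi>" "\<And>x. r + 1 \<le> norm x \<Longrightarrow> \<psi> x = 0" "\<And>x. \<bar>g x - \<psi> x\<bar> \<le> e"
proof -
  define R where "R = r + 1"
  define \<rho> where "\<rho> x = flat_exp 0 (R\<^sup>2 - x \<bullet> x)" for x :: 'a
  \<comment> \<open>A positive lower bound of the bump function on \<open>cball 0 r\<close>,
    available because R exceeds r.\<close>
  define c where "c = exp (- 1 / (R\<^sup>2 - r\<^sup>2))"
  have R: "0 < R" "r\<^sup>2 < R\<^sup>2" using r by (auto simp: R_def power2_eq_square algebra_simps)
  have c: "0 < c" by (simp add: c_def)
  have \<rho>_cont: "continuous_on UNIV \<rho>"
    unfolding \<rho>_def
    by (intro continuous_on_compose2[OF DERIV_continuous_on[OF DERIV_flat_exp[THEN has_field_derivative_at_within], of UNIV 0]]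
        continuous_intros) auto
  have \<rho>_0: "\<rho> x = 0" if "R \<le> norm x" for x
    using that R power_mono[of R "norm x" 2] by (simp add: \<rho>_def flat_exp_def dot_square_norm)
  have \<rho>_bounds: "0 \<le> \<rho> x" "\<rho> x \<le> 1" for x
    by (auto simp: \<rho>_def flat_exp_def)
  have \<rho>_c: "c \<le> \<rho> x" if "norm x \<le> r" for x
  proof -
    have "x \<bullet> x \<le> r\<^sup>2" using that power_mono[of "norm x" r 2] by (simp add: dot_square_norm)
    then have "0 < R\<^sup>2 - x \<bullet> x" "1 / (R\<^sup>2 - x \<bullet> x) \<le> 1 / (R\<^sup>2 - r\<^sup>2)"
      using R by (auto intro!: divide_left_mono)
    then show ?thesis by (simp add: \<rho>_def flat_exp_def c_def)
  qed
  define h where "h x = g x / max (\<rho> x) c" for x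
  have "continuous_on (cball 0 R) h"
    unfolding h_def using c
    by (intro continuous_intros continuous_on_subset[OF g(1)] continuous_on_subset[OF \<rho>_cont]) (auto simp: max_def)
  then obtain P where P: "real_polynomial_function P" "\<And>x. x \<in> cball 0 R \<Longrightarrow> \<bar>h x - P x\<bar> < e"
    using Stone_Weierstrass_real_polynomial_function[OF compact_cball _ e, of 0 R h] by metis
  \<comment> \<open>On \<open>cball 0 r\<close> the truncation is inactive; outside,
    \<open>g\<close> and hence \<open>h\<close> vanish. The error of \<open>P\<close> is therefore
    only multiplied by \<open>\<rho>\<close>, which is at most 1.\<close>
  have g_eq: "g x = h x * \<rho> x" for x
  proof (cases "norm x \<le> r")
    case True
    then show ?thesis using \<rho>_c[OF True] c by (simp add: h_def max_def)
  qed (simp add: h_def g(2))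
  show ?thesis
  proof (rule that[of "\<lambda>x. P x * \<rho> x"])
    show "Cinf (\<lambda>x. P x * \<rho> x)"
      unfolding \<rho>_def by (intro bump_class_Cinf[of R] bump_class.base P)
    show "P x * \<rho> x = 0" if "r + 1 \<le> norm x" for x using \<rho>_0[of x] that by (simp add: R_def)
    show "\<bar>g x - P x * \<rho> x\<bar> \<le> e" for x
    proof (cases "norm x \<le> R")
      case True
      have "\<bar>g x - P x * \<rho> x\<bar> = \<bar>h x - P x\<bar> * \<rho> x"
        using \<rho>_bounds[of x] by (simp add: g_eq left_diff_distrib[symmetric] abs_mult)
      also have "\<dots> \<le> e * 1"
        using P(2)[of x] True \<rho>_bounds[of x] e by (intro mult_mono) auto
      finally show ?thesis by simp
    next
      case False
      then show ?thesis using e \<rho>_0[of x] by (simp add: g_eq)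
    qed
  qed
qed

text \<open>The continuous approximants behind \<open>measurable_on\<close> are truncated to [-m, m]
  and cut off linearly between the radii r and r + 1; smoothing up to 1 / (n + 1) costs another unit
  of radius. The sup bound tends to \<open>m\<close>, which keeps the constant in the BV estimate
  sharp.\<close>

lemma Cinf_approx_measurable:
  fixes g :: "'a::euclidean_space \<Rightarrow> real"
  assumes g: "g \<in> borel_measurable borel" "\<And>x. \<bar>g x\<bar> \<le> m" "\<And>x. r < norm x \<Longrightarrow> g x = 0" and r: "0 \<le> r"
  obtains \<psi> where "\<And>n. Cinf (\<psi> n)" "\<And>n x. r + 2 \<le> norm x \<Longrightarrow> \<psi> n x = 0"
    "\<And>n x. \<bar>\<psi> n x\<bar> \<le> m + 1 / real (Suc n)" "AE x in lborel. (\<lambda>n. \<psi> n x) \<longlonglongrightarrow> g x"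
proof -
  have m: "0 \<le> m" using g(2)[of undefined] by linarith
  have "g measurable_on UNIV"
    using g(1) by (intro lebesgue_measurable_imp_measurable_on measurable_completion) auto
  then obtain N c where N: "negligible N" and c: "\<And>n. continuous_on UNIV (c n)"
    and lim: "\<And>x. x \<notin> N \<Longrightarrow> (\<lambda>n. c n x) \<longlonglongrightarrow> g x"
    unfolding measurable_on_def by auto
  define d where "d n x = max (- m) (min m (c n x)) * max 0 (min 1 (r + 1 - norm x))" for n :: nat and x
  have d_cont: "continuous_on UNIV (d n)" for n
    unfolding d_def by (intro continuous_intros c)
  have d_0: "d n x = 0" if "r + 1 \<le> norm x" for n x
    using that by (simp add: d_def)
  have d_le: "\<bar>d n x\<bar> \<le> m" for n x
  proof -
    have "\<bar>d n x\<bar> \<le> m * 1"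
      unfolding d_def abs_mult using m by (intro mult_mono) auto
    then show ?thesis by simp
  qed
  have "\<exists>\<psi>. Cinf \<psi> \<and> (\<forall>x. r + 2 \<le> norm x \<longrightarrow> \<psi> x = 0) \<and> (\<forall>x. \<bar>d n x - \<psi> x\<bar> \<le> 1 / real (Suc n))" for n
  proof -
    obtain \<psi> where "Cinf \<psi>" "\<And>x. (r + 1) + 1 \<le> norm x \<Longrightarrow> \<psi> x = 0" "\<And>x. \<bar>d n x - \<psi> x\<bar> \<le> 1 / real (Suc n)"
      by (rule Cinf_approx[OF d_cont[of n], of "r + 1" "1 / real (Suc n)"]) (use d_0 r in auto)
    then show ?thesis by (intro exI[of _ \<psi>]) auto
  qed
  then obtain \<psi> where \<psi>: "\<And>n. Cinf (\<psi> n)" "\<And>n x. r + 2 \<le> norm x \<Longrightarrow> \<psi> n x = 0"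
    "\<And>n x. \<bar>d n x - \<psi> n x\<bar> \<le> 1 / real (Suc n)"
    by metis
  show ?thesis
  proof (rule that[of \<psi>])
    show "\<bar>\<psi> n x\<bar> \<le> m + 1 / real (Suc n)" for n x
      using d_le[of n x] \<psi>(3)[of n x] by linarith
    have "(\<lambda>n. \<psi> n x) \<longlonglongrightarrow> g x" if "x \<notin> N" for x
    proof -
      have "(\<lambda>n. d n x) \<longlonglongrightarrow> max (- m) (min m (g x)) * max 0 (min 1 (r + 1 - norm x))"
        unfolding d_def by (intro tendsto_intros lim that)
      also have "max (- m) (min m (g x)) * max 0 (min 1 (r + 1 - norm x)) = g x"
        using g(2)[of x] g(3)[of x] by (cases "norm x \<le> r") (auto simp: max_def min_def abs_le_iff)
      finally have 1: "(\<lambda>n. d n x) \<longlonglongrightarrow> g x" .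
      have "(\<lambda>n. d n x - \<psi> n x) \<longlonglongrightarrow> 0"
        by (rule Lim_null_comparison[OF _ LIMSEQ_inverse_real_of_nat])
           (use \<psi>(3) in \<open>auto simp: inverse_eq_divide\<close>)
      from tendsto_diff[OF 1 this] show ?thesis by simp
    qed
    then have "AE x in lebesgue. (\<lambda>n. \<psi> n x) \<longlonglongrightarrow> g x"
      using N by (intro AE_I'[of N]) (auto simp: negligible_iff_null_sets)
    then show "AE x in lborel. (\<lambda>n. \<psi> n x) \<longlonglongrightarrow> g x"
      by (simp add: AE_completion_iff)
  qed (use \<psi> in auto)
qed

section \<open>Translations tested against smooth functions\<close>

lemma lborel_translate:
  fixes f :: "'a::euclidean_space \<Rightarrow> 'b::euclidean_space"
  assumes [measurable]: "f \<in> borel_measurable borel"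
  shows "integrable lborel (\<lambda>y. f (c + y)) \<longleftrightarrow> integrable lborel f"
    and "(LINT y|lborel. f (c + y)) = (LINT y|lborel. f y)"
proof -
  show "integrable lborel (\<lambda>y. f (c + y)) \<longleftrightarrow> integrable lborel f"
    using integrable_distr_eq[of "(+) c" lborel borel f] by (simp add: lborel_distr_plus)
  show "(LINT y|lborel. f (c + y)) = (LINT y|lborel. f y)"
    using integral_distr[of "(+) c" lborel borel f] by (simp add: lborel_distr_plus)
qed

lemma integrable_mult_bounded_support:
  fixes f k :: "'a::euclidean_space \<Rightarrow> real"
  assumes loc: "\<And>r. integrable lborel (\<lambda>x. indicator (cball 0 r) x * f x)"
    and [measurable]: "f \<in> borel_measurable borel" "k \<in> borel_measurable borel"
    and k: "\<And>x. \<bar>k x\<bar> \<le> B" "\<And>x. R < norm x \<Longrightarrow> k x = 0"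
  shows "integrable lborel (\<lambda>x. f x * k x)"
proof (rule Bochner_Integration.integrable_bound)
  show "integrable lborel (\<lambda>x. B * (indicator (cball 0 R) x * f x))"
    by (intro integrable_mult_right loc)
  have "norm (f x * k x) \<le> norm (B * (indicator (cball 0 R) x * f x))" for x
  proof (cases "R < norm x")
    case False
    have "\<bar>k x\<bar> * \<bar>f x\<bar> \<le> \<bar>B\<bar> * \<bar>f x\<bar>" using k(1)[of x] by (intro mult_right_mono) auto
    then show ?thesis using False by (simp add: abs_mult mult.commute)
  qed (simp add: k(2))
  then show "AE x in lborel. norm (f x * k x) \<le> norm (B * (indicator (cball 0 R) x * f x))" by simp
qed measurable

text \<open>Move the translation onto \<open>\<psi>\<close> and write
  \<open>\<psi> (x - h) - \<psi> x\<close> as an integral of directional derivatives along the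
  segment; Fubini's theorem leaves tests of \<open>f\<close> against translated derivatives, which
  is why \<open>b\<close> must bound all translates. Expanding \<open>h\<close> in the basis
  produces the sum of its coordinates.\<close>

lemma translation_test_le:
  fixes f \<psi> :: "'a::euclidean_space \<Rightarrow> real"
  assumes loc: "\<And>r. integrable lborel (\<lambda>x. indicator (cball 0 r) x * f x)"
    and f [measurable]: "f \<in> borel_measurable borel"
    and \<psi>: "Cinf \<psi>" "\<And>x. R \<le> norm x \<Longrightarrow> \<psi> x = 0"
    and b: "\<And>a i. i \<in> Basis \<Longrightarrow> \<bar>LINT x|lborel. f x * pd i \<psi> (x - a)\<bar> \<le> b"
  shows "\<bar>LINT x|lborel. (f (x + h) - f x) * \<psi> x\<bar> \<le> b * (\<Sum>i\<in>Basis. \<bar>h \<bullet> i\<bar>)"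
proof -
  have \<psi>_cont: "continuous_on UNIV \<psi>" by (rule Cinf_continuous[OF \<psi>(1)])
  have pd_cont: "continuous_on UNIV (pd v \<psi>)" for v
    unfolding pd_eq_sum[OF \<psi>(1), of v, abs_def] by (intro continuous_intros Cinf_continuous Cinf_pd \<psi>)
  have pd_0: "pd v \<psi> x = 0" if "R < norm x" for v x
    by (rule pd_eq_0_outside[of "cball 0 R"]) (use \<psi>(2) that in auto)
  have bnd: "\<exists>B. \<forall>x. \<bar>k x\<bar> \<le> B" if "continuous_on UNIV k" "\<And>x. R < norm x \<Longrightarrow> k x = 0" for k :: "'a \<Rightarrow> real"
  proof -
    have "bounded (k ` cball 0 R)"
      by (intro compact_imp_bounded compact_continuous_image continuous_on_subset[OF that(1)]) auto
    then obtain B where B: "\<forall>x\<in>cball 0 R. \<bar>k x\<bar> \<le> B" unfolding bounded_iff by auto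
    have "\<bar>k x\<bar> \<le> \<bar>B\<bar>" for x
    proof (cases "norm x \<le> R")
      case True
      with B have "\<bar>k x\<bar> \<le> B" by simp
      then show ?thesis by linarith
    qed (simp add: that(2))
    then show ?thesis by blast
  qed
  obtain B1 where B1: "\<And>x. \<bar>\<psi> x\<bar> \<le> B1" using bnd[OF \<psi>_cont] \<psi>(2) by auto
  obtain B2 where B2: "\<And>x. \<bar>pd h \<psi> x\<bar> \<le> B2" using bnd[OF pd_cont pd_0] by metis
  have \<psi>_borel [measurable]: "\<psi> \<in> borel_measurable borel" by (rule borel_measurable_continuous_onI[OF \<psi>_cont])
  have pd_borel [measurable]: "pd v \<psi> \<in> borel_measurable borel" for v by (rule borel_measurable_continuous_onI[OF pd_cont])
  have int_\<psi>: "integrable lborel (\<lambda>x. f x * \<psi> (x - a))" for a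
  proof -
    have "\<psi> (x - a) = 0" if "R + norm a < norm x" for x
      using that norm_triangle_ineq2[of x a] by (intro \<psi>(2)) linarith
    then show ?thesis
      by (intro integrable_mult_bounded_support[where B = B1 and R = "R + norm a", OF loc f]) (auto intro: B1)
  qed
  have int_pd: "integrable lborel (\<lambda>x. f x * pd i \<psi> (x - a))" for a i
  proof -
    obtain B where B: "\<And>x. \<bar>pd i \<psi> x\<bar> \<le> B" using bnd[OF pd_cont pd_0] by metis
    have "pd i \<psi> (x - a) = 0" if "R + norm a < norm x" for x
      using that norm_triangle_ineq2[of x a] by (intro pd_0) linarith
    then show ?thesis
      by (intro integrable_mult_bounded_support[where B = B and R = "R + norm a", OF loc f]) (auto intro: B)
  qed
  have pt: "(LINT s|lborel. indicator {0..1} s *\<^sub>R (- pd h \<psi> (x - s *\<^sub>R h))) = \<psi> (x - h) - \<psi> x" for x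
  proof -
    have "has_bochner_integral lborel (\<lambda>s. indicator {0..1} s *\<^sub>R (- pd h \<psi> (x - s *\<^sub>R h))) (\<psi> (x - 1 *\<^sub>R h) - \<psi> (x - 0 *\<^sub>R h))"
    proof (rule has_bochner_integral_FTC_Icc[where F = "\<lambda>s. \<psi> (x - s *\<^sub>R h)"])
      fix s :: real
      have "((\<lambda>s. \<psi> (x - s *\<^sub>R h)) has_derivative (\<lambda>d. pd (- (d *\<^sub>R h)) \<psi> (x - s *\<^sub>R h))) (at s within {0..1})"
        by (rule has_derivative_compose[OF _ Cinf_has_derivative[OF \<psi>(1)]]) (auto intro!: derivative_eq_intros)
      moreover have "pd (- (d *\<^sub>R h)) \<psi> z = d *\<^sub>R (- pd h \<psi> z)" for d z
        using linear_scale[OF has_derivative_linear[OF Cinf_has_derivative[OF \<psi>(1), of z]], of "- d" h] by simp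
      ultimately show "((\<lambda>s. \<psi> (x - s *\<^sub>R h)) has_vector_derivative - pd h \<psi> (x - s *\<^sub>R h)) (at s within {0..1})"
        unfolding has_vector_derivative_def by simp
    next
      show "continuous_on {0..1} (\<lambda>s. - pd h \<psi> (x - s *\<^sub>R h))"
        by (intro continuous_intros continuous_on_compose2[OF pd_cont]) auto
    qed simp
    then show ?thesis by (simp add: has_bochner_integral_iff)
  qed
  define Q where "Q s x = f x * (indicator {0..1} s * (- pd h \<psi> (x - s *\<^sub>R h)))" for s :: real and x
  have Q_int: "integrable (lborel \<Otimes>\<^sub>M lborel) (case_prod Q)"
  proof (rule Bochner_Integration.integrable_bound)
    let ?G = "\<lambda>p. indicator {0..1::real} (fst p) * (B2 * (indicator (cball 0 (R + norm h)) (snd p) * f (snd p)))"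
    have [measurable]: "cball (0::'a) (R + norm h) \<in> sets borel" by simp
    show "integrable (lborel \<Otimes>\<^sub>M lborel) ?G"
    proof (rule lborel_pair.Fubini_integrable)
      have "integrable lborel (\<lambda>t. indicator {0..1::real} t * (LINT y|lborel. norm (B2 * (indicator (cball 0 (R + norm h)) y * f y))))"
        by (intro integrable_mult_left integrable_real_indicator) (auto simp: emeasure_lborel_Icc_eq)
      then show "integrable lborel (\<lambda>t. LINT y|lborel. norm (?G (t, y)))"
        by (simp add: abs_mult)
      show "AE t in lborel. integrable lborel (\<lambda>y. ?G (t, y))"
        by (auto intro!: AE_I2 integrable_mult_right loc)
    qed measurable
    have "norm (Q s x) \<le> norm (?G (s, x))" for s x
    proof (cases "s \<in> {0..1} \<and> norm x \<le> R + norm h")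
      case True
      have "\<bar>pd h \<psi> (x - s *\<^sub>R h)\<bar> * \<bar>f x\<bar> \<le> \<bar>B2\<bar> * \<bar>f x\<bar>"
        using B2[of "x - s *\<^sub>R h"] by (intro mult_right_mono) auto
      then show ?thesis using True by (auto simp: Q_def abs_mult mult.commute)
    next
      case False
      have "pd h \<psi> (x - s *\<^sub>R h) = 0" if "s \<in> {0..1}"
      proof (rule pd_0)
        have "norm (s *\<^sub>R h) \<le> norm h" using that by (simp add: mult_left_le_one_le)
        then show "R < norm (x - s *\<^sub>R h)"
          using False that norm_triangle_ineq2[of x "s *\<^sub>R h"] by simp
      qed
      then show ?thesis by (auto simp: Q_def indicator_def)
    qed
    then show "AE p in lborel \<Otimes>\<^sub>M lborel. norm (case_prod Q p) \<le> norm (?G p)" by auto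
    show "case_prod Q \<in> borel_measurable (lborel \<Otimes>\<^sub>M lborel)" unfolding Q_def by measurable
  qed
  have "(LINT x|lborel. (f (x + h) - f x) * \<psi> x) = (LINT x|lborel. f (h + x) * \<psi> ((h + x) - h)) - (LINT x|lborel. f x * \<psi> x)"
  proof -
    have 1: "integrable lborel (\<lambda>x. f (h + x) * \<psi> ((h + x) - h))"
      using lborel_translate(1)[of "\<lambda>x. f x * \<psi> (x - h)" h] int_\<psi>[of h] by simp
    have "(LINT x|lborel. f (h + x) * \<psi> ((h + x) - h)) - (LINT x|lborel. f x * \<psi> x) =
       (LINT x|lborel. f (h + x) * \<psi> ((h + x) - h) - f x * \<psi> x)"
      using 1 int_\<psi>[of 0] by simp
    also have "\<dots> = (LINT x|lborel. (f (x + h) - f x) * \<psi> x)"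
      by (simp add: algebra_simps)
    finally show ?thesis by simp
  qed
  also have "(LINT x|lborel. f (h + x) * \<psi> ((h + x) - h)) = (LINT x|lborel. f x * \<psi> (x - h))"
    by (rule lborel_translate(2)) measurable
  also have "(LINT x|lborel. f x * \<psi> (x - h)) - (LINT x|lborel. f x * \<psi> x) = (LINT x|lborel. f x * (\<psi> (x - h) - \<psi> x))"
    using int_\<psi>[of h] int_\<psi>[of 0] by (simp add: right_diff_distrib)
  also have "\<dots> = (LINT x|lborel. (LINT s|lborel. Q s x))"
    by (simp add: Q_def pt[symmetric])
  also have "\<dots> = (LINT s|lborel. (LINT x|lborel. Q s x))"
    by (rule lborel_pair.Fubini_integral[OF Q_int])
  finally have eq: "(LINT x|lborel. (f (x + h) - f x) * \<psi> x) = (LINT s|lborel. (LINT x|lborel. Q s x))" .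
  let ?b = "b * (\<Sum>i\<in>Basis. \<bar>h \<bullet> i\<bar>)"
  have inner: "\<bar>LINT x|lborel. Q s x\<bar> \<le> indicator {0..1} s * ?b" for s
  proof -
    have "(LINT x|lborel. Q s x) = - indicator {0..1} s * (LINT x|lborel. f x * pd h \<psi> (x - s *\<^sub>R h))"
      unfolding Q_def by (subst integral_mult_right_zero[symmetric]) (simp add: algebra_simps)
    also have "(LINT x|lborel. f x * pd h \<psi> (x - s *\<^sub>R h)) = (LINT x|lborel. (\<Sum>i\<in>Basis. (h \<bullet> i) * (f x * pd i \<psi> (x - s *\<^sub>R h))))"
      by (simp add: pd_eq_sum[OF \<psi>(1), of h] sum_distrib_left algebra_simps)
    also have "\<dots> = (\<Sum>i\<in>Basis. (h \<bullet> i) * (LINT x|lborel. f x * pd i \<psi> (x - s *\<^sub>R h)))"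
      by (subst Bochner_Integration.integral_sum) (auto intro!: integrable_mult_right int_pd)
    finally have "\<bar>LINT x|lborel. Q s x\<bar> = indicator {0..1} s * \<bar>\<Sum>i\<in>Basis. (h \<bullet> i) * (LINT x|lborel. f x * pd i \<psi> (x - s *\<^sub>R h))\<bar>"
      by (simp add: abs_mult)
    also have "\<dots> \<le> indicator {0..1} s * (\<Sum>i\<in>Basis. \<bar>h \<bullet> i\<bar> * b)"
      by (intro mult_left_mono order_trans[OF sum_abs] sum_mono) (auto simp: abs_mult intro!: mult_left_mono b)
    finally show ?thesis by (simp add: sum_distrib_left mult.commute)
  qed
  have "\<bar>LINT s|lborel. (LINT x|lborel. Q s x)\<bar> \<le> (LINT s|lborel. indicator {0..1::real} s * ?b)"
  proof (rule order_trans[OF integral_abs_bound integral_mono])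
    show "integrable lborel (\<lambda>s. \<bar>LINT x|lborel. Q s x\<bar>)"
      using lborel_pair.integrable_fst'[OF Q_int] by (intro integrable_abs) simp
    show "integrable lborel (\<lambda>s. indicator {0..1::real} s * ?b)"
      by (intro integrable_mult_left integrable_real_indicator) (auto simp: emeasure_lborel_Icc_eq)
  qed (rule inner)
  also have "\<dots> = ?b" by simp
  finally show ?thesis unfolding eq .
qed

section \<open>Translation estimates for BV and Sobolev kernels\<close>

text \<open>An equivalence, because \<open>frechet_derivative\<close> is defined by choice: the
  candidates on both sides agree, so \<open>pd\<close> commutes with translations even where no
  derivative exists.\<close>

lemma has_derivative_translate_iff:
  "((\<lambda>x. f (x - a)) has_derivative D) (at x) \<longleftrightarrow> (f has_derivative D) (at (x - a))"
proof
  assume *: "(f has_derivative D) (at (x - a))"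
  have "((\<lambda>x. x - a) has_derivative (\<lambda>v. v)) (at x)" by (auto intro!: derivative_eq_intros)
  from has_derivative_compose[OF this *] show "((\<lambda>x. f (x - a)) has_derivative D) (at x)" by simp
next
  assume *: "((\<lambda>x. f (x - a)) has_derivative D) (at x)"
  have "((\<lambda>y. f ((y + a) - a)) has_derivative (\<lambda>v. D v)) (at (x - a))"
    by (rule has_derivative_compose[where f = "\<lambda>y. y + a" and g = "\<lambda>x. f (x - a)"])
       (use * in \<open>auto intro!: derivative_eq_intros\<close>)
  then show "(f has_derivative D) (at (x - a))" by simp
qed

lemma pd_translate: "pd v (\<lambda>x. f (x - a)) = (\<lambda>x. pd v f (x - a))"
  by (rule ext) (simp add: pd_def frechet_derivative_def has_derivative_translate_iff)

lemma Cinf_translate: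
  assumes "Cinf f" shows "Cinf (\<lambda>x. f (x - a))"
proof -
  have "iter_pd vs (\<lambda>x. f (x - a)) = (\<lambda>x. iter_pd vs f (x - a))" for vs
    by (induction vs) (simp_all add: pd_translate)
  then show ?thesis
    using assms unfolding Cinf_def differentiable_def by (simp add: has_derivative_translate_iff)
qed

section \<open>BV kernels\<close>

lemma tv_set_0: "0 \<in> tv_set \<eta>"
proof -
  have "divg (\<lambda>_. 0) x = 0" for x :: 'a
    by (simp add: divg_def)
  then show ?thesis
    unfolding tv_set_def
    by (intro CollectI exI[of _ "\<lambda>_ _. 0"]) (auto simp: C1_field_def compact_supp_def intro: exI[of _ "{}"])
qed

lemma total_variation_nonneg: "is_BV \<eta> \<Longrightarrow> 0 \<le> total_variation \<eta>"
  unfolding is_BV_def total_variation_def by (auto intro: cSup_upper tv_set_0)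

text \<open>The matrix field used has a single nonzero entry \<open>c * \<psi> x\<close>, in row
  \<open>j\<close> and column \<open>i\<close>, with c = 1 / S or -1 / S. Its norm is at most 1 and
  its divergence is \<open>c * pd i \<psi> x\<close>; the two signs give the absolute value.\<close>

lemma BV_test_le:
  fixes \<eta> :: "'d::euclidean_space \<Rightarrow> 'n::euclidean_space"
  assumes BV: "is_BV \<eta>" and j: "j \<in> Basis" and i: "i \<in> Basis"
    and \<psi>: "Cinf \<psi>" "\<And>x. R \<le> norm x \<Longrightarrow> \<psi> x = 0" "\<And>x. \<bar>\<psi> x\<bar> \<le> S" and S: "0 < S"
  shows "\<bar>LINT x|lebesgue. (\<eta> x \<bullet> j) * pd i \<psi> x\<bar> \<le> total_variation \<eta> * S"
proof -
  have le: "c * (LINT x|lebesgue. (\<eta> x \<bullet> j) * pd i \<psi> x) \<le> total_variation \<eta>" if c: "\<bar>c\<bar> = 1 / S" for c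
  proof -
    define \<Phi> where "\<Phi> j' x = (if j' = j then (c * \<psi> x) *\<^sub>R i else 0)" for j' :: 'n and x
    have der: "(\<Phi> j has_derivative (\<lambda>v. (c * pd v \<psi> x) *\<^sub>R i)) (at x)" for x
      unfolding \<Phi>_def by (auto intro!: derivative_eq_intros Cinf_has_derivative[OF \<psi>(1)])
    have zero: "\<Phi> j' = (\<lambda>_. 0)" if "j' \<noteq> j" for j' using that by (auto simp: \<Phi>_def)
    have fr: "frechet_derivative (\<Phi> j) (at x) = (\<lambda>v. (c * pd v \<psi> x) *\<^sub>R i)" for x
      using frechet_derivative_at[OF der[of x]] by simp
    have pd_cont: "continuous_on UNIV (pd v \<psi>)" for v
      unfolding pd_eq_sum[OF \<psi>(1), of v, abs_def] by (intro continuous_intros Cinf_continuous Cinf_pd \<psi>)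
    have "C1_field (\<Phi> j)"
      unfolding C1_field_def fr using der pd_cont by (auto intro!: continuous_intros differentiableI)
    moreover have "compact_supp (\<Phi> j)"
      unfolding compact_supp_def by (rule exI[of _ "cball 0 R"]) (auto simp: \<Phi>_def \<psi>(2))
    moreover have "C1_field (\<lambda>_. 0 :: 'd)" "compact_supp (\<lambda>_. 0 :: 'd)"
      by (auto simp: C1_field_def compact_supp_def intro: exI[of _ "{}"])
    ultimately have C: "\<forall>j'\<in>Basis. C1_field (\<Phi> j') \<and> compact_supp (\<Phi> j')"
      using zero by metis
    have N: "(\<Sum>j'\<in>Basis. (norm (\<Phi> j' x))\<^sup>2) \<le> 1" for x
    proof -
      have "(\<Sum>j'\<in>Basis. (norm (\<Phi> j' x))\<^sup>2) = (\<Sum>j'\<in>Basis. if j' = j then (c * \<psi> x)\<^sup>2 else 0)"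
        using i by (intro sum.cong) (auto simp: \<Phi>_def power_mult_distrib)
      also have "\<dots> = \<bar>c * \<psi> x\<bar>\<^sup>2" using j by simp
      also have "\<dots> \<le> 1\<^sup>2"
        using \<psi>(3)[of x] S c by (intro power_mono) (auto simp: abs_mult)
      finally show ?thesis by simp
    qed
    have div: "divg (\<Phi> j) x = c * pd i \<psi> x" for x
      unfolding divg_def fr using i by (simp add: inner_Basis if_distrib cong: if_cong)
    have div0: "divg (\<Phi> j') x = 0" if "j' \<noteq> j" for j' x
      unfolding zero[OF that] by (simp add: divg_def)
    have "(\<Sum>j'\<in>Basis. (\<eta> x \<bullet> j') * divg (\<Phi> j') x) = c * ((\<eta> x \<bullet> j) * pd i \<psi> x)" for x
    proof -
      have "(\<Sum>j'\<in>Basis. (\<eta> x \<bullet> j') * divg (\<Phi> j') x) = (\<Sum>j'\<in>Basis. if j' = j then c * ((\<eta> x \<bullet> j) * pd i \<psi> x) else 0)"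
        using div div0 by (intro sum.cong) auto
      then show ?thesis using j by simp
    qed
    then have "c * (LINT x|lebesgue. (\<eta> x \<bullet> j) * pd i \<psi> x) =
        (LINT x|lebesgue. (\<Sum>j'\<in>Basis. (\<eta> x \<bullet> j') * divg (\<Phi> j') x))" by simp
    also have "\<dots> \<in> tv_set \<eta>" unfolding tv_set_def using C N by blast
    finally show ?thesis
      using BV unfolding total_variation_def is_BV_def by (intro cSup_upper) auto
  qed
  show ?thesis using le[of "1 / S"] le[of "- 1 / S"] S by (auto simp: field_simps abs_le_iff)
qed

lemma integral_test_limit:
  fixes k g :: "'a::euclidean_space \<Rightarrow> real"
  assumes loc: "\<And>r. integrable lborel (\<lambda>x. indicator (cball 0 r) x * k x)"
    and [measurable]: "k \<in> borel_measurable borel" "g \<in> borel_measurable borel" "\<And>n. \<psi> n \<in> borel_measurable borel"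
    and \<psi>: "\<And>n x. \<bar>\<psi> n x\<bar> \<le> B" "\<And>n x. R \<le> norm x \<Longrightarrow> \<psi> n x = 0"
    and lim: "AE x in lborel. (\<lambda>n. \<psi> n x) \<longlonglongrightarrow> g x"
  shows "(\<lambda>n. LINT x|lborel. k x * \<psi> n x) \<longlonglongrightarrow> (LINT x|lborel. k x * g x)"
proof (rule integral_dominated_convergence)
  show "integrable lborel (\<lambda>x. B * \<bar>indicator (cball 0 R) x * k x\<bar>)"
    by (intro integrable_mult_right integrable_abs loc)
  show "AE x in lborel. (\<lambda>n. k x * \<psi> n x) \<longlonglongrightarrow> k x * g x"
    using lim by eventually_elim (intro tendsto_intros)
  have B: "0 \<le> B" using \<psi>(1)[of 0 undefined] by linarith
  have "norm (k x * \<psi> n x) \<le> B * \<bar>indicator (cball 0 R) x * k x\<bar>" for n x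
  proof (cases "R \<le> norm x")
    case True
    then show ?thesis using B by (simp add: \<psi>(2))
  next
    case False
    have "\<bar>k x\<bar> * \<bar>\<psi> n x\<bar> \<le> \<bar>k x\<bar> * B" by (intro mult_left_mono \<psi>) auto
    then show ?thesis using False by (simp add: abs_mult mult.commute)
  qed
  then show "AE x in lborel. norm (k x * \<psi> n x) \<le> B * \<bar>indicator (cball 0 R) x * k x\<bar>" for n by simp
qed measurable

lemma integral_inner_cong_AE:
  fixes \<eta> :: "'d::euclidean_space \<Rightarrow> 'n::euclidean_space"
  assumes \<eta>: "\<eta> \<in> borel_measurable lebesgue" and \<eta>' [measurable]: "\<eta>' \<in> borel_measurable borel"
    and ae: "AE x in lborel. \<eta> x = \<eta>' x" and g [measurable]: "g \<in> borel_measurable borel"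
  shows "(LINT x|lborel. (\<eta>' x \<bullet> j) * g x) = (LINT x|lebesgue. (\<eta> x \<bullet> j) * g x)"
proof -
  have m: "(\<lambda>x. (\<eta>' x \<bullet> j) * g x) \<in> borel_measurable lborel" by measurable
  have g': "g \<in> borel_measurable lebesgue" using g by (intro measurable_completion) simp
  have "(LINT x|lborel. (\<eta>' x \<bullet> j) * g x) = (LINT x|lebesgue. (\<eta>' x \<bullet> j) * g x)"
    by (rule integral_completion[OF m, symmetric])
  also have "\<dots> = (LINT x|lebesgue. (\<eta> x \<bullet> j) * g x)"
  proof (rule integral_cong_AE)
    show "(\<lambda>x. (\<eta> x \<bullet> j) * g x) \<in> borel_measurable lebesgue"
      by (intro borel_measurable_times borel_measurable_inner \<eta> g') simp
    show "AE x in lebesgue. (\<eta>' x \<bullet> j) * g x = (\<eta> x \<bullet> j) * g x"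
      using AE_completion[OF ae] by eventually_elim simp
  qed (rule measurable_completion[OF m])
  finally show ?thesis .
qed

text \<open>Duality of L1 and bounded functions: testing the difference \<open>k\<close> against its
  sign on a ball gives the integral of |k| there. The sign is approximated by smooth functions
  bounded by 1 + 1 / (n + 1), so the constant tends to the total variation; finally the balls
  exhaust the space.\<close>

lemma BV_translation_le:
  fixes \<eta> :: "'d::euclidean_space \<Rightarrow> 'n::euclidean_space"
  assumes BV: "is_BV \<eta>" and j: "j \<in> Basis"
    and \<eta>' [measurable]: "\<eta>' \<in> borel_measurable borel" and ae: "AE x in lborel. \<eta> x = \<eta>' x"
  shows "(\<integral>\<^sup>+x. ennreal \<bar>(\<eta>' (x + h) - \<eta>' x) \<bullet> j\<bar> \<partial>lborel) \<le> ennreal (total_variation \<eta> * (\<Sum>i\<in>Basis. \<bar>h \<bullet> i\<bar>))"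
proof -
  define f where "f x = \<eta>' x \<bullet> j" for x
  have f [measurable]: "f \<in> borel_measurable borel" unfolding f_def by measurable
  have ae': "AE x in lebesgue. \<eta> x = \<eta>' x" using ae by (rule AE_completion)
  have \<eta>_meas: "\<eta> \<in> borel_measurable lebesgue" using BV unfolding is_BV_def by auto
  have "integrable lebesgue \<eta>'"
    using BV ae' unfolding is_BV_def by (subst integrable_cong_AE[where g = \<eta>, OF measurable_completion]) auto
  then have f_int: "integrable lborel f"
    unfolding f_def by (intro integrable_inner_left) (simp add: integrable_completion)
  have loc: "integrable lborel (\<lambda>x. indicator (cball 0 r) x * f x)" for r
    using integrable_mult_indicator[OF _ f_int, of "cball 0 r"] by simp
  define k where "k x = f (x + h) - f x" for x
  have k [measurable]: "k \<in> borel_measurable borel" unfolding k_def by measurable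
  have k_int: "integrable lborel k"
    unfolding k_def using f_int lborel_translate(1)[OF f, of h] by (auto simp: add.commute)
  have k_loc: "integrable lborel (\<lambda>x. indicator (cball 0 r) x * k x)" for r
    using integrable_mult_indicator[OF _ k_int, of "cball 0 r"] by simp
  let ?s = "\<Sum>i\<in>Basis. \<bar>h \<bullet> i\<bar>"
  have ball: "(LINT x|lborel. \<bar>k x\<bar> * indicator (cball 0 (real r)) x) \<le> total_variation \<eta> * ?s" for r :: nat
  proof -
    have [measurable]: "cball (0::'d) r \<in> sets borel" by simp
    define g where "g x = sgn (k x) * indicator (cball 0 (real r)) x" for x
    have g [measurable]: "g \<in> borel_measurable borel" unfolding g_def by measurable
    obtain \<psi> where \<psi>: "\<And>n. Cinf (\<psi> n)" "\<And>n x. real r + 2 \<le> norm x \<Longrightarrow> \<psi> n x = 0"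
      "\<And>n x. \<bar>\<psi> n x\<bar> \<le> 1 + 1 / real (Suc n)" "AE x in lborel. (\<lambda>n. \<psi> n x) \<longlonglongrightarrow> g x"
      by (rule Cinf_approx_measurable[OF g, of 1 "real r"]) (auto simp: g_def indicator_def sgn_if)
    have \<psi>m: "\<psi> n \<in> borel_measurable borel" for n
      by (intro borel_measurable_continuous_onI Cinf_continuous \<psi>)
    have "(\<lambda>n. LINT x|lborel. k x * \<psi> n x) \<longlonglongrightarrow> (LINT x|lborel. k x * g x)"
    proof (rule integral_test_limit[OF k_loc k g \<psi>m _ \<psi>(2) \<psi>(4)])
      show "\<bar>\<psi> n x\<bar> \<le> 2" for n x
        using \<psi>(3)[of n x] by (smt (verit) divide_le_eq_1_pos of_nat_0_less_iff of_nat_1 of_nat_le_iff zero_less_Suc Suc_le_mono le0 One_nat_def)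
    qed
    then have "(\<lambda>n. \<bar>LINT x|lborel. k x * \<psi> n x\<bar>) \<longlonglongrightarrow> \<bar>LINT x|lborel. k x * g x\<bar>"
      by (intro tendsto_intros)
    moreover have "(\<lambda>n. total_variation \<eta> * (1 + 1 / real (Suc n)) * ?s) \<longlonglongrightarrow> total_variation \<eta> * (1 + 0) * ?s"
      using LIMSEQ_inverse_real_of_nat by (intro tendsto_intros) (simp add: inverse_eq_divide)
    moreover have "\<bar>LINT x|lborel. k x * \<psi> n x\<bar> \<le> total_variation \<eta> * (1 + 1 / real (Suc n)) * ?s" for n
      unfolding k_def
    proof (rule translation_test_le[OF loc f \<psi>(1) \<psi>(2)])
      fix a i :: 'd assume i: "i \<in> Basis"
      have "continuous_on UNIV (\<lambda>x. pd i (\<psi> n) (x - a))"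
        by (intro continuous_on_compose2[OF Cinf_continuous[OF Cinf_pd[OF \<psi>(1) i], of UNIV]] continuous_intros) auto
      then have [measurable]: "(\<lambda>x. pd i (\<psi> n) (x - a)) \<in> borel_measurable borel" by (rule borel_measurable_continuous_onI)
      have "(LINT x|lborel. f x * pd i (\<psi> n) (x - a)) = (LINT x|lebesgue. (\<eta> x \<bullet> j) * pd i (\<lambda>x. \<psi> n (x - a)) x)"
        unfolding pd_translate f_def by (intro integral_inner_cong_AE \<eta>_meas \<eta>' ae) measurable
      also have "\<bar>\<dots>\<bar> \<le> total_variation \<eta> * (1 + 1 / real (Suc n))"
      proof (rule BV_test_le[OF BV j i Cinf_translate[OF \<psi>(1)], where R = "real r + 2 + norm a"])
        show "\<psi> n (x - a) = 0" if "real r + 2 + norm a \<le> norm x" for x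
          using that norm_triangle_ineq2[of x a] by (intro \<psi>(2)) linarith
      qed (rule \<psi>(3), simp add: add_pos_nonneg)
      finally show "\<bar>LINT x|lborel. f x * pd i (\<psi> n) (x - a)\<bar> \<le> total_variation \<eta> * (1 + 1 / real (Suc n))" .
    qed
    ultimately have "\<bar>LINT x|lborel. k x * g x\<bar> \<le> total_variation \<eta> * (1 + 0) * ?s"
      by (intro LIMSEQ_le[OF _ _ exI[of _ 0]]) auto
    moreover have "(\<lambda>x. k x * g x) = (\<lambda>x. \<bar>k x\<bar> * indicator (cball 0 (real r)) x)"
      by (auto simp: g_def sgn_if fun_eq_iff)
    ultimately show ?thesis by simp
  qed
  have "(\<lambda>r. LINT x|lborel. \<bar>k x\<bar> * indicator (cball 0 (real r)) x) \<longlonglongrightarrow> (LINT x|lborel. \<bar>k x\<bar>)"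
  proof (rule integral_dominated_convergence[where w = "\<lambda>x. \<bar>k x\<bar>"])
    have "(\<lambda>r. \<bar>k x\<bar> * indicator (cball 0 (real r)) x) \<longlonglongrightarrow> \<bar>k x\<bar>" for x
    proof (rule tendsto_eventually)
      obtain n :: nat where "norm x \<le> real n" using real_arch_simple by blast
      then show "\<forall>\<^sub>F r in sequentially. \<bar>k x\<bar> * indicator (cball 0 (real r)) x = \<bar>k x\<bar>"
        by (intro eventually_sequentiallyI[of n]) (auto simp: indicator_def)
    qed
    then show "AE x in lborel. (\<lambda>r. \<bar>k x\<bar> * indicator (cball 0 (real r)) x) \<longlonglongrightarrow> \<bar>k x\<bar>" by simp
    show "(\<lambda>x. \<bar>k x\<bar> * indicator (cball 0 (real r)) x) \<in> borel_measurable lborel" for r :: nat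
      by (intro borel_measurable_times borel_measurable_indicator) auto
  qed (use k_int in \<open>auto simp: indicator_def\<close>)
  then have "(LINT x|lborel. \<bar>k x\<bar>) \<le> total_variation \<eta> * ?s"
    by (rule LIMSEQ_le_const2) (use ball in auto)
  moreover have "(\<integral>\<^sup>+x. ennreal \<bar>k x\<bar> \<partial>lborel) = ennreal (LINT x|lborel. \<bar>k x\<bar>)"
    using k_int by (intro nn_integral_eq_integral) auto
  ultimately show ?thesis by (simp add: k_def f_def inner_diff_left ennreal_leI)
qed

section \<open>Sobolev kernels: duality through Young's inequality\<close>

lemma Young_le:
  fixes p a b :: real
  assumes p: "1 < p" and "0 \<le> a" "0 \<le> b"
  shows "a * b \<le> a powr p + b powr (p / (p - 1))"
proof -
  have "a * b \<le> a powr p / p + b powr (p / (p - 1)) / (p / (p - 1))"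
    using assms by (intro Youngs_inequality) (auto simp: field_simps)
  also have "\<dots> \<le> a powr p / 1 + b powr (p / (p - 1)) / 1"
    using p by (intro add_mono divide_left_mono) (auto simp: field_simps)
  finally show ?thesis by simp
qed

lemma Lp_norm_powr:
  assumes "0 < p" shows "Lp_norm p f powr p = (LINT x|lebesgue. norm (f x) powr p)"
proof -
  have "0 \<le> (LINT x|lebesgue. norm (f x) powr p)" by (intro integral_nonneg_AE) auto
  then show ?thesis using assms by (simp add: Lp_norm_def powr_powr)
qed

text \<open>The weak gradient takes over the derivative, then Young's inequality is applied to
  \<open>frob G x / \<kappa>\<close> and the test function. Dividing by \<open>\<kappa>\<close>
  brings the integral of the p-th power down to at most 1; the added 1 keeps \<open>\<kappa>\<close>
  positive when the gradient vanishes.\<close>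

lemma Sobolev_test_le:
  fixes \<eta> :: "'d::euclidean_space \<Rightarrow> 'n::euclidean_space"
  assumes p: "1 < p" and G: "weak_grad \<eta> G" "Lp p (frob G)" and j: "j \<in> Basis" and i: "i \<in> Basis"
    and \<psi>: "Cinf \<psi>" "\<And>x. R \<le> norm x \<Longrightarrow> \<psi> x = 0" and \<psi>q: "integrable lebesgue (\<lambda>x. \<bar>\<psi> x\<bar> powr (p / (p - 1)))"
  shows "\<bar>LINT x|lebesgue. (\<eta> x \<bullet> j) * pd i \<psi> x\<bar> \<le>
     (Lp_norm p (frob G) + 1) * (1 + (LINT x|lebesgue. \<bar>\<psi> x\<bar> powr (p / (p - 1))))"
proof -
  define \<kappa> where "\<kappa> = Lp_norm p (frob G) + 1"
  have \<kappa>: "0 < \<kappa>" by (simp add: \<kappa>_def Lp_norm_def add_nonneg_pos)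
  have supp: "compact_supp \<psi>" unfolding compact_supp_def by (rule exI[of _ "cball 0 R"]) (auto simp: \<psi>(2))
  have eq: "(LINT x|lebesgue. (\<eta> x \<bullet> j) * pd i \<psi> x) = - (LINT x|lebesgue. (G j x \<bullet> i) * \<psi> x)"
    using G(1) \<psi>(1) supp i j unfolding weak_grad_def by blast
  have frob_le: "\<bar>G j x \<bullet> i\<bar> \<le> frob G x" for x
  proof -
    have "\<bar>G j x \<bullet> i\<bar> \<le> norm (G j x)" using i by (rule Basis_le_norm)
    also have "\<dots> = sqrt ((norm (G j x))\<^sup>2)" by simp
    also have "\<dots> \<le> frob G x" unfolding frob_def
      using j by (intro real_sqrt_le_mono member_le_sum) auto
    finally show ?thesis .
  qed
  have frob_0: "0 \<le> frob G x" for x by (simp add: frob_def sum_nonneg)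
  let ?w = "\<lambda>x. \<kappa> * (\<kappa> powr (- p) * frob G x powr p + \<bar>\<psi> x\<bar> powr (p / (p - 1)))"
  have fp: "integrable lebesgue (\<lambda>x. frob G x powr p)"
    using G(2) frob_0 unfolding Lp_def by simp
  have w_int: "integrable lebesgue ?w"
    by (intro integrable_mult_right Bochner_Integration.integrable_add fp \<psi>q)
  have pt: "\<bar>(G j x \<bullet> i) * \<psi> x\<bar> \<le> ?w x" for x
  proof -
    have "\<bar>(G j x \<bullet> i) * \<psi> x\<bar> \<le> \<kappa> * ((frob G x / \<kappa>) * \<bar>\<psi> x\<bar>)"
      using frob_le[of x] \<kappa> by (auto simp: abs_mult intro!: mult_right_mono)
    also have "\<dots> \<le> \<kappa> * ((frob G x / \<kappa>) powr p + \<bar>\<psi> x\<bar> powr (p / (p - 1)))"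
      using \<kappa> frob_0[of x] by (intro mult_left_mono Young_le p) auto
    also have "(frob G x / \<kappa>) powr p = \<kappa> powr (- p) * frob G x powr p"
      using \<kappa> frob_0[of x] by (simp add: powr_divide powr_minus field_simps)
    finally show ?thesis .
  qed
  have "\<bar>LINT x|lebesgue. (G j x \<bullet> i) * \<psi> x\<bar> \<le> (LINT x|lebesgue. ?w x)"
  proof (cases "integrable lebesgue (\<lambda>x. (G j x \<bullet> i) * \<psi> x)")
    case True
    have "\<bar>LINT x|lebesgue. (G j x \<bullet> i) * \<psi> x\<bar> \<le> (LINT x|lebesgue. \<bar>(G j x \<bullet> i) * \<psi> x\<bar>)"
      by (rule integral_abs_bound)
    also have "\<dots> \<le> (LINT x|lebesgue. ?w x)"
      by (rule integral_mono[OF integrable_abs[OF True] w_int pt])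
    finally show ?thesis .
  next
    \<comment> \<open>The Bochner integral of a non-integrable function is 0 by convention, and the
      right-hand side is nonnegative.\<close>
    case False
    have "0 \<le> (LINT x|lebesgue. ?w x)"
      by (rule Bochner_Integration.integral_nonneg) (use pt order_trans[OF abs_ge_zero] in blast)
    then show ?thesis by (simp add: not_integrable_integral_eq[OF False])
  qed
  also have "(LINT x|lebesgue. ?w x) = \<kappa> * (\<kappa> powr (- p) * (LINT x|lebesgue. frob G x powr p) + (LINT x|lebesgue. \<bar>\<psi> x\<bar> powr (p / (p - 1))))"
    using fp \<psi>q by simp
  also have "\<dots> \<le> \<kappa> * (1 + (LINT x|lebesgue. \<bar>\<psi> x\<bar> powr (p / (p - 1))))"
  proof -
    have "(LINT x|lebesgue. frob G x powr p) = Lp_norm p (frob G) powr p"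
      using Lp_norm_powr[of p "frob G"] p frob_0 by simp
    also have "\<dots> \<le> \<kappa> powr p" using p by (intro powr_mono2) (auto simp: \<kappa>_def Lp_norm_def)
    finally have "\<kappa> powr (- p) * (LINT x|lebesgue. frob G x powr p) \<le> 1"
      using \<kappa> by (simp add: powr_minus field_simps)
    then show ?thesis using \<kappa> by (intro mult_left_mono) auto
  qed
  finally show ?thesis unfolding eq \<kappa>_def by simp
qed


lemma powr_integrable_imp_loc:
  fixes f :: "'a::euclidean_space \<Rightarrow> real"
  assumes [measurable]: "f \<in> borel_measurable borel" and p: "1 \<le> p"
    and int: "integrable lborel (\<lambda>x. \<bar>f x\<bar> powr p)"
  shows "integrable lborel (\<lambda>x. indicator (cball 0 r) x * f x)"
proof (rule Bochner_Integration.integrable_bound)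
  have [measurable]: "cball (0::'a) r \<in> sets borel" by simp
  show "integrable lborel (\<lambda>x. indicator (cball 0 r) x + \<bar>f x\<bar> powr p)"
    using emeasure_lborel_cball_finite[of "0::'a" r]
    by (intro Bochner_Integration.integrable_add int integrable_real_indicator) auto
  show "(\<lambda>x. indicator (cball 0 r) x * f x) \<in> borel_measurable lborel" by measurable
  have "\<bar>f x\<bar> \<le> 1 + \<bar>f x\<bar> powr p" for x
  proof (cases "\<bar>f x\<bar> \<le> 1")
    case False
    then have "\<bar>f x\<bar> powr 1 \<le> \<bar>f x\<bar> powr p" using p by (intro powr_mono) auto
    then show ?thesis by simp
  qed (simp add: add_increasing2)
  then show "AE x in lborel. norm (indicator (cball 0 r) x * f x) \<le> norm (indicator (cball 0 r) x + \<bar>f x\<bar> powr p)"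
    by (auto simp: indicator_def)
qed

text \<open>Optimising over the scaling \<open>t\<close> of the test function replaces Hoelder's inequality by
  Young's in the duality argument below.\<close>

lemma powr_dual_bound:
  fixes I c p :: real
  assumes p: "1 < p" and c: "0 < c"
    and le: "\<And>t. 0 < t \<Longrightarrow> t * I \<le> c * (1 + t powr (p / (p - 1)) * I)"
  shows "I \<le> (2 * c) powr p"
proof -
  \<comment> \<open>This choice makes \<open>t powr (p / (p - 1))\<close> equal to
    \<open>t / (2 * c)\<close>, so the term with \<open>I\<close> on the right is half of the
    left-hand side and can be absorbed. What remains is \<open>I \<le> 2 * c / t\<close>.\<close>
  define t where "t = (2 * c) powr (- (p - 1))"
  have t: "0 < t" using c by (simp add: t_def)
  have "- (p - 1) * (p / (p - 1)) = - (p - 1) - 1" using p by (simp add: field_simps)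
  then have "t powr (p / (p - 1)) = (2 * c) powr (- (p - 1) - 1)"
    unfolding t_def powr_powr by simp
  also have "\<dots> = t / (2 * c)" using c by (simp add: t_def powr_diff powr_minus_divide)
  finally have "t * I \<le> c * (1 + t / (2 * c) * I)" using le[OF t] by simp
  also have "\<dots> = c + t * I / 2" using c by (simp add: field_simps)
  finally have "I \<le> 2 * c / t" using t by (simp add: field_simps)
  also have "\<dots> = (2 * c) powr p"
    using c powr_add[of "2 * c" "p - 1" 1] powr_add[of "2 * c" "1 - p" "p - 1"]
    by (simp add: t_def divide_simps mult.commute)
  finally show ?thesis .
qed

text \<open>Test the difference \<open>k\<close> against t sgn(k) |k|^(p-1), the extremal function
  of the duality of L^p and L^q. With I the integral of |k|^p, the pairing is t I and the integral
  of the q-th power of the test function is t^q I, the situation of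
  \<open>powr_dual_bound\<close>.\<close>

lemma Sobolev_translation_le:
  fixes \<eta> :: "'d::euclidean_space \<Rightarrow> 'n::euclidean_space"
  assumes p: "1 < p" and L: "Lp p \<eta>" and G: "weak_grad \<eta> G" "Lp p (frob G)" and j: "j \<in> Basis"
    and \<eta>' [measurable]: "\<eta>' \<in> borel_measurable borel" and ae: "AE x in lborel. \<eta> x = \<eta>' x"
    and c: "(Lp_norm p (frob G) + 1) * (\<Sum>i\<in>Basis. \<bar>h \<bullet> i\<bar>) \<le> c" "0 < c"
  shows "(\<integral>\<^sup>+x. ennreal (\<bar>(\<eta>' (x + h) - \<eta>' x) \<bullet> j\<bar> powr p) \<partial>lborel) \<le> ennreal ((2 * c) powr p)"
proof -
  define q where "q = p / (p - 1)"
  have q: "1 < q" using p by (simp add: q_def field_simps)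
  have pq: "(p - 1) * q = p" using p by (simp add: q_def)
  define f where "f x = \<eta>' x \<bullet> j" for x
  have f [measurable]: "f \<in> borel_measurable borel" unfolding f_def by measurable
  have ae': "AE x in lebesgue. \<eta> x = \<eta>' x" using ae by (rule AE_completion)
  have \<eta>_meas: "\<eta> \<in> borel_measurable lebesgue" using L unfolding Lp_def by auto
  have "integrable lebesgue (\<lambda>x. norm (\<eta>' x) powr p)"
  proof (subst integrable_cong_AE[where g = "\<lambda>x. norm (\<eta> x) powr p"])
    show "(\<lambda>x. norm (\<eta>' x) powr p) \<in> borel_measurable lebesgue" by (rule measurable_completion) measurable
    show "(\<lambda>x. norm (\<eta> x) powr p) \<in> borel_measurable lebesgue" using \<eta>_meas by measurable
    show "AE x in lebesgue. norm (\<eta>' x) powr p = norm (\<eta> x) powr p" using ae' by eventually_elim simp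
  qed (use L in \<open>simp add: Lp_def\<close>)
  then have \<eta>'_int: "integrable lborel (\<lambda>x. norm (\<eta>' x) powr p)" by (simp add: integrable_completion)
  have fp_int: "integrable lborel (\<lambda>x. \<bar>f x\<bar> powr p)"
  proof (rule Bochner_Integration.integrable_bound[OF \<eta>'_int])
    have "\<bar>f x\<bar> powr p \<le> norm (\<eta>' x) powr p" for x
      unfolding f_def using p j by (intro powr_mono2 Basis_le_norm) auto
    then show "AE x in lborel. norm (\<bar>f x\<bar> powr p) \<le> norm (norm (\<eta>' x) powr p)" by simp
  qed measurable
  have loc: "integrable lborel (\<lambda>x. indicator (cball 0 r) x * f x)" for r
    using p by (intro powr_integrable_imp_loc[OF f _ fp_int]) auto
  define k where "k x = f (x + h) - f x" for x
  have k [measurable]: "k \<in> borel_measurable borel" unfolding k_def by measurable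
  have k_loc: "integrable lborel (\<lambda>x. indicator (cball 0 r) x * k x)" for r
  proof -
    have "integrable lborel (\<lambda>x. indicator (cball 0 r) ((h + x) - h) * f (h + x))"
    proof (subst lborel_translate(1)[where f = "\<lambda>x. indicator (cball 0 r) (x - h) * f x"])
      have m: "(\<lambda>x. indicator (cball 0 r) (x - h) :: real) \<in> borel_measurable borel"
        by (rule measurable_compose[of "\<lambda>x. x - h" _ borel]) (auto intro!: borel_measurable_indicator)
      then show "(\<lambda>x. indicator (cball 0 r) (x - h) * f x) \<in> borel_measurable borel" by measurable
      have z: "indicator (cball 0 r) (x - h) = (0::real)" if "r + norm h < norm x" for x
        using that norm_triangle_ineq2[of x h] by (auto simp: indicator_def)
      have "integrable lborel (\<lambda>x. f x * indicator (cball 0 r) (x - h))"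
        by (rule integrable_mult_bounded_support[where B = 1 and R = "r + norm h", OF loc f m])
           (use z in \<open>auto simp: indicator_def\<close>)
      then show "integrable lborel (\<lambda>x. indicator (cball 0 r) (x - h) * f x)" by (simp add: mult.commute)
    qed
    then have "integrable lborel (\<lambda>x. indicator (cball 0 r) x * f (x + h))" by (simp add: add.commute)
    from Bochner_Integration.integrable_diff[OF this loc[of r]] show ?thesis
      by (simp add: k_def right_diff_distrib)
  qed
  let ?s = "\<Sum>i\<in>Basis. \<bar>h \<bullet> i\<bar>"
  define \<kappa> where "\<kappa> = Lp_norm p (frob G) + 1"
  have \<kappa>: "0 < \<kappa>" by (simp add: \<kappa>_def Lp_norm_def add_nonneg_pos)
  have cut: "(LINT x|lborel. \<bar>k x\<bar> powr p * indicator (cball 0 (real r) \<inter> {x. \<bar>k x\<bar> \<le> real r}) x) \<le> (2 * c) powr p" for r :: nat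
  proof (rule powr_dual_bound[OF p c(2)])
    \<comment> \<open>Restricting to bounded \<open>x\<close> and bounded \<open>k\<close> makes the
      test function bounded with bounded support and its integrals finite; Fatou's lemma removes the
      restriction at the end.\<close>
    define A where "A = cball (0::'d) (real r) \<inter> {x. \<bar>k x\<bar> \<le> real r}"
    have [measurable]: "cball (0::'d) r \<in> sets borel" by simp
    have A [measurable]: "A \<in> sets borel" unfolding A_def by measurable
    fix t :: real assume t: "0 < t"
    define g where "g x = t * sgn (k x) * \<bar>k x\<bar> powr (p - 1) * indicator A x" for x
    have g [measurable]: "g \<in> borel_measurable borel" unfolding g_def by measurable
    define m where "m = t * real r powr (p - 1)"
    have g_le: "\<bar>g x\<bar> \<le> m" for x
    proof (cases "x \<in> A")
      case True
      then have "\<bar>k x\<bar> powr (p - 1) \<le> real r powr (p - 1)"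
        using p by (intro powr_mono2) (auto simp: A_def)
      then show ?thesis using t True by (auto simp: g_def m_def abs_mult sgn_if)
    next
      case False
      then show ?thesis using t by (simp add: g_def m_def)
    qed
    obtain \<psi> where \<psi>: "\<And>n. Cinf (\<psi> n)" "\<And>n x. real r + 2 \<le> norm x \<Longrightarrow> \<psi> n x = 0"
      "\<And>n x. \<bar>\<psi> n x\<bar> \<le> m + 1 / real (Suc n)" "AE x in lborel. (\<lambda>n. \<psi> n x) \<longlonglongrightarrow> g x"
      by (rule Cinf_approx_measurable[OF g g_le, of "real r"]) (auto simp: g_def A_def)
    have \<psi>m [measurable]: "\<psi> n \<in> borel_measurable borel" for n
      by (intro borel_measurable_continuous_onI Cinf_continuous \<psi>)
    have \<psi>_le: "\<bar>\<psi> n x\<bar> \<le> m + 1" for n x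
    proof -
      have "1 / real (Suc n) \<le> 1" by simp
      then show ?thesis using \<psi>(3)[of n x] by linarith
    qed
    have lim1: "(\<lambda>n. LINT x|lborel. k x * \<psi> n x) \<longlonglongrightarrow> (LINT x|lborel. k x * g x)"
      by (rule integral_test_limit[OF k_loc k g \<psi>m \<psi>_le \<psi>(2) \<psi>(4)])
    have dom: "norm (\<bar>\<psi> n x\<bar> powr q) \<le> (m + 1) powr q * indicator (cball 0 (real r + 2)) x" for n x
      using \<psi>_le[of n x] \<psi>(2)[of x n] q by (cases "norm x \<le> real r + 2") (auto intro: powr_mono2)
    have dom_int: "integrable lborel (\<lambda>x. (m + 1) powr q * indicator (cball (0::'d) (real r + 2)) x)"
      using emeasure_lborel_cball_finite[of "0::'d" "real r + 2"]
      by (intro integrable_mult_right integrable_real_indicator) auto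
    have \<psi>q: "integrable lborel (\<lambda>x. \<bar>\<psi> n x\<bar> powr q)" for n
      by (rule Bochner_Integration.integrable_bound[OF dom_int])
         (measurable, use dom in \<open>auto intro: order_trans[OF _ abs_ge_self]\<close>)
    have lim2: "(\<lambda>n. LINT x|lborel. \<bar>\<psi> n x\<bar> powr q) \<longlonglongrightarrow> (LINT x|lborel. \<bar>g x\<bar> powr q)"
    proof (rule integral_dominated_convergence[OF _ _ dom_int])
      show "AE x in lborel. (\<lambda>n. \<bar>\<psi> n x\<bar> powr q) \<longlonglongrightarrow> \<bar>g x\<bar> powr q"
        using \<psi>(4)
      proof eventually_elim
        case (elim x)
        then show ?case using q by (intro tendsto_powr2 tendsto_intros) auto
      qed
      show "AE x in lborel. norm (\<bar>\<psi> n x\<bar> powr q) \<le> (m + 1) powr q * indicator (cball 0 (real r + 2)) x" for n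
        using dom by simp
    qed measurable
    have "\<bar>LINT x|lborel. k x * \<psi> n x\<bar> \<le> \<kappa> * (1 + (LINT x|lborel. \<bar>\<psi> n x\<bar> powr q)) * ?s" for n
      unfolding k_def
    proof (rule translation_test_le[OF loc f \<psi>(1) \<psi>(2)])
      fix a i :: 'd assume i: "i \<in> Basis"
      have "continuous_on UNIV (\<lambda>x. pd i (\<psi> n) (x - a))"
        by (intro continuous_on_compose2[OF Cinf_continuous[OF Cinf_pd[OF \<psi>(1) i], of UNIV]] continuous_intros) auto
      then have [measurable]: "(\<lambda>x. pd i (\<psi> n) (x - a)) \<in> borel_measurable borel" by (rule borel_measurable_continuous_onI)
      have tr: "integrable lborel (\<lambda>x. \<bar>\<psi> n (x - a)\<bar> powr q)"
        "(LINT x|lborel. \<bar>\<psi> n (x - a)\<bar> powr q) = (LINT x|lborel. \<bar>\<psi> n x\<bar> powr q)"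
        using \<psi>q[of n] lborel_translate[of "\<lambda>x. \<bar>\<psi> n x\<bar> powr q" "- a"] by simp_all
      have "(LINT x|lborel. f x * pd i (\<psi> n) (x - a)) = (LINT x|lebesgue. (\<eta> x \<bullet> j) * pd i (\<lambda>x. \<psi> n (x - a)) x)"
        unfolding pd_translate f_def by (intro integral_inner_cong_AE \<eta>_meas \<eta>' ae) measurable
      also have "\<bar>\<dots>\<bar> \<le> \<kappa> * (1 + (LINT x|lebesgue. \<bar>\<psi> n (x - a)\<bar> powr q))"
        unfolding \<kappa>_def q_def
      proof (rule Sobolev_test_le[OF p G j i Cinf_translate[OF \<psi>(1)], where R = "real r + 2 + norm a"])
        show "\<psi> n (x - a) = 0" if "real r + 2 + norm a \<le> norm x" for x
          using that norm_triangle_ineq2[of x a] by (intro \<psi>(2)) linarith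
        show "integrable lebesgue (\<lambda>x. \<bar>\<psi> n (x - a)\<bar> powr (p / (p - 1)))"
          using tr(1) by (subst integrable_completion) (auto simp: q_def)
      qed
      also have "(LINT x|lebesgue. \<bar>\<psi> n (x - a)\<bar> powr q) = (LINT x|lborel. \<bar>\<psi> n x\<bar> powr q)"
        unfolding tr(2)[symmetric] by (rule integral_completion) measurable
      finally show "\<bar>LINT x|lborel. f x * pd i (\<psi> n) (x - a)\<bar> \<le> \<kappa> * (1 + (LINT x|lborel. \<bar>\<psi> n x\<bar> powr q))" .
    qed
    moreover have "(\<lambda>n. \<kappa> * (1 + (LINT x|lborel. \<bar>\<psi> n x\<bar> powr q)) * ?s) \<longlonglongrightarrow> \<kappa> * (1 + (LINT x|lborel. \<bar>g x\<bar> powr q)) * ?s"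
      by (intro tendsto_intros lim2)
    moreover have "(\<lambda>n. \<bar>LINT x|lborel. k x * \<psi> n x\<bar>) \<longlonglongrightarrow> \<bar>LINT x|lborel. k x * g x\<bar>"
      by (intro tendsto_intros lim1)
    ultimately have main: "\<bar>LINT x|lborel. k x * g x\<bar> \<le> \<kappa> * (1 + (LINT x|lborel. \<bar>g x\<bar> powr q)) * ?s"
      by (intro LIMSEQ_le[OF _ _ exI[of _ 0]]) auto
    have kp: "\<bar>k x\<bar> * \<bar>k x\<bar> powr (p - 1) = \<bar>k x\<bar> powr p" for x
      using powr_add[of "\<bar>k x\<bar>" 1 "p - 1"] by (cases "k x = 0") auto
    have "k x * g x = t * (\<bar>k x\<bar> powr p * indicator A x)" for x
      unfolding kp[symmetric] by (simp add: g_def sgn_if)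
    moreover have "\<bar>g x\<bar> powr q = t powr q * (\<bar>k x\<bar> powr p * indicator A x)" for x
      using t q by (auto simp: g_def indicator_def abs_mult sgn_if powr_mult powr_powr pq)
    ultimately have "t * (LINT x|lborel. \<bar>k x\<bar> powr p * indicator A x) \<le>
        \<kappa> * (1 + t powr q * (LINT x|lborel. \<bar>k x\<bar> powr p * indicator A x)) * ?s"
      using main by (simp add: abs_le_iff)
    also have "\<dots> = (\<kappa> * ?s) * (1 + t powr q * (LINT x|lborel. \<bar>k x\<bar> powr p * indicator A x))"
      by simp
    also have "\<dots> \<le> c * (1 + t powr q * (LINT x|lborel. \<bar>k x\<bar> powr p * indicator A x))"
      using c(1) by (intro mult_right_mono add_nonneg_nonneg mult_nonneg_nonneg Bochner_Integration.integral_nonneg) (auto simp: \<kappa>_def)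
    finally show "t * (LINT x|lborel. \<bar>k x\<bar> powr p * indicator (cball 0 (real r) \<inter> {x. \<bar>k x\<bar> \<le> real r}) x)
      \<le> c * (1 + t powr (p / (p - 1)) * (LINT x|lborel. \<bar>k x\<bar> powr p * indicator (cball 0 (real r) \<inter> {x. \<bar>k x\<bar> \<le> real r}) x))"
      unfolding A_def q_def .
  qed
  define A where "A r = cball (0::'d) (real r) \<inter> {x. \<bar>k x\<bar> \<le> real r}" for r :: nat
  have A [measurable]: "A r \<in> sets borel" for r
  proof -
    have [measurable]: "cball (0::'d) r \<in> sets borel" by simp
    show ?thesis unfolding A_def by measurable
  qed
  have nn: "(\<integral>\<^sup>+x. ennreal (\<bar>k x\<bar> powr p) * indicator (A r) x \<partial>lborel) \<le> ennreal ((2 * c) powr p)" for r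
  proof -
    have "integrable lborel (\<lambda>x. real r powr p * indicator (cball (0::'d) (real r)) x)"
      using emeasure_lborel_cball_finite[of "0::'d" "real r"]
      by (intro integrable_mult_right integrable_real_indicator) auto
    then have "integrable lborel (\<lambda>x. \<bar>k x\<bar> powr p * indicator (A r) x)"
      by (rule Bochner_Integration.integrable_bound)
         (measurable, use p in \<open>auto simp: A_def indicator_def intro!: powr_mono2\<close>)
    then have "(\<integral>\<^sup>+x. ennreal (\<bar>k x\<bar> powr p * indicator (A r) x) \<partial>lborel) = ennreal (LINT x|lborel. \<bar>k x\<bar> powr p * indicator (A r) x)"
      by (intro nn_integral_eq_integral) auto
    also have "\<dots> \<le> ennreal ((2 * c) powr p)"
      using cut[of r] unfolding A_def by (rule ennreal_leI)
    finally show ?thesis by (simp add: ennreal_mult'' ennreal_indicator)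
  qed
  have "(\<integral>\<^sup>+x. ennreal (\<bar>k x\<bar> powr p) \<partial>lborel) \<le> (\<integral>\<^sup>+x. liminf (\<lambda>r. ennreal (\<bar>k x\<bar> powr p) * indicator (A r) x) \<partial>lborel)"
  proof (rule nn_integral_mono)
    fix x
    obtain n :: nat where n: "norm x + \<bar>k x\<bar> \<le> real n" using real_arch_simple by blast
    have "x \<in> A r" if "n \<le> r" for r
    proof -
      have "real n \<le> real r" using that by simp
      then show ?thesis using n norm_ge_zero[of x] abs_ge_zero[of "k x"] unfolding A_def
        by (simp only: Int_iff mem_Collect_eq mem_cball_0) linarith
    qed
    then have "\<forall>\<^sub>F r in sequentially. ennreal (\<bar>k x\<bar> powr p) \<le> ennreal (\<bar>k x\<bar> powr p) * indicator (A r) x"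
      by (intro eventually_sequentiallyI[of n]) auto
    then show "ennreal (\<bar>k x\<bar> powr p) \<le> liminf (\<lambda>r. ennreal (\<bar>k x\<bar> powr p) * indicator (A r) x)"
      by (rule Liminf_bounded)
  qed
  also have "\<dots> \<le> liminf (\<lambda>r. \<integral>\<^sup>+x. ennreal (\<bar>k x\<bar> powr p) * indicator (A r) x \<partial>lborel)"
    by (rule nn_integral_liminf) measurable
  also have "\<dots> \<le> limsup (\<lambda>r. \<integral>\<^sup>+x. ennreal (\<bar>k x\<bar> powr p) * indicator (A r) x \<partial>lborel)"
    by (rule Liminf_le_Limsup) simp
  also have "\<dots> \<le> ennreal ((2 * c) powr p)"
    by (rule Limsup_bounded) (use nn in auto)
  finally show ?thesis by (simp add: k_def f_def inner_diff_left)
qed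

section \<open>Local existence\<close>

text \<open>Composition with the flow requires Borel functions, while the data are only measurable
  for the completed measure. The real-valued case is applied to each coordinate.\<close>

lemma ex_borel_version:
  fixes f :: "'a::euclidean_space \<Rightarrow> 'b::euclidean_space"
  assumes f: "f \<in> borel_measurable lebesgue"
  obtains f' where "f' \<in> borel_measurable borel" "AE x in lborel. f x = f' x"
proof -
  have "\<exists>g\<in>borel_measurable lborel. AE x in lborel. f x \<bullet> j = g x" for j
    using f by (intro completion_ex_borel_measurable_real borel_measurable_inner) auto
  then obtain g where g: "\<And>j. g j \<in> borel_measurable lborel" "\<And>j. AE x in lborel. f x \<bullet> j = g j x"
    by metis
  show ?thesis
  proof (rule that[of "\<lambda>x. \<Sum>j\<in>Basis. g j x *\<^sub>R j"])
    show "(\<lambda>x. \<Sum>j\<in>Basis. g j x *\<^sub>R j) \<in> borel_measurable borel"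
      using g(1) by simp
    have "AE x in lborel. \<forall>j\<in>Basis. f x \<bullet> j = g j x"
      using g(2) by (intro AE_finite_allI) auto
    then show "AE x in lborel. f x = (\<Sum>j\<in>Basis. g j x *\<^sub>R j)"
    proof eventually_elim
      case (elim x)
      then have "(\<Sum>j\<in>Basis. g j x *\<^sub>R j) = (\<Sum>j\<in>Basis. (f x \<bullet> j) *\<^sub>R j)" by (intro sum.cong) auto
      then show ?case by (simp add: euclidean_representation)
    qed
  qed
qed

lemma AE_lborel_ex:
  fixes P :: "'a::euclidean_space \<Rightarrow> bool"
  assumes "AE x in lborel. P x" shows "\<exists>x. P x"
proof (rule ccontr)
  assume "\<nexists>x. P x"
  then have "AE x in (lborel :: 'a measure). False" using assms by simp
  then have "emeasure lborel (UNIV :: 'a set) = 0"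
    by (auto elim!: AE_E simp: top.extremum_unique)
  then show False by (simp add: emeasure_lborel_UNIV)
qed

lemma nn_integral_tail:
  fixes f :: "'a::euclidean_space \<Rightarrow> ennreal"
  assumes [measurable]: "f \<in> borel_measurable borel" and fin: "(\<integral>\<^sup>+x. f x \<partial>lborel) < \<infinity>" and e: "0 < (e::real)"
  obtains r :: real where "(\<integral>\<^sup>+x. f x * indicator {x. r < norm x} x \<partial>lborel) \<le> ennreal e"
proof -
  let ?f = "\<lambda>i x. f x * indicator {x. real i < norm x} x"
  have "(INF i. (\<integral>\<^sup>+x. ?f i x \<partial>lborel)) = (\<integral>\<^sup>+x. (INF i. ?f i x) \<partial>lborel)"
  proof (rule nn_integral_monotone_convergence_INF_decseq[symmetric])
    show "decseq ?f"
      by (intro decseq_SucI le_funI mult_left_mono) (auto simp: indicator_def)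
    show "(\<integral>\<^sup>+x. ?f i x \<partial>lborel) < \<infinity>" for i
      by (rule le_less_trans[OF nn_integral_mono fin]) (auto simp: indicator_def)
  qed measurable
  also have "\<dots> = (\<integral>\<^sup>+x. 0 \<partial>(lborel :: 'a measure))"
  proof (rule nn_integral_cong)
    fix x :: 'a
    obtain n :: nat where "norm x \<le> real n" using real_arch_simple by blast
    then have n: "?f n x = 0" by simp
    have "(INF i. ?f i x) \<le> ?f n x" by (rule INF_lower) simp
    then show "(INF i. ?f i x) = 0" by (simp only: n le_zero_eq)
  qed
  finally have "(INF i. (\<integral>\<^sup>+x. ?f i x \<partial>lborel)) < ennreal e" using e by simp
  then obtain i where "(\<integral>\<^sup>+x. ?f i x \<partial>lborel) < ennreal e" unfolding INF_less_iff by auto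
  then show ?thesis using that[of "real i"] by simp
qed

lemma sum_abs_inner_Basis_le: "(\<Sum>i\<in>Basis. \<bar>h \<bullet> i\<bar>) \<le> real DIM('a) * norm (h :: 'a::euclidean_space)"
  using sum_bounded_above[of Basis "\<lambda>i. \<bar>h \<bullet> i\<bar>" "norm h"] Basis_le_norm[of _ h] by simp

text \<open>The bounded \<open>u\<close> comes out as \<open>U\<close>, the transport costs 4 ^ d,
  the norm is split into its N coordinates, and the sum of the |h . i| is at most d times the norm
  of \<open>h\<close>: these are the factors of \<open>?K\<close>.\<close>

lemma BV_transported_kernel:
  fixes \<eta> \<eta>' :: "'d::euclidean_space \<Rightarrow> 'n::euclidean_space"
  assumes BV: "is_BV \<eta>" and \<eta>' [measurable]: "\<eta>' \<in> borel_measurable borel" and ae: "AE x in lborel. \<eta> x = \<eta>' x"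
    and u [measurable]: "u \<in> borel_measurable borel" and U: "\<And>y. \<bar>u y\<bar> \<le> U"
  shows "transported_kernel \<eta>' u (U * 4 ^ DIM('d) * (real DIM('n) * (total_variation \<eta> * real DIM('d))))"
    (is "transported_kernel \<eta>' u ?K")
proof
  have U0: "0 \<le> U" using U[of undefined] by linarith
  let ?C = "U * 4 ^ DIM('d)"
  have TV: "0 \<le> total_variation \<eta>" by (rule total_variation_nonneg[OF BV])
  show "0 \<le> ?K" using U0 TV by simp
  have gen: "(\<integral>\<^sup>+y. ennreal \<bar>u y\<bar> * k (X y) \<partial>lborel) \<le> ennreal ?C * (\<integral>\<^sup>+x. k x \<partial>lborel)"
    if X: "expanding X" and k [measurable]: "k \<in> borel_measurable borel" for X and k :: "'d \<Rightarrow> ennreal"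
  proof -
    note [measurable] = expanding_measurable[OF X]
    have "(\<integral>\<^sup>+y. ennreal \<bar>u y\<bar> * k (X y) \<partial>lborel) \<le> (\<integral>\<^sup>+y. ennreal U * k (X y) \<partial>lborel)"
      by (intro nn_integral_mono mult_right_mono ennreal_leI U) auto
    also have "\<dots> = ennreal U * (\<integral>\<^sup>+y. k (X y) \<partial>lborel)" by (rule nn_integral_cmult) measurable
    also have "\<dots> \<le> ennreal U * (ennreal (4 ^ DIM('d)) * (\<integral>\<^sup>+x. k x \<partial>lborel))"
      by (intro mult_left_mono expanding_nn_integral X k) auto
    finally show ?thesis using U0 by (simp add: ennreal_mult mult.assoc)
  qed
  have fin: "(\<integral>\<^sup>+x. ennreal (norm (\<eta>' x)) \<partial>lborel) < \<infinity>"
  proof -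
    have "(\<integral>\<^sup>+x. ennreal (norm (\<eta>' x)) \<partial>lborel) = (\<integral>\<^sup>+x. ennreal (norm (\<eta> x)) \<partial>lebesgue)"
      unfolding nn_integral_completion using ae by (intro nn_integral_cong_AE) auto
    then show ?thesis using BV unfolding is_BV_def integrable_iff_bounded by simp
  qed
  show "\<exists>M. \<forall>X. expanding X \<longrightarrow> (\<integral>\<^sup>+y. ennreal (\<bar>u y\<bar> * norm (\<eta>' (X y))) \<partial>lborel) \<le> ennreal M"
  proof (intro exI[of _ "enn2real (ennreal ?C * (\<integral>\<^sup>+x. ennreal (norm (\<eta>' x)) \<partial>lborel))"] allI impI)
    fix X :: "'d \<Rightarrow> 'd" assume X: "expanding X"
    have "ennreal ?C * (\<integral>\<^sup>+x. ennreal (norm (\<eta>' x)) \<partial>lborel) < top"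
      using fin by (simp add: ennreal_mult_less_top)
    then show "(\<integral>\<^sup>+y. ennreal (\<bar>u y\<bar> * norm (\<eta>' (X y))) \<partial>lborel) \<le> ennreal (enn2real (ennreal ?C * (\<integral>\<^sup>+x. ennreal (norm (\<eta>' x)) \<partial>lborel)))"
      using gen[OF X, of "\<lambda>x. ennreal (norm (\<eta>' x))"] by (simp add: ennreal_mult)
  qed
  show "\<exists>r. \<forall>X. expanding X \<longrightarrow> (\<integral>\<^sup>+y. ennreal (\<bar>u y\<bar> * norm (\<eta>' (X y))) * indicator {y. r < norm (X y)} y \<partial>lborel) \<le> ennreal e"
    if e: "0 < e" for e
  proof -
    \<comment> \<open>The added 1 keeps the quotient positive when \<open>?C\<close> is 0.\<close>
    have e': "0 < e / (?C + 1)" using e U0 by (intro divide_pos_pos add_nonneg_pos) auto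
    obtain r where r: "(\<integral>\<^sup>+x. ennreal (norm (\<eta>' x)) * indicator {x. r < norm x} x \<partial>lborel) \<le> ennreal (e / (?C + 1))"
      by (rule nn_integral_tail[OF _ fin e']) measurable
    show ?thesis
    proof (intro exI[of _ r] allI impI)
      fix X :: "'d \<Rightarrow> 'd" assume X: "expanding X"
      have "(\<integral>\<^sup>+y. ennreal (\<bar>u y\<bar> * norm (\<eta>' (X y))) * indicator {y. r < norm (X y)} y \<partial>lborel) =
        (\<integral>\<^sup>+y. ennreal \<bar>u y\<bar> * (ennreal (norm (\<eta>' (X y))) * indicator {x. r < norm x} (X y)) \<partial>lborel)"
        by (intro nn_integral_cong) (auto simp: ennreal_mult indicator_def)
      also have "\<dots> \<le> ennreal ?C * (\<integral>\<^sup>+x. ennreal (norm (\<eta>' x)) * indicator {x. r < norm x} x \<partial>lborel)"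
        by (rule gen[OF X]) measurable
      also have "\<dots> \<le> ennreal ?C * ennreal (e / (?C + 1))" by (intro mult_left_mono r) auto
      also have "\<dots> = ennreal (?C * (e / (?C + 1)))" using U0 e' by (intro ennreal_mult[symmetric]) auto
      also have "\<dots> \<le> ennreal e"
      proof (rule ennreal_leI)
        have "0 < ?C + 1" using U0 by (intro add_nonneg_pos) auto
        then show "?C * (e / (?C + 1)) \<le> e" using e by (simp add: field_simps)
      qed
      finally show "(\<integral>\<^sup>+y. ennreal (\<bar>u y\<bar> * norm (\<eta>' (X y))) * indicator {y. r < norm (X y)} y \<partial>lborel) \<le> ennreal e" .
    qed
  qed
  fix X :: "'d \<Rightarrow> 'd" and h assume X: "expanding X"
  have "(\<integral>\<^sup>+y. ennreal (\<bar>u y\<bar> * norm (\<eta>' (X y + h) - \<eta>' (X y))) \<partial>lborel) =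
     (\<integral>\<^sup>+y. ennreal \<bar>u y\<bar> * ennreal (norm (\<eta>' (X y + h) - \<eta>' (X y))) \<partial>lborel)"
    by (simp add: ennreal_mult)
  also have "\<dots> \<le> ennreal ?C * (\<integral>\<^sup>+x. ennreal (norm (\<eta>' (x + h) - \<eta>' x)) \<partial>lborel)"
    by (rule gen[OF X, of "\<lambda>x. ennreal (norm (\<eta>' (x + h) - \<eta>' x))"]) measurable
  also have "(\<integral>\<^sup>+x. ennreal (norm (\<eta>' (x + h) - \<eta>' x)) \<partial>lborel) \<le> (\<integral>\<^sup>+x. (\<Sum>j\<in>Basis. ennreal \<bar>(\<eta>' (x + h) - \<eta>' x) \<bullet> j\<bar>) \<partial>lborel)"
    by (intro nn_integral_mono) (auto intro!: ennreal_leI norm_le_l1)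
  also have "\<dots> = (\<Sum>j\<in>Basis. (\<integral>\<^sup>+x. ennreal \<bar>(\<eta>' (x + h) - \<eta>' x) \<bullet> j\<bar> \<partial>lborel))"
    by (rule nn_integral_sum) measurable
  also have "\<dots> \<le> (\<Sum>j\<in>(Basis :: 'n set). ennreal (total_variation \<eta> * (real DIM('d) * norm h)))"
    by (intro sum_mono order_trans[OF BV_translation_le[OF BV _ \<eta>' ae]] ennreal_leI mult_left_mono sum_abs_inner_Basis_le TV)
  also have "\<dots> = ennreal (real DIM('n) * (total_variation \<eta> * (real DIM('d) * norm h)))"
    using TV by (subst sum_ennreal) auto
  finally have "(\<integral>\<^sup>+y. ennreal (\<bar>u y\<bar> * norm (\<eta>' (X y + h) - \<eta>' (X y))) \<partial>lborel) \<le>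
      ennreal ?C * ennreal (real DIM('n) * (total_variation \<eta> * (real DIM('d) * norm h)))"
    by (simp add: mult_left_mono)
  also have "\<dots> = ennreal (?K * norm h)"
    using U0 TV by (subst ennreal_mult[symmetric]) (auto simp: mult_ac)
  finally show "(\<integral>\<^sup>+y. ennreal (\<bar>u y\<bar> * norm (\<eta>' (X y + h) - \<eta>' (X y))) \<partial>lborel) \<le> ennreal (?K * norm h)" .
qed (use \<eta>' u in auto)

text \<open>Young's inequality for the pair \<open>k (X y) / s\<close> and |u y|, multiplied by
  \<open>s\<close>. The free scale is later taken small to control tails, and proportional to the
  norm of \<open>h\<close> to control the modulus.\<close>

lemma expanding_Young:
  fixes X :: "'d::euclidean_space \<Rightarrow> 'd"
  assumes p: "1 < p" and s: "0 < s" and X: "expanding X"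
    and k [measurable]: "k \<in> borel_measurable borel" and k0: "\<And>x. 0 \<le> (k x :: real)"
    and u [measurable]: "u \<in> borel_measurable borel"
  shows "(\<integral>\<^sup>+y. ennreal (\<bar>u y\<bar> * k (X y)) \<partial>lborel) \<le>
     ennreal (s powr (1 - p) * 4 ^ DIM('d)) * (\<integral>\<^sup>+x. ennreal (k x powr p) \<partial>lborel)
     + ennreal s * (\<integral>\<^sup>+y. ennreal (\<bar>u y\<bar> powr (p / (p - 1))) \<partial>lborel)"
proof -
  note [measurable] = expanding_measurable[OF X]
  let ?q = "p / (p - 1)"
  have "(\<integral>\<^sup>+y. ennreal (\<bar>u y\<bar> * k (X y)) \<partial>lborel) \<le>
      (\<integral>\<^sup>+y. ennreal (s powr (1 - p)) * ennreal (k (X y) powr p) + ennreal s * ennreal (\<bar>u y\<bar> powr ?q) \<partial>lborel)"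
  proof (rule nn_integral_mono)
    fix y
    have "\<bar>u y\<bar> * k (X y) = s * ((k (X y) / s) * \<bar>u y\<bar>)" using s by simp
    also have "\<dots> \<le> s * ((k (X y) / s) powr p + \<bar>u y\<bar> powr ?q)"
      using s k0[of "X y"] by (intro mult_left_mono Young_le p) auto
    also have "\<dots> = s powr (1 - p) * k (X y) powr p + s * \<bar>u y\<bar> powr ?q"
      using s k0[of "X y"] by (simp add: powr_divide powr_diff distrib_left)
    finally show "ennreal (\<bar>u y\<bar> * k (X y)) \<le> ennreal (s powr (1 - p)) * ennreal (k (X y) powr p) + ennreal s * ennreal (\<bar>u y\<bar> powr ?q)"
      using s by (simp add: ennreal_mult[symmetric] ennreal_plus[symmetric] ennreal_leI del: ennreal_plus)
  qed
  also have "\<dots> = ennreal (s powr (1 - p)) * (\<integral>\<^sup>+y. ennreal (k (X y) powr p) \<partial>lborel)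
     + ennreal s * (\<integral>\<^sup>+y. ennreal (\<bar>u y\<bar> powr ?q) \<partial>lborel)"
    by (simp add: nn_integral_add nn_integral_cmult)
  also have "(\<integral>\<^sup>+y. ennreal (k (X y) powr p) \<partial>lborel) \<le> ennreal (4 ^ DIM('d)) * (\<integral>\<^sup>+x. ennreal (k x powr p) \<partial>lborel)"
    by (rule expanding_nn_integral[OF X]) measurable
  finally show ?thesis by (simp add: ennreal_mult mult.assoc add_right_mono mult_left_mono)
qed

text \<open>With the scale 2c, where c is proportional to the norm of \<open>h\<close>, both terms
  of \<open>expanding_Young\<close> become linear in that norm, because (2c)^(1-p) (2c)^p =
  2c.\<close>

lemma Sobolev_transported_kernel:
  fixes \<eta> \<eta>' :: "'d::euclidean_space \<Rightarrow> 'n::euclidean_space"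
  assumes p: "1 < p" and L: "Lp p \<eta>" and G: "weak_grad \<eta> G" "Lp p (frob G)"
    and \<eta>' [measurable]: "\<eta>' \<in> borel_measurable borel" and ae: "AE x in lborel. \<eta> x = \<eta>' x"
    and u [measurable]: "u \<in> borel_measurable borel"
    and A: "(\<integral>\<^sup>+y. ennreal (\<bar>u y\<bar> powr (p / (p - 1))) \<partial>lborel) = ennreal A" "0 \<le> A"
  shows "transported_kernel \<eta>' u (real DIM('n) * (2 * ((Lp_norm p (frob G) + 1) * real DIM('d)) * (4 ^ DIM('d) + A)))"
    (is "transported_kernel \<eta>' u ?K")
proof
  define \<kappa> where "\<kappa> = Lp_norm p (frob G) + 1"
  have \<kappa>: "0 < \<kappa>" by (simp add: \<kappa>_def Lp_norm_def add_nonneg_pos)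
  show "0 \<le> ?K" using A \<kappa> by (simp add: \<kappa>_def)
  define E where "E = enn2real (\<integral>\<^sup>+x. ennreal (norm (\<eta>' x) powr p) \<partial>lborel)"
  have fin: "(\<integral>\<^sup>+x. ennreal (norm (\<eta>' x) powr p) \<partial>lborel) < \<infinity>"
  proof -
    have "(\<integral>\<^sup>+x. ennreal (norm (\<eta>' x) powr p) \<partial>lborel) = (\<integral>\<^sup>+x. ennreal (norm (norm (\<eta> x) powr p)) \<partial>lebesgue)"
      unfolding nn_integral_completion using ae by (intro nn_integral_cong_AE) auto
    then show ?thesis using L unfolding Lp_def integrable_iff_bounded by simp
  qed
  then have E: "(\<integral>\<^sup>+x. ennreal (norm (\<eta>' x) powr p) \<partial>lborel) = ennreal E" "0 \<le> E" by (auto simp: E_def)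
  show "\<exists>M. \<forall>X. expanding X \<longrightarrow> (\<integral>\<^sup>+y. ennreal (\<bar>u y\<bar> * norm (\<eta>' (X y))) \<partial>lborel) \<le> ennreal M"
  proof (intro exI[of _ "4 ^ DIM('d) * E + A"] allI impI)
    fix X :: "'d \<Rightarrow> 'd" assume X: "expanding X"
    have "(\<integral>\<^sup>+y. ennreal (\<bar>u y\<bar> * norm (\<eta>' (X y))) \<partial>lborel) \<le>
       ennreal (1 powr (1 - p) * 4 ^ DIM('d)) * ennreal E + ennreal 1 * ennreal A"
      unfolding E(1)[symmetric] A(1)[symmetric] by (rule expanding_Young[OF p _ X]) auto
    then show "(\<integral>\<^sup>+y. ennreal (\<bar>u y\<bar> * norm (\<eta>' (X y))) \<partial>lborel) \<le> ennreal (4 ^ DIM('d) * E + A)"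
      using E A by (simp add: ennreal_mult ennreal_plus)
  qed
  show "\<exists>r. \<forall>X. expanding X \<longrightarrow> (\<integral>\<^sup>+y. ennreal (\<bar>u y\<bar> * norm (\<eta>' (X y))) * indicator {y. r < norm (X y)} y \<partial>lborel) \<le> ennreal e"
    if e: "0 < e" for e
  proof -
    define s where "s = e / (2 * (A + 1))"
    have s: "0 < s" "s * A \<le> e / 2" using e A by (auto simp: s_def field_simps)
    define B where "B = s powr (1 - p) * 4 ^ DIM('d)"
    have B: "0 < B" using s by (simp add: B_def)
    obtain r where r: "(\<integral>\<^sup>+x. ennreal (norm (\<eta>' x) powr p) * indicator {x. r < norm x} x \<partial>lborel) \<le> ennreal (e / (2 * B))"
      by (rule nn_integral_tail[OF _ fin, of "e / (2 * B)"]) (use e B in auto)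
    show ?thesis
    proof (intro exI[of _ r] allI impI)
      fix X :: "'d \<Rightarrow> 'd" assume X: "expanding X"
      let ?k = "\<lambda>x. norm (\<eta>' x) * indicator {x. r < norm x} x :: real"
      have "(\<integral>\<^sup>+y. ennreal (\<bar>u y\<bar> * norm (\<eta>' (X y))) * indicator {y. r < norm (X y)} y \<partial>lborel) =
        (\<integral>\<^sup>+y. ennreal (\<bar>u y\<bar> * ?k (X y)) \<partial>lborel)"
        by (intro nn_integral_cong) (auto simp: indicator_def)
      also have "\<dots> \<le> ennreal B * (\<integral>\<^sup>+x. ennreal (?k x powr p) \<partial>lborel) + ennreal s * ennreal A"
        unfolding A(1)[symmetric] B_def by (rule expanding_Young[OF p s(1) X]) auto
      also have "(\<integral>\<^sup>+x. ennreal (?k x powr p) \<partial>lborel) = (\<integral>\<^sup>+x. ennreal (norm (\<eta>' x) powr p) * indicator {x. r < norm x} x \<partial>lborel)"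
        using p by (intro nn_integral_cong) (auto simp: indicator_def)
      also have "ennreal B * \<dots> + ennreal s * ennreal A \<le> ennreal B * ennreal (e / (2 * B)) + ennreal s * ennreal A"
        by (intro add_right_mono mult_left_mono r) auto
      also have "\<dots> = ennreal (B * (e / (2 * B)) + s * A)"
        using B e s A by (simp add: ennreal_mult[symmetric] ennreal_plus[symmetric] del: ennreal_plus)
      also have "\<dots> \<le> ennreal e" using B s e by (intro ennreal_leI) simp
      finally show "(\<integral>\<^sup>+y. ennreal (\<bar>u y\<bar> * norm (\<eta>' (X y))) * indicator {y. r < norm (X y)} y \<partial>lborel) \<le> ennreal e" .
    qed
  qed
  fix X :: "'d \<Rightarrow> 'd" and h assume X: "expanding X"
  note [measurable] = expanding_measurable[OF X]
  show "(\<integral>\<^sup>+y. ennreal (\<bar>u y\<bar> * norm (\<eta>' (X y + h) - \<eta>' (X y))) \<partial>lborel) \<le> ennreal (?K * norm h)"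
  \<comment> \<open>The scale has to be positive, so a zero shift is treated apart.\<close>
  proof (cases "h = 0")
    case False
    define c where "c = \<kappa> * (real DIM('d) * norm h)"
    have c: "0 < c" using False \<kappa> by (simp add: c_def)
    have cs: "(Lp_norm p (frob G) + 1) * (\<Sum>i\<in>Basis. \<bar>h \<bullet> i\<bar>) \<le> c"
      unfolding c_def \<kappa>_def[symmetric] using \<kappa> by (intro mult_left_mono sum_abs_inner_Basis_le) auto
    have comp: "(\<integral>\<^sup>+y. ennreal (\<bar>u y\<bar> * \<bar>(\<eta>' (X y + h) - \<eta>' (X y)) \<bullet> j\<bar>) \<partial>lborel) \<le> ennreal (2 * c * (4 ^ DIM('d) + A))"
      if j: "j \<in> Basis" for j
    proof -
      have "(\<integral>\<^sup>+y. ennreal (\<bar>u y\<bar> * \<bar>(\<eta>' (X y + h) - \<eta>' (X y)) \<bullet> j\<bar>) \<partial>lborel) \<le>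
         ennreal ((2 * c) powr (1 - p) * 4 ^ DIM('d)) * (\<integral>\<^sup>+x. ennreal (\<bar>(\<eta>' (x + h) - \<eta>' x) \<bullet> j\<bar> powr p) \<partial>lborel)
         + ennreal (2 * c) * ennreal A"
        unfolding A(1)[symmetric] using c
        by (intro expanding_Young[OF p _ X, where k = "\<lambda>x. \<bar>(\<eta>' (x + h) - \<eta>' x) \<bullet> j\<bar>"]) auto
      also have "\<dots> \<le> ennreal ((2 * c) powr (1 - p) * 4 ^ DIM('d)) * ennreal ((2 * c) powr p) + ennreal (2 * c) * ennreal A"
        by (intro add_right_mono mult_left_mono Sobolev_translation_le[OF p L G j \<eta>' ae cs c]) auto
      also have "\<dots> = ennreal ((2 * c) powr (1 - p) * 4 ^ DIM('d) * (2 * c) powr p + 2 * c * A)"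
        using c A by (simp add: ennreal_mult[symmetric] ennreal_plus[symmetric] del: ennreal_plus)
      also have "(2 * c) powr (1 - p) * 4 ^ DIM('d) * (2 * c) powr p = 2 * c * 4 ^ DIM('d)"
        using c powr_add[of "2 * c" "1 - p" p] by simp
      finally show ?thesis by (simp add: distrib_left)
    qed
    have "(\<integral>\<^sup>+y. ennreal (\<bar>u y\<bar> * norm (\<eta>' (X y + h) - \<eta>' (X y))) \<partial>lborel) \<le>
       (\<integral>\<^sup>+y. (\<Sum>j\<in>Basis. ennreal (\<bar>u y\<bar> * \<bar>(\<eta>' (X y + h) - \<eta>' (X y)) \<bullet> j\<bar>)) \<partial>lborel)"
      by (intro nn_integral_mono) (auto simp: sum_distrib_left[symmetric] intro!: ennreal_leI mult_left_mono norm_le_l1)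
    also have "\<dots> = (\<Sum>j\<in>Basis. (\<integral>\<^sup>+y. ennreal (\<bar>u y\<bar> * \<bar>(\<eta>' (X y + h) - \<eta>' (X y)) \<bullet> j\<bar>) \<partial>lborel))"
      by (rule nn_integral_sum) measurable
    also have "\<dots> \<le> (\<Sum>j\<in>(Basis :: 'n set). ennreal (2 * c * (4 ^ DIM('d) + A)))"
      by (intro sum_mono comp)
    also have "\<dots> = ennreal (real DIM('n) * (2 * c * (4 ^ DIM('d) + A)))"
      using c A by (subst sum_ennreal) auto
    also have "real DIM('n) * (2 * c * (4 ^ DIM('d) + A)) = ?K * norm h"
      by (simp add: c_def \<kappa>_def mult_ac)
    finally show ?thesis .
  qed simp
qed (use \<eta>' u in auto)

section \<open>Change of representatives, negative times and the life span\<close>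

lemma loc_integrable_cong_AE:
  fixes f g :: "'a::euclidean_space \<Rightarrow> 'b::euclidean_space"
  assumes "loc_integrable_on S f" and g: "g \<in> borel_measurable borel" and ae: "AE x in lborel. f x = g x"
  shows "loc_integrable_on S g"
  unfolding loc_integrable_on_def
proof safe
  fix K assume K: "compact K" "K \<subseteq> S"
  then have f: "integrable lebesgue (\<lambda>x. indicator K x *\<^sub>R f x)"
    using assms(1) unfolding loc_integrable_on_def set_integrable_def by auto
  have [measurable]: "K \<in> sets borel" using K by (intro borel_closed compact_imp_closed)
  have "integrable lebesgue (\<lambda>x. indicator K x *\<^sub>R g x)"
  proof (subst integrable_cong_AE[where g = "\<lambda>x. indicator K x *\<^sub>R f x"])
    show "(\<lambda>x. indicator K x *\<^sub>R g x) \<in> borel_measurable lebesgue"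
      using g by (intro measurable_completion) simp
    show "AE x in lebesgue. indicator K x *\<^sub>R g x = indicator K x *\<^sub>R f x"
      using AE_completion[OF ae] by eventually_elim simp
  qed (use f in auto)
  then show "set_integrable lebesgue K g" by (simp add: set_integrable_def)
qed

lemma Lp_imp_loc_integrable:
  fixes f :: "'a::euclidean_space \<Rightarrow> 'b::euclidean_space"
  assumes p: "1 \<le> p" and f: "Lp p f" shows "loc_integrable_on UNIV f"
  unfolding loc_integrable_on_def set_integrable_def
proof safe
  fix K :: "'a set" assume K: "compact K"
  have [measurable]: "f \<in> borel_measurable lebesgue" "K \<in> sets lebesgue"
    using f K by (auto simp: Lp_def compact_imp_closed borel_closed)
  show "integrable lebesgue (\<lambda>x. indicator K x *\<^sub>R f x)"
  proof (rule Bochner_Integration.integrable_bound)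
    show "integrable lebesgue (\<lambda>x. indicator K x + norm (f x) powr p)"
      using f emeasure_compact_finite[OF K]
      by (intro Bochner_Integration.integrable_add integrable_real_indicator) (auto simp: Lp_def compact_imp_closed borel_closed K)
    have "norm (f x) \<le> 1 + norm (f x) powr p" for x
    proof (cases "norm (f x) \<le> 1")
      case False
      then have "norm (f x) powr 1 \<le> norm (f x) powr p" using p by (intro powr_mono) auto
      then show ?thesis by simp
    qed (simp add: add_increasing2)
    then show "AE x in lebesgue. norm (indicator K x *\<^sub>R f x) \<le> norm (indicator K x + norm (f x) powr p)"
      by (auto simp: indicator_def)
  qed measurable
qed

text \<open>\<open>\<eta>\<close> and \<open>u0\<close> enter the weak formulation only under
  integrals, hence up to null sets, and \<open>V\<close> is evaluated only at times in
  \<open>{0<..<T}\<close>. This leads back from Borel data and an extended velocity to the given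
  ones.\<close>

lemma dist_sol_cong:
  fixes u :: "real \<times> 'd::euclidean_space \<Rightarrow> real" and \<eta> \<eta>' :: "'d \<Rightarrow> 'n::euclidean_space"
  assumes sol: "dist_sol V' \<eta>' u0' T u" and u: "u \<in> borel_measurable borel"
    and V: "\<And>t. 0 < t \<Longrightarrow> V' t = V t"
    and \<eta>: "\<eta> \<in> borel_measurable lebesgue" "\<eta>' \<in> borel_measurable borel" "AE x in lborel. \<eta> x = \<eta>' x"
    and u0: "u0 \<in> borel_measurable lebesgue" "u0' \<in> borel_measurable borel" "AE x in lborel. u0 x = u0' x"
    and loc: "loc_integrable_on UNIV \<eta>" "loc_integrable_on UNIV u0"
  shows "dist_sol V \<eta> u0 T u"
proof -
  have ae: "AE x in lebesgue. \<eta> x = \<eta>' x" "AE x in lebesgue. u0 x = u0' x"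
    using \<eta>(3) u0(3) by (auto intro: AE_completion)
  have \<eta>'m: "\<eta>' \<in> borel_measurable lebesgue" using \<eta>(2) by (intro measurable_completion) simp
  have u0'm: "u0' \<in> borel_measurable lebesgue" using u0(2) by (intro measurable_completion) simp
  have um [measurable]: "(\<lambda>y. u (fst z, snd z - y)) \<in> borel_measurable lebesgue" for z
  proof (rule measurable_completion)
    have "(\<lambda>y. (fst z, snd z - y)) \<in> borel_measurable borel"
      by (intro borel_measurable_continuous_onI continuous_intros)
    from measurable_compose[OF this u] show "(\<lambda>y. u (fst z, snd z - y)) \<in> borel_measurable lborel" by simp
  qed
  have ae2: "AE y in lebesgue. u (fst z, snd z - y) *\<^sub>R \<eta> y = u (fst z, snd z - y) *\<^sub>R \<eta>' y" for z
    using ae(1) by eventually_elim simp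
  have m: "(\<lambda>y. u (fst z, snd z - y) *\<^sub>R \<eta> y) \<in> borel_measurable lebesgue"
    "(\<lambda>y. u (fst z, snd z - y) *\<^sub>R \<eta>' y) \<in> borel_measurable lebesgue" for z
    using \<eta>(1) \<eta>'m by measurable
  have conv: "conv u \<eta> = conv u \<eta>'"
    unfolding conv_def by (intro ext integral_cong_AE m ae2)
  have int: "integrable lebesgue (\<lambda>y. u (fst z, snd z - y) *\<^sub>R \<eta> y) \<longleftrightarrow>
      integrable lebesgue (\<lambda>y. u (fst z, snd z - y) *\<^sub>R \<eta>' y)" for z
    by (intro integrable_cong_AE m ae2)
  have u0\<phi>: "(LINT x|lebesgue. u0 x * \<phi> (0, x)) = (LINT x|lebesgue. u0' x * \<phi> (0, x))"
    if "test_fun T \<phi>" for \<phi> :: "real \<times> 'd \<Rightarrow> real"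
  proof (rule integral_cong_AE)
    have "Cinf \<phi>" using that by (simp add: test_fun_def)
    then have "continuous_on UNIV (\<lambda>x. \<phi> (0, x))"
      by (intro continuous_on_compose2[OF Cinf_continuous[of \<phi> UNIV]] continuous_intros) auto
    then have [measurable]: "(\<lambda>x. \<phi> (0, x)) \<in> borel_measurable lebesgue"
      by (intro measurable_completion) (simp add: borel_measurable_continuous_onI)
    show "(\<lambda>x. u0 x * \<phi> (0, x)) \<in> borel_measurable lebesgue" using u0(1) by measurable
    show "(\<lambda>x. u0' x * \<phi> (0, x)) \<in> borel_measurable lebesgue" using u0'm by measurable
    show "AE x in lebesgue. u0 x * \<phi> (0, x) = u0' x * \<phi> (0, x)" using ae(2) by eventually_elim simp
  qed
  have Veq: "(\<lambda>z. indicator ({0<..<T} \<times> UNIV) z *\<^sub>R (u z * (dt \<phi> z + V (fst z) (snd z) (conv u \<eta>' z) \<bullet> gradx \<phi> z))) =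
     (\<lambda>z. indicator ({0<..<T} \<times> UNIV) z *\<^sub>R (u z * (dt \<phi> z + V' (fst z) (snd z) (conv u \<eta>' z) \<bullet> gradx \<phi> z)))" for \<phi>
    by (auto simp: fun_eq_iff indicator_def V)
  show ?thesis
    using sol loc unfolding dist_sol_def conv int set_integrable_def set_lebesgue_integral_def Veq
    by (simp add: u0\<phi>)
qed

text \<open>\<open>t \<mapsto> max 0 t\<close> does not increase distances, so the constant
  \<open>L\<close> is kept.\<close>

lemma lipschitz_on_extend_time:
  fixes V :: "real \<Rightarrow> 'd::euclidean_space \<Rightarrow> 'n::euclidean_space \<Rightarrow> 'd"
  assumes "L-lipschitz_on ({0..} \<times> UNIV) (\<lambda>(t, x, w). V t x w)"
  shows "L-lipschitz_on UNIV (\<lambda>(t, x, w). V (max 0 t) x w)"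
proof (rule lipschitz_onI)
  have L: "0 \<le> L" using assms by (rule lipschitz_on_nonneg)
  then show "0 \<le> L" .
  fix a b :: "real \<times> 'd \<times> 'n"
  obtain t x w s y v where ab: "a = (t, x, w)" "b = (s, y, v)" by (metis prod_cases3)
  have "dist (V (max 0 t) x w) (V (max 0 s) y v) \<le> L * dist (max 0 t, x, w) (max 0 s, y, v)"
    using lipschitz_onD[OF assms, of "(max 0 t, x, w)" "(max 0 s, y, v)"] by simp
  also have "dist (max 0 t, x, w) (max 0 s, y, v) \<le> dist (t, x, w) (s, y, v)"
  proof -
    have "\<bar>max 0 t - max 0 s\<bar> \<le> \<bar>t - s\<bar>" by (simp add: max_def)
    then have "(dist (max 0 t) (max 0 s))\<^sup>2 \<le> (dist t s)\<^sup>2"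
      unfolding dist_real_def by (intro power_mono) auto
    then show ?thesis
      unfolding dist_Pair_Pair[of "max 0 t"] dist_Pair_Pair[of t] by (intro real_sqrt_le_mono add_right_mono)
  qed
  finally show "dist (case a of (t, x, w) \<Rightarrow> V (max 0 t) x w) (case b of (t, x, w) \<Rightarrow> V (max 0 t) x w) \<le> L * dist a b"
    using L by (simp add: ab mult_left_mono)
qed

text \<open>Chosen to meet \<open>T_flow\<close> and \<open>T_contraction\<close> together. The
  absolute values and the added ones make it positive for all arguments, including L = 0 and K =
  0.\<close>

definition life_span :: "nat \<Rightarrow> real \<Rightarrow> real \<Rightarrow> real" where
  "life_span d L K = 1 / (3 * (1 + 2 * 2 ^ d) * (\<bar>L\<bar> + 1) * (\<bar>K\<bar> + 1))"

lemma life_span_pos: "0 < life_span d L K"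
  unfolding life_span_def by (intro divide_pos_pos mult_pos_pos add_pos_nonneg add_nonneg_pos) auto

lemma life_span_bounds:
  assumes "0 \<le> L" "0 \<le> K"
  shows "life_span d L K * L * (1 + K) \<le> 1 / 3"
    and "(1 + 2 * 2 ^ d) * K * (3 / 2 * (life_span d L K * L)) \<le> 1 / 2"
proof -
  let ?c = "1 + 2 * 2 ^ d :: real"
  have c: "1 \<le> ?c" by simp
  define P where "P = 3 * (?c * ((L + 1) * (K + 1)))"
  have eq: "life_span d L K = 1 / P" using assms by (simp add: life_span_def P_def mult.assoc)
  have P: "0 < P" unfolding P_def using assms c by (intro mult_pos_pos add_pos_nonneg add_nonneg_pos) auto
  have "L * (1 + K) \<le> (L + 1) * (K + 1)" using assms by (simp add: algebra_simps)
  also have "\<dots> \<le> ?c * ((L + 1) * (K + 1))"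
    using mult_right_mono[OF c, of "(L + 1) * (K + 1)"] assms by simp
  finally have "L * (1 + K) \<le> P / 3" by (simp add: P_def)
  then have "L * (1 + K) / P \<le> 1 / 3" using P by (simp add: divide_le_eq)
  then show "life_span d L K * L * (1 + K) \<le> 1 / 3" by (simp add: eq)
  have "K * L \<le> (L + 1) * (K + 1)" using assms by (simp add: algebra_simps)
  then have "?c * (K * L) \<le> ?c * ((L + 1) * (K + 1))" using c by (intro mult_left_mono) auto
  then have "?c * (K * L) \<le> P / 3" by (simp add: P_def)
  then have "?c * (K * L) / P \<le> 1 / 3" using P by (simp add: divide_le_eq)
  then have "3 / 2 * (?c * (K * L) / P) \<le> 3 / 2 * (1 / 3)" by (rule mult_left_mono) simp
  moreover have "?c * K * (3 / 2 * (life_span d L K * L)) = 3 / 2 * (?c * (K * L) / P)"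
    using P by (simp add: eq field_simps)
  ultimately show "?c * K * (3 / 2 * (life_span d L K * L)) \<le> 1 / 2" by simp
qed

text \<open>The construction runs with \<open>V (max 0 t)\<close> and with the Borel versions fixed
  by the locale; \<open>dist_sol_cong\<close> transfers the result to the given data.\<close>

lemma (in transported_kernel) ex_dist_sol_upto:
  fixes V :: "real \<Rightarrow> 'd \<Rightarrow> 'n \<Rightarrow> 'd"
  assumes V: "L-lipschitz_on ({0..} \<times> UNIV) (\<lambda>(t, x, w). V t x w)"
    and \<eta>: "\<eta>1 \<in> borel_measurable lebesgue" "AE x in lborel. \<eta>1 x = \<eta> x" "loc_integrable_on UNIV \<eta>1"
    and u1: "u1 \<in> borel_measurable lebesgue" "AE x in lborel. u1 x = u0 x" "loc_integrable_on UNIV u1"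
  shows "\<exists>u. u \<in> borel_measurable borel \<and> dist_sol_upto V \<eta>1 u1 (life_span DIM('d) L K) u
    \<and> (\<forall>B. (\<forall>y. \<bar>u0 y\<bar> \<le> B) \<longrightarrow> (\<forall>p. \<bar>u p\<bar> \<le> 4 ^ DIM('d) * B))
    \<and> (\<forall>q>1. AE t in lborel. (\<integral>\<^sup>+x. ennreal (\<bar>u (t, x)\<bar> powr q) \<partial>lborel) \<le>
         ennreal ((4 ^ DIM('d)) powr (q - 1)) * (\<integral>\<^sup>+y. ennreal (\<bar>u0 y\<bar> powr q) \<partial>lborel))"
proof -
  have L: "0 \<le> L" using V by (rule lipschitz_on_nonneg)
  interpret nonlocal_flow \<eta> u0 K "\<lambda>t. V (max 0 t)" L "life_span DIM('d) L K"
    using lipschitz_on_extend_time[OF V] life_span_pos life_span_bounds[OF L K_nonneg]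
    by unfold_locales auto
  obtain u where u: "u \<in> borel_measurable borel"
    "\<forall>T'. 0 < T' \<longrightarrow> T' \<le> life_span DIM('d) L K \<longrightarrow> dist_sol (\<lambda>t. V (max 0 t)) \<eta> u0 T' u"
    "\<forall>B. (\<forall>y. \<bar>u0 y\<bar> \<le> B) \<longrightarrow> (\<forall>p. \<bar>u p\<bar> \<le> 4 ^ DIM('d) * B)"
    "\<forall>q>1. AE t in lborel. (\<integral>\<^sup>+x. ennreal (\<bar>u (t, x)\<bar> powr q) \<partial>lborel) \<le>
     ennreal ((4 ^ DIM('d)) powr (q - 1)) * (\<integral>\<^sup>+y. ennreal (\<bar>u0 y\<bar> powr q) \<partial>lborel)"
    using ex_dist_sol[OF loc_integrable_cong_AE[OF \<eta>(3) eta_borel \<eta>(2)] loc_integrable_cong_AE[OF u1(3) u0_borel u1(2)]]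
    by (elim exE conjE)
  have "dist_sol_upto V \<eta>1 u1 (life_span DIM('d) L K) u"
    unfolding dist_sol_upto_def
  proof safe
    fix T' assume "0 < T'" "T' < life_span DIM('d) L K"
    then show "dist_sol V \<eta>1 u1 T' u"
      using u(2) by (intro dist_sol_cong[where V' = "\<lambda>t. V (max 0 t)", OF _ u(1) _ \<eta>(1) eta_borel \<eta>(2) u1(1) u0_borel u1(2) \<eta>(3) u1(3)]) auto
  qed
  with u(1,3,4) show ?thesis by (intro exI[of _ u] conjI)
qed

text \<open>\<open>real_of_ereal\<close> returns 0 at infinite values, so the essential supremum is
  first shown to be finite. It is nonnegative because Lebesgue measure is nonzero, so that some
  point satisfies the almost everywhere bound.\<close>

lemma Linf_norm_AE:
  assumes "Linf u0" shows "AE x in lebesgue. \<bar>u0 x\<bar> \<le> Linf_norm u0" "0 \<le> Linf_norm u0"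
proof -
  let ?e = "esssup lebesgue (\<lambda>x. ereal \<bar>u0 x\<bar>)"
  obtain M where M: "AE x in lebesgue. \<bar>u0 x\<bar> \<le> M" and [measurable]: "u0 \<in> borel_measurable lebesgue"
    using assms unfolding Linf_def by auto
  have ae: "AE x in lebesgue. ereal \<bar>u0 x\<bar> \<le> ?e" by (rule esssup_AE)
  have le: "?e \<le> ereal M" using M by (intro esssup_I) auto
  obtain x where "ereal \<bar>u0 x\<bar> \<le> ?e" using AE_lborel_ex[OF ae[unfolded AE_completion_iff]] by (elim exE)
  then have ge: "0 \<le> ?e" by (metis abs_ge_zero ereal_less_eq(5) order_trans)
  then have eq: "ereal (Linf_norm u0) = ?e"
    unfolding Linf_norm_def using le by (intro ereal_real') auto
  show "AE x in lebesgue. \<bar>u0 x\<bar> \<le> Linf_norm u0"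
    using ae unfolding eq[symmetric] by simp
  show "0 \<le> Linf_norm u0" using ge unfolding eq[symmetric] by simp
qed

lemma Linf_loc_integrable:
  fixes u0 :: "'a::euclidean_space \<Rightarrow> real"
  assumes "Linf u0" shows "loc_integrable_on UNIV u0"
  unfolding loc_integrable_on_def set_integrable_def
proof safe
  fix K :: "'a set" assume K: "compact K"
  have [measurable]: "u0 \<in> borel_measurable lebesgue" "K \<in> sets lebesgue"
    using assms K by (auto simp: Linf_def compact_imp_closed borel_closed)
  show "integrable lebesgue (\<lambda>x. indicator K x *\<^sub>R u0 x)"
  proof (rule Bochner_Integration.integrable_bound)
    show "integrable lebesgue (\<lambda>x. indicator K x * Linf_norm u0)"
      using emeasure_compact_finite[OF K]
      by (intro integrable_mult_left integrable_real_indicator) (auto simp: compact_imp_closed borel_closed K)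
    show "AE x in lebesgue. norm (indicator K x *\<^sub>R u0 x) \<le> norm (indicator K x * Linf_norm u0)"
      using Linf_norm_AE(1)[OF assms] by eventually_elim (auto simp: indicator_def)
  qed measurable
qed

text \<open>Beyond \<open>L\<close> and the dimensions the life span sees only the constant
  \<open>K\<close> of the kernel, so \<open>F\<close> is \<open>life_span\<close> composed with the
  formula for \<open>K\<close> in each case; the dimensions enter through the types.\<close>

theorem theorem1p1:
  shows "(\<exists>F :: real \<Rightarrow> real \<Rightarrow> real \<Rightarrow> real.
            \<forall>(L::real) (V :: real \<Rightarrow> 'd::euclidean_space \<Rightarrow> 'n::euclidean_space \<Rightarrow> 'd)
              (\<eta> :: 'd \<Rightarrow> 'n) (u0 :: 'd \<Rightarrow> real).
              lipschitz_on L ({0..} \<times> UNIV) (\<lambda>(t, x, w). V t x w) \<and> is_BV \<eta> \<and> Linf u0 \<longrightarrow>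
              0 < F L (total_variation \<eta>) (Linf_norm u0) \<and>
              (\<exists>u. dist_sol_upto V \<eta> u0 (F L (total_variation \<eta>) (Linf_norm u0)) u \<and>
                   Linf_loc_Linf (F L (total_variation \<eta>) (Linf_norm u0)) u))
       \<and>
       (\<forall>p::real. 1 < p \<longrightarrow>
          (\<exists>F :: real \<Rightarrow> real \<Rightarrow> real \<Rightarrow> real.
            \<forall>(L::real) (V :: real \<Rightarrow> 'd \<Rightarrow> 'n \<Rightarrow> 'd) (\<eta> :: 'd \<Rightarrow> 'n) (G :: 'n \<Rightarrow> 'd \<Rightarrow> 'd)
              (u0 :: 'd \<Rightarrow> real).
              lipschitz_on L ({0..} \<times> UNIV) (\<lambda>(t, x, w). V t x w) \<and>
              Lp p \<eta> \<and> weak_grad \<eta> G \<and> Lp p (frob G) \<and> Lp (p / (p - 1)) u0 \<longrightarrow>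
              0 < F L (Lp_norm p (frob G)) (Lp_norm (p / (p - 1)) u0) \<and>
              (\<exists>u. dist_sol_upto V \<eta> u0 (F L (Lp_norm p (frob G)) (Lp_norm (p / (p - 1)) u0)) u \<and>
                   Linf_loc_Lq (p / (p - 1)) (F L (Lp_norm p (frob G)) (Lp_norm (p / (p - 1)) u0)) u)))"
proof (intro conjI allI impI, goal_cases)
  case 1
  let ?F = "\<lambda>L tv U. life_span DIM('d) L (U * 4 ^ DIM('d) * (real DIM('n) * (tv * real DIM('d))))"
  show ?case
  proof (intro exI[of _ ?F] allI impI conjI life_span_pos; elim conjE)
    fix L and V :: "real \<Rightarrow> 'd \<Rightarrow> 'n \<Rightarrow> 'd" and \<eta> :: "'d \<Rightarrow> 'n" and u0 :: "'d \<Rightarrow> real"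
    assume V: "lipschitz_on L ({0..} \<times> UNIV) (\<lambda>(t, x, w). V t x w)" and BV: "is_BV \<eta>" and u0: "Linf u0"
    have \<eta>m: "\<eta> \<in> borel_measurable lebesgue" and u0m: "u0 \<in> borel_measurable lebesgue"
      using BV u0 by (auto simp: is_BV_def Linf_def)
    obtain \<eta>' where \<eta>': "\<eta>' \<in> borel_measurable borel" "AE x in lborel. \<eta> x = \<eta>' x"
      using ex_borel_version[OF \<eta>m] by blast
    obtain u1 where u1: "u1 \<in> borel_measurable borel" "AE x in lborel. u0 x = u1 x"
      using ex_borel_version[OF u0m] by blast
    define U where "U = Linf_norm u0"
    have U: "0 \<le> U" "AE x in lborel. \<bar>u0 x\<bar> \<le> U"
      using Linf_norm_AE[OF u0] by (auto simp: U_def AE_completion_iff)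
    \<comment> \<open>Clamping makes the bound \<open>U\<close> hold at every point, as the kernel
      estimate requires, and changes the Borel version on a null set only.\<close>
    define u0' where "u0' x = max (- U) (min U (u1 x))" for x
    have u0': "u0' \<in> borel_measurable borel" using u1(1) unfolding u0'_def by measurable
    have u0'_ae: "AE x in lborel. u0 x = u0' x"
      using u1(2) U(2) by eventually_elim (auto simp: u0'_def)
    have u0'_le: "\<bar>u0' x\<bar> \<le> U" for x using U(1) by (auto simp: u0'_def)
    have \<eta>_loc: "loc_integrable_on UNIV \<eta>"
      using BV unfolding is_BV_def loc_integrable_on_def set_integrable_def
      by (auto intro!: integrable_mult_indicator simp: compact_imp_closed borel_closed)
    interpret transported_kernel \<eta>' u0' "U * 4 ^ DIM('d) * (real DIM('n) * (total_variation \<eta> * real DIM('d)))"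
      by (rule BV_transported_kernel[OF BV \<eta>' u0' u0'_le])
    obtain u where u: "u \<in> borel_measurable borel"
      "dist_sol_upto V \<eta> u0 (?F L (total_variation \<eta>) U) u"
      "\<forall>B. (\<forall>y. \<bar>u0' y\<bar> \<le> B) \<longrightarrow> (\<forall>p. \<bar>u p\<bar> \<le> 4 ^ DIM('d) * B)"
      using ex_dist_sol_upto[OF V \<eta>m \<eta>'(2) \<eta>_loc u0m u0'_ae Linf_loc_integrable[OF u0]]
      by (elim exE conjE)
    have "Linf_loc_Linf (?F L (total_variation \<eta>) U) u"
      unfolding Linf_loc_Linf_def
    proof (intro conjI allI impI)
      show "u \<in> borel_measurable lebesgue" using u(1) by (intro measurable_completion) simp
      show "\<exists>M. AE z in lebesgue. z \<in> {0<..<T} \<times> UNIV \<longrightarrow> \<bar>u z\<bar> \<le> M" for T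
        using u(3)[rule_format, OF u0'_le] by (intro exI[of _ "4 ^ DIM('d) * U"]) simp
    qed
    then show "\<exists>u. dist_sol_upto V \<eta> u0 (?F L (total_variation \<eta>) (Linf_norm u0)) u \<and>
                   Linf_loc_Linf (?F L (total_variation \<eta>) (Linf_norm u0)) u"
      using u(2) unfolding U_def by blast
  qed
next
  case (2 p)
  then have p: "1 < p" .
  define q where "q = p / (p - 1)"
  have q: "1 < q" using p by (simp add: q_def field_simps)
  \<comment> \<open>\<open>U powr q\<close> is the integral of |u0|^q when \<open>U\<close> is the
    norm; it is the \<open>A\<close> of \<open>Sobolev_transported_kernel\<close>.\<close>
  let ?F = "\<lambda>L g U. life_span DIM('d) L (real DIM('n) * (2 * ((g + 1) * real DIM('d)) * (4 ^ DIM('d) + U powr q)))"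
  show ?case
    unfolding q_def[symmetric]
  proof (intro exI[of _ ?F] allI impI conjI life_span_pos; elim conjE)
    fix L and V :: "real \<Rightarrow> 'd \<Rightarrow> 'n \<Rightarrow> 'd" and \<eta> :: "'d \<Rightarrow> 'n" and G :: "'n \<Rightarrow> 'd \<Rightarrow> 'd" and u0 :: "'d \<Rightarrow> real"
    assume V: "lipschitz_on L ({0..} \<times> UNIV) (\<lambda>(t, x, w). V t x w)"
      and \<eta>: "Lp p \<eta>" and G: "weak_grad \<eta> G" "Lp p (frob G)" and u0: "Lp q u0"
    have \<eta>m: "\<eta> \<in> borel_measurable lebesgue" and u0m: "u0 \<in> borel_measurable lebesgue"
      using \<eta> u0 by (auto simp: Lp_def)
    obtain \<eta>' where \<eta>': "\<eta>' \<in> borel_measurable borel" "AE x in lborel. \<eta> x = \<eta>' x"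
      using ex_borel_version[OF \<eta>m] by blast
    obtain u0' where u0': "u0' \<in> borel_measurable borel" "AE x in lborel. u0 x = u0' x"
      using ex_borel_version[OF u0m] by blast
    define A where "A = Lp_norm q u0 powr q"
    have A0: "0 \<le> A" by (simp add: A_def)
    have A: "(\<integral>\<^sup>+y. ennreal (\<bar>u0' y\<bar> powr q) \<partial>lborel) = ennreal A"
    proof -
      have "(\<integral>\<^sup>+y. ennreal (\<bar>u0' y\<bar> powr q) \<partial>lborel) = (\<integral>\<^sup>+y. ennreal (norm (u0 y) powr q) \<partial>lebesgue)"
        unfolding nn_integral_completion using u0'(2) by (intro nn_integral_cong_AE) auto
      also have "\<dots> = ennreal (LINT y|lebesgue. norm (u0 y) powr q)"
        using u0 by (intro nn_integral_eq_integral) (auto simp: Lp_def)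
      finally show ?thesis using q Lp_norm_powr[of q u0] by (simp add: A_def)
    qed
    interpret transported_kernel \<eta>' u0' "real DIM('n) * (2 * ((Lp_norm p (frob G) + 1) * real DIM('d)) * (4 ^ DIM('d) + A))"
      by (rule Sobolev_transported_kernel[OF p \<eta> G \<eta>' u0'(1) A[unfolded q_def] A0])
    obtain u where u: "u \<in> borel_measurable borel"
      "dist_sol_upto V \<eta> u0 (life_span DIM('d) L (real DIM('n) * (2 * ((Lp_norm p (frob G) + 1) * real DIM('d)) * (4 ^ DIM('d) + A)))) u"
      "\<forall>q>1. AE t in lborel. (\<integral>\<^sup>+x. ennreal (\<bar>u (t, x)\<bar> powr q) \<partial>lborel) \<le>
         ennreal ((4 ^ DIM('d)) powr (q - 1)) * (\<integral>\<^sup>+y. ennreal (\<bar>u0' y\<bar> powr q) \<partial>lborel)"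
      using ex_dist_sol_upto[OF V \<eta>m \<eta>'(2) Lp_imp_loc_integrable[OF less_imp_le[OF p] \<eta>] u0m u0'(2)
            Lp_imp_loc_integrable[OF less_imp_le[OF q] u0]]
      by (elim exE conjE)
    have slices: "AE t in lebesgue. integrable lebesgue (\<lambda>x. \<bar>u (t, x)\<bar> powr q) \<and>
        (LINT x|lebesgue. \<bar>u (t, x)\<bar> powr q) \<le> (4 ^ DIM('d)) powr (q - 1) * A"
    proof (rule AE_completion)
      show "AE t in lborel. integrable lebesgue (\<lambda>x. \<bar>u (t, x)\<bar> powr q) \<and>
        (LINT x|lebesgue. \<bar>u (t, x)\<bar> powr q) \<le> (4 ^ DIM('d)) powr (q - 1) * A"
        using u(3)[rule_format, OF q, unfolded A]
      proof eventually_elim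
        case (elim t)
        have "(\<lambda>x. (t, x)) \<in> borel_measurable borel"
          by (intro borel_measurable_continuous_onI continuous_intros)
        from measurable_compose[OF this u(1)] have [measurable]: "(\<lambda>x. u (t, x)) \<in> borel_measurable borel" .
        have le: "(\<integral>\<^sup>+x. ennreal (\<bar>u (t, x)\<bar> powr q) \<partial>lborel) \<le> ennreal ((4 ^ DIM('d)) powr (q - 1) * A)"
          using elim A0 by (simp add: ennreal_mult)
        have int: "integrable lborel (\<lambda>x. \<bar>u (t, x)\<bar> powr q)"
          using le by (intro integrableI_bounded) (auto intro: le_less_trans)
        then have "ennreal (LINT x|lborel. \<bar>u (t, x)\<bar> powr q) \<le> ennreal ((4 ^ DIM('d)) powr (q - 1) * A)"
          using le by (simp add: nn_integral_eq_integral)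
        then have "(LINT x|lborel. \<bar>u (t, x)\<bar> powr q) \<le> (4 ^ DIM('d)) powr (q - 1) * A"
          using A0 by (subst (asm) ennreal_le_iff) auto
        then show ?case using int by (simp add: integrable_completion integral_completion)
      qed
    qed
    have "Linf_loc_Lq q (?F L (Lp_norm p (frob G)) (Lp_norm q u0)) u"
      unfolding Linf_loc_Lq_def
    proof (intro conjI allI impI)
      show "u \<in> borel_measurable lebesgue" using u(1) by (intro measurable_completion) simp
      show "\<exists>M. AE t in lebesgue. 0 < t \<and> t < T \<longrightarrow>
          integrable lebesgue (\<lambda>x. \<bar>u (t, x)\<bar> powr q) \<and> (LINT x|lebesgue. \<bar>u (t, x)\<bar> powr q) \<le> M" for T
        by (rule exI[of _ "(4 ^ DIM('d)) powr (q - 1) * A"], rule eventually_mono[OF slices]) simp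
    qed
    then show "\<exists>u. dist_sol_upto V \<eta> u0 (?F L (Lp_norm p (frob G)) (Lp_norm q u0)) u \<and>
                 Linf_loc_Lq q (?F L (Lp_norm p (frob G)) (Lp_norm q u0)) u"
      using u(2) unfolding A_def by blast
  qed
qed

end
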